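(* Let $\alpha\in\mathsf{RX}$ be a regex over $\Sigma$, and let $n$ denote the number of occurrences of terminals and variable references in $\alpha$. One can construct a memory automaton with rejecting trap-state $\mathcal{M}(\alpha)\in\mathsf{TMFA^{rej}}$ with $n+2$ states such that $\mathcal{L}(\mathcal{M}(\alpha))=\mathcal{L}(\alpha)$ and such that $\mathcal{M}(\alpha)$ is deterministic if and only if $\alpha$ is deterministic. Moreover, there is an algorithm that, given $\alpha$, in time $O(|\Sigma||\alpha|n)$ either (1) computes $\mathcal{M}(\alpha)$ if $\alpha$ is deterministic, or (2) detects that $\alpha$ is not deterministic.
   Context: Regex. Let $\Sigma$ be a finite terminal alphabet ($|\Sigma|\ge 2$ unless otherwise noted) and $\Xi$ an infinite variable alphabet disjoint from $\Sigma$. The set $\mathsf{RX}$ of regex, with $\mathsf{var}(\alpha)\subset\Xi$ the set of variables occurring in $\alpha$, is defined recursively: every $a\in\Sigma\cup\{\varepsilon\}$ is a regex; $\&x$ (variable reference) for $x\in\Xi$; $(\alpha\cdot\beta)$, $(\alpha\vee\beta)$, $(\alpha^+)$ for $\alpha,\beta\in\mathsf{RX}$; and $\langle x:\alpha\rangle$ (variable binding) for $\alpha\in\mathsf{RX}$ and $x\in\Xi\setminus\mathsf{var}(\alpha)$. Also $\emptyset$ is a regex, but may not occur inside another regex. $\alpha^*$ abbreviates $\varepsilon\vee\alpha^+$; a nonempty set $A\subseteq\Sigma$ abbreviates $\bigvee_{a\in A}a$. Let $\Gamma=\{[_x,]_x\mid x\in\Xi\}$. The ref-language $\mathcal{R}(\alpha)\subseteq(\Sigma\cup\Xi\cup\Gamma)^*$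 is given by $\mathcal{R}(\emptyset)=\emptyset$, $\mathcal{R}(a)=\{a\}$ for $a\in\Sigma\cup\{\varepsilon\}$, $\mathcal{R}(\&x)=\{x\}$, $\mathcal{R}(\langle x:\alpha\rangle)=[_x\mathcal{R}(\alpha)]_x$, $\mathcal{R}(\alpha\cdot\beta)=\mathcal{R}(\alpha)\mathcal{R}(\beta)$, $\mathcal{R}(\alpha\vee\beta)=\mathcal{R}(\alpha)\cup\mathcal{R}(\beta)$, $\mathcal{R}(\alpha^+)=\mathcal{R}(\alpha)^+$. For $r\in\mathcal{R}(\alpha)$, the dereference $\mathcal{D}(r)\in\Sigma^*$ is obtained by replacing each occurrence of a variable $x$ by $v$, where $[_x v]_x$ is the nearest such factor to the left of this occurrence (or by $\varepsilon$ if there is none; variables inside $v$ are replaced likewise), and then deleting all symbols of $\Gamma$. $\mathcal{L}(\alpha)=\{\mathcal{D}(r)\mid r\in\mathcal{R}(\alpha)\}$. Deterministic regex. Let $\alpha_{\mathcal{R}}$ be the regular expression over $\Sigma\cup\Xi\cup\Gamma$ obtained from $\alpha$ by replacing each $\langle x:\beta\rangle$ by $[_x\beta_{\mathcal{R}}]_x$ and each $\&x$ by $x$. The marked regex $\tilde\alpha$ is obtained from $\alpha_{\mathcal{R}}$ by attaching to each occurrence of a symbol $\chi\in\Sigma\cup\Xi\cup\Gamma$ its own unique number $i$, written $\chi_{(i)}$; $\mathcal{R}(\tilde\alpha)$ is the language of marked ref-words it generates. $\tilde A$ denotes the set of marked symbols from $A$. A regex $\alpha$ is not deterministic if there exist $\rho_1,\rho_2\in\mathcal{R}(\tilde\alpha)$,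 $r,s_1,s_2\in(\tilde\Sigma\cup\tilde\Xi\cup\tilde\Gamma)^*$ and $\gamma_1,\gamma_2\in\tilde\Gamma^*$ such that one of the following holds: (1) $\rho_1=r\gamma_1a_{(i)}s_1$ and $\rho_2=r\gamma_2a_{(j)}s_2$ with $a\in\Sigma$, $i\ne j$; (2) $\rho_1=r\gamma_1x_{(i)}s_1$ and $\rho_2=r\gamma_2\chi_{(j)}s_2$ with $x\in\Xi$, $\chi\in\Sigma\cup\Xi$, $i\neq j$; (3) $\rho_1=r\gamma_1\chi_{(i)}s_1$ and $\rho_2=r\gamma_2\chi_{(i)}s_2$ with $\chi\in\Sigma\cup\Xi$, $\gamma_1\ne\gamma_2$; (4) $\rho_1=r\gamma_1$ and $\rho_2=r\gamma_2$ with $\gamma_1\neq\gamma_2$. Otherwise $\alpha$ is deterministic. Memory automata with trap-state. A $\mathsf{TMFA}$ with $k$ memories is $M=(Q,\Sigma,\delta,q_0,F)$ with finite state set $Q$ containing a special state $[\mathsf{trap}]$, initial state $q_0\in Q$, final states $F\subseteq Q$, and $\delta: Q\times(\Sigma\cup\{\varepsilon\}\cup\{1,\dots,k\})\to\mathcal{P}(Q\times\{\mathtt{o},\mathtt{c},\mathtt{r},\diamond\}^k)$, where $\delta([\mathsf{trap}],b)=\{([\mathsf{trap}],\diamond,\dots,\diamond)\}$ for $b\in\Sigma$ and $\delta([\mathsf{trap}],b)=\emptyset$ for other $b$. A configuration is $(q,w,(u_1,r_1),\dots,(u_k,r_k))$ with state $q$, remaining input $w$, memory contents $u_i\in\Sigma^*$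 and statuses $r_i\in\{\mathtt{O},\mathtt{C}\}$ (open/closed). The initial configuration on $w$ is $(q_0,w,(\varepsilon,\mathtt{C}),\dots,(\varepsilon,\mathtt{C}))$; a configuration is accepting if $w=\varepsilon$ and $q\in F$. $M$ can move from $(q,vw,(u_i,r_i)_i)$ to $(p,w,(u_i',r_i')_i)$ if there is $(p,s_1,\dots,s_k)\in\delta(q,b)$ with either $b\in\Sigma\cup\{\varepsilon\}$, $v=b$, or $b\in\{1,\dots,k\}$, $s_b=\mathtt{c}$, $v=u_b$ (memory recall), and for every $i$: $s_i=\diamond$, $r_i=\mathtt{O}$ give $(u_iv,\mathtt{O})$; $s_i=\diamond$, $r_i=\mathtt{C}$ give $(u_i,\mathtt{C})$; $s_i=\mathtt{o}$ gives $(v,\mathtt{O})$; $s_i=\mathtt{c}$ gives $(u_i,\mathtt{C})$; $s_i=\mathtt{r}$ gives $(\varepsilon,\mathtt{C})$. Furthermore (memory recall failure), $M$ can move from $(q,vw,(u_i,r_i)_i)$ to $([\mathsf{trap}],w,(u_i,r_i)_i)$ if there is $(p,s_1,\dots,s_k)\in\delta(q,b)$ with $b\in\{1,\dots,k\}$, $s_b=\mathtt{c}$, $u_b=vv'$, $v'\ne\varepsilon$, and $w=\varepsilon$ or the first letters of $v'$ and $w$ differ. $\mathcal{L}(M)$ is the set of $w\in\Sigma^*$ for which an accepting configuration is reachable from the initial configuration on $w$. $\mathsf{TMFA^{rej}}$ denotes the $\mathsf{TMFA}$ with $[\mathsf{trap}]\notin F$. A $\mathsf{TMFA}$ is deterministic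 if $|\delta(q,b)|\le1$ for all $q,b$, and whenever $\delta(q,x)\neq\emptyset$ for some $x\in\{1,\dots,k\}\cup\{\varepsilon\}$, then $\delta(q,y)=\emptyset$ for all $y\ne x$. *)

theory Defs
  imports Main
begin

section \<open>Regex with backreferences\<close>

text \<open>Terminals and variables live in separate types, so the two alphabets are disjoint. The raw
  type also contains terms that are not regex; these are excluded by \<open>RX\<close> below.\<close>

datatype ('a, 'v) rx =
    REmpty
  | REps
  | RTerm 'a
  | RRef 'v
  | RCat "('a, 'v) rx" "('a, 'v) rx"
  | RAlt "('a, 'v) rx" "('a, 'v) rx"
  | RPlus "('a, 'v) rx"
  | RBind 'v "('a, 'v) rx"

fun rx_vars :: "('a, 'v) rx \<Rightarrow> 'v set" where
  "rx_vars REmpty = {}"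
| "rx_vars REps = {}"
| "rx_vars (RTerm a) = {}"
| "rx_vars (RRef x) = {x}"
| "rx_vars (RCat \<alpha> \<beta>) = rx_vars \<alpha> \<union> rx_vars \<beta>"
| "rx_vars (RAlt \<alpha> \<beta>) = rx_vars \<alpha> \<union> rx_vars \<beta>"
| "rx_vars (RPlus \<alpha>) = rx_vars \<alpha>"
| "rx_vars (RBind x \<alpha>) = insert x (rx_vars \<alpha>)"

fun nonempty_rx :: "'a set \<Rightarrow> ('a, 'v) rx \<Rightarrow> bool" where
  "nonempty_rx A REmpty = False"
| "nonempty_rx A REps = True"
| "nonempty_rx A (RTerm a) = (a \<in> A)"
| "nonempty_rx A (RRef x) = True"
| "nonempty_rx A (RCat \<alpha> \<beta>) = (nonempty_rx A \<alpha> \<and> nonempty_rx A \<beta>)"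
| "nonempty_rx A (RAlt \<alpha> \<beta>) = (nonempty_rx A \<alpha> \<and> nonempty_rx A \<beta>)"
| "nonempty_rx A (RPlus \<alpha>) = nonempty_rx A \<alpha>"
| "nonempty_rx A (RBind x \<alpha>) = (nonempty_rx A \<alpha> \<and> x \<notin> rx_vars \<alpha>)"

definition RX :: "'a set \<Rightarrow> ('a, 'v) rx set" where
  "RX A = insert REmpty {\<alpha>. nonempty_rx A \<alpha>}"

text \<open>The size counts syntax tree nodes. The length of the fully parenthesised string differs from
  it by at most a constant factor.\<close>

fun rx_size :: "('a, 'v) rx \<Rightarrow> nat" where
  "rx_size REmpty = 1"
| "rx_size REps = 1"
| "rx_size (RTerm a) = 1"
| "rx_size (RRef x) = 1"
| "rx_size (RCat \<alpha> \<beta>) = 1 + rx_size \<alpha> + rx_size \<beta>"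
| "rx_size (RAlt \<alpha> \<beta>) = 1 + rx_size \<alpha> + rx_size \<beta>"
| "rx_size (RPlus \<alpha>) = 1 + rx_size \<alpha>"
| "rx_size (RBind x \<alpha>) = 1 + rx_size \<alpha>"

fun occurrences :: "('a, 'v) rx \<Rightarrow> nat" where
  "occurrences REmpty = 0"
| "occurrences REps = 0"
| "occurrences (RTerm a) = 1"
| "occurrences (RRef x) = 1"
| "occurrences (RCat \<alpha> \<beta>) = occurrences \<alpha> + occurrences \<beta>"
| "occurrences (RAlt \<alpha> \<beta>) = occurrences \<alpha> + occurrences \<beta>"
| "occurrences (RPlus \<alpha>) = occurrences \<alpha>"
| "occurrences (RBind x \<alpha>) = occurrences \<alpha>"


section \<open>Ref-words and the language of a regex\<close>

datatype ('a, 'v) sym = Tm 'a | Vr 'v | Op 'v | Cl 'v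

definition conc :: "'c list set \<Rightarrow> 'c list set \<Rightarrow> 'c list set" where
  "conc A B = {u @ v | u v. u \<in> A \<and> v \<in> B}"

definition plus_lang :: "'c list set \<Rightarrow> 'c list set" where
  "plus_lang A = {concat ws | ws. ws \<noteq> [] \<and> set ws \<subseteq> A}"

fun ref_lang :: "('a, 'v) rx \<Rightarrow> ('a, 'v) sym list set" where
  "ref_lang REmpty = {}"
| "ref_lang REps = {[]}"
| "ref_lang (RTerm a) = {[Tm a]}"
| "ref_lang (RRef x) = {[Vr x]}"
| "ref_lang (RCat \<alpha> \<beta>) = conc (ref_lang \<alpha>) (ref_lang \<beta>)"
| "ref_lang (RAlt \<alpha> \<beta>) = ref_lang \<alpha> \<union> ref_lang \<beta>"
| "ref_lang (RPlus \<alpha>) = plus_lang (ref_lang \<alpha>)"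
| "ref_lang (RBind x \<alpha>) = conc {[Op x]} (conc (ref_lang \<alpha>) {[Cl x]})"

text \<open>\<open>nearest x c\<close> searches a left context \<open>c\<close>, given in reverse (nearest symbol first), for the
  nearest factor that starts with \<open>Op x\<close>, ends with \<open>Cl x\<close> and has some word \<open>v\<close> in between. It
  returns \<open>v\<close> together with the reversed left context of that occurrence of \<open>v\<close>, whose first
  element is \<open>Op x\<close>. In ref-words of regex, bindings of the same variable are never nested, so
  the last \<open>Op x\<close> before the last \<open>Cl x\<close> is the matching one.\<close>

definition nearest ::
  "'v \<Rightarrow> ('a, 'v) sym list \<Rightarrow> (('a, 'v) sym list \<times> ('a, 'v) sym list) option" where
  "nearest x c =
    (let c1 = tl (dropWhile (\<lambda>s. s \<noteq> Cl x) c);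
         c2 = dropWhile (\<lambda>s. s \<noteq> Op x) c1
     in if c2 = [] then None else Some (c2, rev (takeWhile (\<lambda>s. s \<noteq> Op x) c1)))"

lemma nearest_length:
  assumes "nearest x c = Some (c2, v)"
  shows "length c2 + length v < length c"
proof -
  define c1 where "c1 = tl (dropWhile (\<lambda>s. s \<noteq> Cl x) c)"
  have c2: "c2 = dropWhile (\<lambda>s. s \<noteq> Op x) c1" "c2 \<noteq> []"
    and v: "v = rev (takeWhile (\<lambda>s. s \<noteq> Op x) c1)"
    using assms by (auto simp: nearest_def c1_def Let_def split: if_splits)
  have "length c2 + length v = length c1"
    unfolding c2(1) v
    by (metis add.commute length_append length_rev takeWhile_dropWhile_id)
  moreover have "c1 \<noteq> []" using c2 by auto
  moreover have "length (dropWhile (\<lambda>s. s \<noteq> Cl x) c) \<le> length c"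
    by (rule length_dropWhile_le)
  ultimately show ?thesis
    unfolding c1_def by (cases "dropWhile (\<lambda>s. s \<noteq> Cl x) c") auto
qed

text \<open>\<open>deref_in c r\<close> dereferences \<open>r\<close> where \<open>c\<close> is the reversed text to the left of \<open>r\<close>. Every
  variable occurrence, also one inside a recalled factor, is resolved with respect to its own
  position in the original ref-word.\<close>

function deref_in :: "('a, 'v) sym list \<Rightarrow> ('a, 'v) sym list \<Rightarrow> 'a list" where
  "deref_in c [] = []"
| "deref_in c (Tm a # r) = a # deref_in (Tm a # c) r"
| "deref_in c (Op x # r) = deref_in (Op x # c) r"
| "deref_in c (Cl x # r) = deref_in (Cl x # c) r"
| "deref_in c (Vr x # r) =
    (case nearest x c of None \<Rightarrow> [] | Some (c', v) \<Rightarrow> deref_in c' v) @ deref_in (Vr x # c) r"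
  by pat_completeness auto
termination
  by (relation "measures [\<lambda>(c, r). length c + length r, \<lambda>(c, r). length r]")
    (auto dest: nearest_length)

definition deref :: "('a, 'v) sym list \<Rightarrow> 'a list" where
  "deref r = deref_in [] r"

definition rx_lang :: "('a, 'v) rx \<Rightarrow> 'a list set" where
  "rx_lang \<alpha> = deref ` ref_lang \<alpha>"


section \<open>Deterministic regex\<close>

datatype 'c rexp =
  Zero | One | Atom 'c | Times "'c rexp" "'c rexp" | Or "'c rexp" "'c rexp" | Iter "'c rexp"

fun rexp_lang :: "'c rexp \<Rightarrow> 'c list set" where
  "rexp_lang Zero = {}"
| "rexp_lang One = {[]}"
| "rexp_lang (Atom c) = {[c]}"
| "rexp_lang (Times r s) = conc (rexp_lang r) (rexp_lang s)"
| "rexp_lang (Or r s) = rexp_lang r \<union> rexp_lang s"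
| "rexp_lang (Iter r) = plus_lang (rexp_lang r)"

fun ref_rexp :: "('a, 'v) rx \<Rightarrow> ('a, 'v) sym rexp" where
  "ref_rexp REmpty = Zero"
| "ref_rexp REps = One"
| "ref_rexp (RTerm a) = Atom (Tm a)"
| "ref_rexp (RRef x) = Atom (Vr x)"
| "ref_rexp (RCat \<alpha> \<beta>) = Times (ref_rexp \<alpha>) (ref_rexp \<beta>)"
| "ref_rexp (RAlt \<alpha> \<beta>) = Or (ref_rexp \<alpha>) (ref_rexp \<beta>)"
| "ref_rexp (RPlus \<alpha>) = Iter (ref_rexp \<alpha>)"
| "ref_rexp (RBind x \<alpha>) = Times (Atom (Op x)) (Times (ref_rexp \<alpha>) (Atom (Cl x)))"

lemma ref_lang_eq_rexp_lang: "ref_lang \<alpha> = rexp_lang (ref_rexp \<alpha>)"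
  by (induction \<alpha>) auto

fun atoms :: "'c rexp \<Rightarrow> nat" where
  "atoms Zero = 0"
| "atoms One = 0"
| "atoms (Atom c) = 1"
| "atoms (Times r s) = atoms r + atoms s"
| "atoms (Or r s) = atoms r + atoms s"
| "atoms (Iter r) = atoms r"

text \<open>\<open>mark i r\<close> numbers the symbol occurrences of \<open>r\<close> from left to right, starting with \<open>i\<close>.\<close>

fun mark :: "nat \<Rightarrow> 'c rexp \<Rightarrow> ('c \<times> nat) rexp" where
  "mark i Zero = Zero"
| "mark i One = One"
| "mark i (Atom c) = Atom (c, i)"
| "mark i (Times r s) = Times (mark i r) (mark (i + atoms r) s)"
| "mark i (Or r s) = Or (mark i r) (mark (i + atoms r) s)"
| "mark i (Iter r) = Iter (mark i r)"

definition marked_lang :: "('a, 'v) rx \<Rightarrow> (('a, 'v) sym \<times> nat) list set" where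
  "marked_lang \<alpha> = rexp_lang (mark 0 (ref_rexp \<alpha>))"

definition bracket_syms :: "('a, 'v) sym set" where
  "bracket_syms = range Op \<union> range Cl"

definition letter_syms :: "('a, 'v) sym set" where
  "letter_syms = range Tm \<union> range Vr"

definition bracket_words :: "(('a, 'v) sym \<times> nat) list set" where
  "bracket_words = lists (bracket_syms \<times> UNIV)"

definition nondeterministic_rx :: "('a, 'v) rx \<Rightarrow> bool" where
  "nondeterministic_rx \<alpha> \<longleftrightarrow>
    (\<exists>\<rho>1 \<in> marked_lang \<alpha>. \<exists>\<rho>2 \<in> marked_lang \<alpha>.
     \<exists>r s1 s2. \<exists>\<gamma>1 \<in> bracket_words. \<exists>\<gamma>2 \<in> bracket_words.
       (\<exists>a i j. \<rho>1 = r @ \<gamma>1 @ (Tm a, i) # s1 \<and> \<rho>2 = r @ \<gamma>2 @ (Tm a, j) # s2 \<and> i \<noteq> j)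
     \<or> (\<exists>x i j. \<exists>\<chi> \<in> letter_syms.
          \<rho>1 = r @ \<gamma>1 @ (Vr x, i) # s1 \<and> \<rho>2 = r @ \<gamma>2 @ (\<chi>, j) # s2 \<and> i \<noteq> j)
     \<or> (\<exists>i. \<exists>\<chi> \<in> letter_syms.
          \<rho>1 = r @ \<gamma>1 @ (\<chi>, i) # s1 \<and> \<rho>2 = r @ \<gamma>2 @ (\<chi>, i) # s2 \<and> \<gamma>1 \<noteq> \<gamma>2)
     \<or> (\<rho>1 = r @ \<gamma>1 \<and> \<rho>2 = r @ \<gamma>2 \<and> \<gamma>1 \<noteq> \<gamma>2))"

definition deterministic_rx :: "('a, 'v) rx \<Rightarrow> bool" where
  "deterministic_rx \<alpha> \<longleftrightarrow> \<not> nondeterministic_rx \<alpha>"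


section \<open>Memory automata with trap-state\<close>

datatype 'a label = LTerm 'a | LEps | LMem nat

datatype action = AOpen | AClose | AReset | AKeep

datatype status = Opened | Closed

text \<open>Memories are numbered from 1 to \<open>memories M\<close>; the component of memory \<open>i\<close> in a list of
  actions or memories has list index \<open>i - 1\<close>.\<close>

record ('q, 'a) tmfa =
  states :: "'q set"
  alphabet :: "'a set"
  memories :: nat
  delta :: "'q \<Rightarrow> 'a label \<Rightarrow> ('q \<times> action list) set"
  init :: 'q
  final :: "'q set"
  trap :: 'q

definition labels :: "('q, 'a) tmfa \<Rightarrow> 'a label set" where
  "labels M = LTerm ` alphabet M \<union> {LEps} \<union> LMem ` {1..memories M}"

text \<open>The transition function is required to be empty outside its domain, so that it is determined
  by its values on \<open>states M\<close> and \<open>labels M\<close>.\<close>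

definition is_tmfa :: "('q, 'a) tmfa \<Rightarrow> bool" where
  "is_tmfa M \<longleftrightarrow>
     finite (states M) \<and> finite (alphabet M) \<and>
     init M \<in> states M \<and> final M \<subseteq> states M \<and> trap M \<in> states M \<and>
     (\<forall>q b. delta M q b \<subseteq> states M \<times> {ss. length ss = memories M}) \<and>
     (\<forall>q b. q \<notin> states M \<or> b \<notin> labels M \<longrightarrow> delta M q b = {}) \<and>
     (\<forall>a \<in> alphabet M. delta M (trap M) (LTerm a) = {(trap M, replicate (memories M) AKeep)}) \<and>
     (\<forall>b. b \<notin> LTerm ` alphabet M \<longrightarrow> delta M (trap M) b = {})"

definition is_tmfa_rej :: "('q, 'a) tmfa \<Rightarrow> bool" where
  "is_tmfa_rej M \<longleftrightarrow> is_tmfa M \<and> trap M \<notin> final M"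

type_synonym 'a memory = "'a list \<times> status"
type_synonym ('q, 'a) config = "'q \<times> 'a list \<times> 'a memory list"

fun update_memory :: "'a list \<Rightarrow> action \<Rightarrow> 'a memory \<Rightarrow> 'a memory" where
  "update_memory v AKeep (u, Opened) = (u @ v, Opened)"
| "update_memory v AKeep (u, Closed) = (u, Closed)"
| "update_memory v AOpen (u, r) = (v, Opened)"
| "update_memory v AClose (u, r) = (u, Closed)"
| "update_memory v AReset (u, r) = ([], Closed)"

inductive move :: "('q, 'a) tmfa \<Rightarrow> ('q, 'a) config \<Rightarrow> ('q, 'a) config \<Rightarrow> bool"
  for M :: "('q, 'a) tmfa" where
  read: "(p, ss) \<in> delta M q (LTerm a) \<Longrightarrow>
     move M (q, [a] @ w, ms) (p, w, map2 (update_memory [a]) ss ms)"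
| eps: "(p, ss) \<in> delta M q LEps \<Longrightarrow>
     move M (q, w, ms) (p, w, map2 (update_memory []) ss ms)"
| recall: "(p, ss) \<in> delta M q (LMem i) \<Longrightarrow> ss ! (i - 1) = AClose \<Longrightarrow> v = fst (ms ! (i - 1)) \<Longrightarrow>
     move M (q, v @ w, ms) (p, w, map2 (update_memory v) ss ms)"
| failure: "(p, ss) \<in> delta M q (LMem i) \<Longrightarrow> ss ! (i - 1) = AClose \<Longrightarrow>
     fst (ms ! (i - 1)) = v @ v' \<Longrightarrow> v' \<noteq> [] \<Longrightarrow> w = [] \<or> hd v' \<noteq> hd w \<Longrightarrow>
     move M (q, v @ w, ms) (trap M, w, ms)"

definition tmfa_lang :: "('q, 'a) tmfa \<Rightarrow> 'a list set" where
  "tmfa_lang M = {w \<in> lists (alphabet M).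
     \<exists>q \<in> final M. \<exists>ms.
       (move M)\<^sup>*\<^sup>* (init M, w, replicate (memories M) ([], Closed)) (q, [], ms)}"

definition deterministic_tmfa :: "('q, 'a) tmfa \<Rightarrow> bool" where
  "deterministic_tmfa M \<longleftrightarrow>
     (\<forall>q \<in> states M. \<forall>b \<in> labels M. finite (delta M q b) \<and> card (delta M q b) \<le> 1) \<and>
     (\<forall>q \<in> states M. \<forall>x \<in> {LEps} \<union> LMem ` {1..memories M}.
        delta M q x \<noteq> {} \<longrightarrow> (\<forall>y \<in> labels M. y \<noteq> x \<longrightarrow> delta M q y = {}))"


section \<open>Random access machines\<close>

text \<open>Algorithms are programs of a unit-cost random access machine, written in structured form. The
  memory cells hold natural numbers and are organised in arrays: \<open>s a i\<close> is the content of cell \<open>i\<close>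
  of array \<open>a\<close>. Array names occur in programs only as constants, so a program uses a fixed finite
  number of arrays; interleaving them in a single memory costs only a constant factor. The only
  arithmetic is addition and (truncated) subtraction.\<close>

type_synonym store = "nat \<Rightarrow> nat \<Rightarrow> nat"

datatype exp = Const nat | Get nat exp | Add exp exp | Sub exp exp

fun eval_exp :: "exp \<Rightarrow> store \<Rightarrow> nat" where
  "eval_exp (Const n) s = n"
| "eval_exp (Get a e) s = s a (eval_exp e s)"
| "eval_exp (Add e1 e2) s = eval_exp e1 s + eval_exp e2 s"
| "eval_exp (Sub e1 e2) s = eval_exp e1 s - eval_exp e2 s"

datatype test = Less exp exp | Equal exp exp | Neg test | Conj test test

fun eval_test :: "test \<Rightarrow> store \<Rightarrow> bool" where
  "eval_test (Less e1 e2) s = (eval_exp e1 s < eval_exp e2 s)"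
| "eval_test (Equal e1 e2) s = (eval_exp e1 s = eval_exp e2 s)"
| "eval_test (Neg b) s = (\<not> eval_test b s)"
| "eval_test (Conj b1 b2) s = (eval_test b1 s \<and> eval_test b2 s)"

datatype prog =
    Skip
  | Put nat exp exp
  | Seq prog prog
  | Cond test prog prog
  | While test prog

text \<open>\<open>exec c s t s'\<close>: program \<open>c\<close>, started in \<open>s\<close>, halts in \<open>s'\<close> after \<open>t\<close> steps. Each assignment
  and each test is one step: the expressions of a program have fixed size, so counting their
  operations separately would change \<open>t\<close> only by a factor depending on the program.\<close>

inductive exec :: "prog \<Rightarrow> store \<Rightarrow> nat \<Rightarrow> store \<Rightarrow> bool" where
  exec_Skip: "exec Skip s 1 s"
| exec_Put: "exec (Put a e1 e2) s 1 (s(a := (s a)(eval_exp e1 s := eval_exp e2 s)))"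
| exec_Seq: "exec c1 s t1 s' \<Longrightarrow> exec c2 s' t2 s'' \<Longrightarrow> exec (Seq c1 c2) s (t1 + t2) s''"
| exec_Cond_True: "eval_test b s \<Longrightarrow> exec c1 s t s' \<Longrightarrow> exec (Cond b c1 c2) s (1 + t) s'"
| exec_Cond_False: "\<not> eval_test b s \<Longrightarrow> exec c2 s t s' \<Longrightarrow> exec (Cond b c1 c2) s (1 + t) s'"
| exec_While_False: "\<not> eval_test b s \<Longrightarrow> exec (While b c) s 1 s"
| exec_While_True: "eval_test b s \<Longrightarrow> exec c s t1 s' \<Longrightarrow> exec (While b c) s' t2 s'' \<Longrightarrow>
     exec (While b c) s (1 + t1 + t2) s''"

definition block :: "nat list \<Rightarrow> nat list" where
  "block ns = length ns # ns"

text \<open>The input is written to array 0 and the output is read from array 1, each preceded by its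
  length in cell 0. All other cells are initially 0.\<close>

definition input_store :: "nat list \<Rightarrow> store" where
  "input_store ns = (\<lambda>a i. if a = 0 \<and> i \<le> length ns then block ns ! i else 0)"

definition result_of :: "store \<Rightarrow> nat list" where
  "result_of s = map (\<lambda>i. s 1 (Suc i)) [0..<s 1 0]"


section \<open>Encodings\<close>

text \<open>For computations, terminals, variables and states are natural numbers, each stored in one
  cell. A regex is given by its syntax tree in prefix notation.\<close>

fun rx_code :: "(nat, nat) rx \<Rightarrow> nat list" where
  "rx_code REmpty = [0]"
| "rx_code REps = [1]"
| "rx_code (RTerm a) = [2, a]"
| "rx_code (RRef x) = [3, x]"
| "rx_code (RCat \<alpha> \<beta>) = [4] @ rx_code \<alpha> @ rx_code \<beta>"
| "rx_code (RAlt \<alpha> \<beta>) = [5] @ rx_code \<alpha> @ rx_code \<beta>"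
| "rx_code (RPlus \<alpha>) = [6] @ rx_code \<alpha>"
| "rx_code (RBind x \<alpha>) = [7, x] @ rx_code \<alpha>"

definition input_code :: "nat list \<Rightarrow> (nat, nat) rx \<Rightarrow> nat list" where
  "input_code as \<alpha> = block as @ rx_code \<alpha>"

fun label_code :: "nat label \<Rightarrow> nat list" where
  "label_code (LTerm a) = [0, a]"
| "label_code LEps = [1, 0]"
| "label_code (LMem i) = [2, i]"

fun action_code :: "action \<Rightarrow> nat" where
  "action_code AOpen = 0"
| "action_code AClose = 1"
| "action_code AReset = 2"
| "action_code AKeep = 3"

fun transition_code :: "nat \<times> nat label \<times> nat \<times> action list \<Rightarrow> nat list" where
  "transition_code (q, b, p, ss) = [q] @ label_code b @ [p] @ map action_code ss"

text \<open>The code of an automaton lists its components completely, with one explicit entry per memory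
  in every transition. The order in which the elements of a set are listed is arbitrary.\<close>

definition is_tmfa_code :: "(nat, nat) tmfa \<Rightarrow> nat list \<Rightarrow> bool" where
  "is_tmfa_code M ns \<longleftrightarrow>
    (\<exists>qs as fs ts.
       distinct qs \<and> set qs = states M \<and>
       distinct as \<and> set as = alphabet M \<and>
       distinct fs \<and> set fs = final M \<and>
       distinct ts \<and> set ts = {(q, b, p, ss). (p, ss) \<in> delta M q b} \<and>
       ns = block qs @ block as @ [memories M, init M] @ block fs @ [trap M] @
            [length ts] @ concat (map transition_code ts))"

end

theory Submission
  imports Defs
begin

text \<open>Write the code of the regex into memory and use its positions as the nodes of a Thompson-like graph
  in which brackets, terminals and references are the visible steps. Its walks are the marked ref-words,
  up to renumbering. Letter positions (and an initial node) are the states of the automaton; a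
  transition follows a walk through brackets up to the next letter, and the effect of these brackets
  on each memory is condensed into one action. A reference preceded by \<open>[\<^sub>x ]\<^sub>x\<close> cannot be a recall, since
  a recall does not see a reset in the same transition; it becomes an \<open>\<epsilon>\<close>-transition.

  The regex is nondeterministic iff from some state two bracket words lead to the same node, or two
  conflicting letters can be reached. A breadth-first search that tags each node with the last bracket
  on the way detects the former: if all tags are unique, so are the bracket words. The search takes
  linear time per state, and in the deterministic case each state has at most \<open>|\<Sigma>|\<close> transitions.\<close>

section \<open>Renumbering marked ref-words\<close>

text \<open>Nondeterminism speaks of complete marked words with a common prefix. It becomes a
  property of single states because \<open>REmpty\<close> never occurs inside another regex:
  positions are reachable and co-reachable, so bracket walks from a state extend to complete words
  on both sides. Memories agree with dereferencing because a variable does not occur in the body of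
  its own binding: a referenced memory is always closed, so forcing \<open>AClose\<close> at a
  recall is harmless. Words, not walks, must be compared. Silent steps allow many walks with one
  bracket word, so a second visit in the search is harmless unless the tag differs. A single number
  suffices as a tag because a node determines the bracket it emits. Unambiguity also bounds the
  output: a bracket node met twice would be reached by two words, so bracket words have length
  O(|\<alpha>|), and one transition with its action list costs O(|\<alpha>|). With |\<Sigma>|
  transitions for each of n + 1 states this is the time bound. It leaves no room for clearing tables
  between states, hence the growing stamps.\<close>

lemma map_conc: "map f ` conc A B = conc (map f ` A) (map f ` B)"
proof (intro equalityI subsetI)
  fix w assume "w \<in> map f ` conc A B"
  then show "w \<in> conc (map f ` A) (map f ` B)"
    by (force simp: conc_def)
next
  fix w assume "w \<in> conc (map f ` A) (map f ` B)"
  then obtain u v where "u \<in> A" "v \<in> B" "w = map f u @ map f v"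
    by (auto simp: conc_def)
  then show "w \<in> map f ` conc A B"
    by (intro image_eqI[of _ _ "u @ v"]) (auto simp: conc_def)
qed

lemma map_plus_lang: "map f ` plus_lang A = plus_lang (map f ` A)"
proof (intro equalityI subsetI)
  fix w assume "w \<in> map f ` plus_lang A"
  then obtain ws where ws: "ws \<noteq> []" "set ws \<subseteq> A" "w = map f (concat ws)"
    by (auto simp: plus_lang_def)
  then show "w \<in> plus_lang (map f ` A)"
    unfolding plus_lang_def by (intro CollectI exI[of _ "map (map f) ws"]) (auto simp: map_concat)
next
  fix w assume "w \<in> plus_lang (map f ` A)"
  then obtain ws where ws: "ws \<noteq> []" "set ws \<subseteq> map f ` A" "w = concat ws"
    by (auto simp: plus_lang_def)
  from ws(2) have "\<exists>vs. set vs \<subseteq> A \<and> ws = map (map f) vs"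
  proof (induction ws)
    case (Cons u ws)
    then obtain vs v where "set vs \<subseteq> A" "ws = map (map f) vs" "v \<in> A" "u = map f v"
      by auto
    then show ?case by (intro exI[of _ "v # vs"]) auto
  qed auto
  then obtain vs where "set vs \<subseteq> A" "ws = map (map f) vs" by blast
  then have "vs \<noteq> []" "set vs \<subseteq> A" "w = map f (concat vs)"
    using ws by (simp_all add: map_concat)
  then show "w \<in> map f ` plus_lang A"
    unfolding plus_lang_def by blast
qed

lemma rexp_lang_map: "rexp_lang (map_rexp f r) = map f ` rexp_lang r"
  by (induction r) (simp_all add: map_conc map_plus_lang image_Un)

lemma rexp_lang_set: "w \<in> rexp_lang r \<Longrightarrow> set w \<subseteq> set_rexp r"
proof (induction r arbitrary: w)
  case (Iter r)
  from Iter.prems obtain ws where ws: "set ws \<subseteq> rexp_lang r" "w = concat ws"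
    by (auto simp: plus_lang_def)
  then show ?case using Iter.IH by auto
next
  case (Times r1 r2)
  then obtain u v where "u \<in> rexp_lang r1" "v \<in> rexp_lang r2" "w = u @ v"
    by (auto simp: conc_def)
  then show ?case using Times.IH[of u] Times.IH(2)[of v] by auto
qed auto

text \<open>Formulated for an arbitrary marked language, so that the numbering produced by
  \<open>mark\<close> can be traded for another one.\<close>

definition nondet_words :: "(('a, 'v) sym \<times> nat) list set \<Rightarrow> bool" where
  "nondet_words X \<longleftrightarrow>
    (\<exists>\<rho>1 \<in> X. \<exists>\<rho>2 \<in> X.
     \<exists>r s1 s2. \<exists>\<gamma>1 \<in> bracket_words. \<exists>\<gamma>2 \<in> bracket_words.
       (\<exists>a i j. \<rho>1 = r @ \<gamma>1 @ (Tm a, i) # s1 \<and> \<rho>2 = r @ \<gamma>2 @ (Tm a, j) # s2 \<and> i \<noteq> j)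
     \<or> (\<exists>x i j. \<exists>\<chi> \<in> letter_syms.
          \<rho>1 = r @ \<gamma>1 @ (Vr x, i) # s1 \<and> \<rho>2 = r @ \<gamma>2 @ (\<chi>, j) # s2 \<and> i \<noteq> j)
     \<or> (\<exists>i. \<exists>\<chi> \<in> letter_syms.
          \<rho>1 = r @ \<gamma>1 @ (\<chi>, i) # s1 \<and> \<rho>2 = r @ \<gamma>2 @ (\<chi>, i) # s2 \<and> \<gamma>1 \<noteq> \<gamma>2)
     \<or> (\<rho>1 = r @ \<gamma>1 \<and> \<rho>2 = r @ \<gamma>2 \<and> \<gamma>1 \<noteq> \<gamma>2))"

lemma nondeterministic_rx_words: "nondeterministic_rx \<alpha> \<longleftrightarrow> nondet_words (marked_lang \<alpha>)"
  unfolding nondeterministic_rx_def nondet_words_def ..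

abbreviation renumber :: "(nat \<Rightarrow> nat) \<Rightarrow> ('s \<times> nat) list \<Rightarrow> ('s \<times> nat) list" where
  "renumber f \<equiv> map (apsnd f)"

lemma renumber_bracket_words: "\<gamma> \<in> bracket_words \<Longrightarrow> renumber f \<gamma> \<in> bracket_words"
  unfolding bracket_words_def in_lists_conv_set by auto

lemma renumber_inj:
  assumes "inj_on f I" "snd ` set u \<subseteq> I" "snd ` set v \<subseteq> I" "renumber f u = renumber f v"
  shows "u = v"
proof -
  have "inj_on (apsnd f) (set u \<union> set v)"
  proof (rule inj_onI)
    fix x y assume "x \<in> set u \<union> set v" "y \<in> set u \<union> set v" "apsnd f x = apsnd f y"
    moreover from this have "snd x \<in> I" "snd y \<in> I" using assms(2,3) by blast+
    ultimately show "x = y" using assms(1) by (cases x; cases y) (simp add: inj_on_eq_iff)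
  qed
  with assms(4) show ?thesis by (simp add: inj_on_map_eq_map)
qed

text \<open>Only equality and inequality of numbers and of bracket words enter the condition, and
  both survive a renumbering that is injective on the numbers in use.\<close>

lemma nondet_words_renumber:
  assumes inj: "inj_on f I" and I: "\<And>w. w \<in> X \<Longrightarrow> snd ` set w \<subseteq> I"
    and nd: "nondet_words X"
  shows "nondet_words (renumber f ` X)"
proof -
  from nd obtain \<rho>1 \<rho>2 r s1 s2 \<gamma>1 \<gamma>2 where \<rho>: "\<rho>1 \<in> X" "\<rho>2 \<in> X"
    and \<gamma>: "\<gamma>1 \<in> bracket_words" "\<gamma>2 \<in> bracket_words" and
    cs: "(\<exists>a i j. \<rho>1 = r @ \<gamma>1 @ (Tm a, i) # s1 \<and> \<rho>2 = r @ \<gamma>2 @ (Tm a, j) # s2 \<and> i \<noteq> j)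
     \<or> (\<exists>x i j. \<exists>\<chi> \<in> letter_syms.
          \<rho>1 = r @ \<gamma>1 @ (Vr x, i) # s1 \<and> \<rho>2 = r @ \<gamma>2 @ (\<chi>, j) # s2 \<and> i \<noteq> j)
     \<or> (\<exists>i. \<exists>\<chi> \<in> letter_syms.
          \<rho>1 = r @ \<gamma>1 @ (\<chi>, i) # s1 \<and> \<rho>2 = r @ \<gamma>2 @ (\<chi>, i) # s2 \<and> \<gamma>1 \<noteq> \<gamma>2)
     \<or> (\<rho>1 = r @ \<gamma>1 \<and> \<rho>2 = r @ \<gamma>2 \<and> \<gamma>1 \<noteq> \<gamma>2)"
    unfolding nondet_words_def by (elim bexE exE) (rule that)
  define \<Phi> :: "(('a, 'b) sym \<times> nat) list \<Rightarrow> (('a, 'b) sym \<times> nat) list"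
    where "\<Phi> = renumber f"
  have mem: "\<Phi> \<rho>1 \<in> \<Phi> ` X" "\<Phi> \<rho>2 \<in> \<Phi> ` X" using \<rho> by auto
  have bw: "\<Phi> \<gamma>1 \<in> bracket_words" "\<Phi> \<gamma>2 \<in> bracket_words"
    using \<gamma> by (simp_all add: \<Phi>_def renumber_bracket_words)
  have neq: "f i \<noteq> f j" if "i \<in> snd ` set \<rho>1" "j \<in> snd ` set \<rho>2" "i \<noteq> j" for i j
  proof -
    have "i \<in> I" "j \<in> I" using that I[OF \<rho>(1)] I[OF \<rho>(2)] by blast+
    with inj \<open>i \<noteq> j\<close> show ?thesis by (simp add: inj_on_eq_iff)
  qed
  have neq\<gamma>: "\<Phi> \<gamma>1 \<noteq> \<Phi> \<gamma>2" if "set \<gamma>1 \<subseteq> set \<rho>1" "set \<gamma>2 \<subseteq> set \<rho>2" "\<gamma>1 \<noteq> \<gamma>2"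
    using renumber_inj[OF inj, of \<gamma>1 \<gamma>2] that I[OF \<rho>(1)] I[OF \<rho>(2)] unfolding \<Phi>_def by blast
  from cs consider
      (1) a i j where "\<rho>1 = r @ \<gamma>1 @ (Tm a, i) # s1" "\<rho>2 = r @ \<gamma>2 @ (Tm a, j) # s2" "i \<noteq> j"
    | (2) x i j \<chi> where "\<chi> \<in> letter_syms" "\<rho>1 = r @ \<gamma>1 @ (Vr x, i) # s1"
        "\<rho>2 = r @ \<gamma>2 @ (\<chi>, j) # s2" "i \<noteq> j"
    | (3) i \<chi> where "\<chi> \<in> letter_syms" "\<rho>1 = r @ \<gamma>1 @ (\<chi>, i) # s1"
        "\<rho>2 = r @ \<gamma>2 @ (\<chi>, i) # s2" "\<gamma>1 \<noteq> \<gamma>2"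
    | (4) "\<rho>1 = r @ \<gamma>1" "\<rho>2 = r @ \<gamma>2" "\<gamma>1 \<noteq> \<gamma>2"
    by blast
  then have "(\<exists>a i j. \<Phi> \<rho>1 = \<Phi> r @ \<Phi> \<gamma>1 @ (Tm a, i) # \<Phi> s1 \<and> \<Phi> \<rho>2 = \<Phi> r @ \<Phi> \<gamma>2 @ (Tm a, j) # \<Phi> s2 \<and> i \<noteq> j)
     \<or> (\<exists>x i j. \<exists>\<chi> \<in> letter_syms.
          \<Phi> \<rho>1 = \<Phi> r @ \<Phi> \<gamma>1 @ (Vr x, i) # \<Phi> s1 \<and> \<Phi> \<rho>2 = \<Phi> r @ \<Phi> \<gamma>2 @ (\<chi>, j) # \<Phi> s2 \<and> i \<noteq> j)
     \<or> (\<exists>i. \<exists>\<chi> \<in> letter_syms.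
          \<Phi> \<rho>1 = \<Phi> r @ \<Phi> \<gamma>1 @ (\<chi>, i) # \<Phi> s1 \<and> \<Phi> \<rho>2 = \<Phi> r @ \<Phi> \<gamma>2 @ (\<chi>, i) # \<Phi> s2 \<and> \<Phi> \<gamma>1 \<noteq> \<Phi> \<gamma>2)
     \<or> (\<Phi> \<rho>1 = \<Phi> r @ \<Phi> \<gamma>1 \<and> \<Phi> \<rho>2 = \<Phi> r @ \<Phi> \<gamma>2 \<and> \<Phi> \<gamma>1 \<noteq> \<Phi> \<gamma>2)"
  proof cases
    case 1
    then have "f i \<noteq> f j" by (intro neq) auto
    with 1 show ?thesis by (intro disjI1 exI[of _ a] exI[of _ "f i"] exI[of _ "f j"]) (simp add: \<Phi>_def)
  next
    case 2
    then have "f i \<noteq> f j" by (intro neq) auto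
    with 2 show ?thesis
      by (intro disjI2 disjI1 exI[of _ x] exI[of _ "f i"] exI[of _ "f j"] bexI[of _ \<chi>]) (simp_all add: \<Phi>_def)
  next
    case 3
    then have "\<Phi> \<gamma>1 \<noteq> \<Phi> \<gamma>2" by (intro neq\<gamma>) auto
    with 3 show ?thesis
      by (intro disjI2[OF disjI2[OF disjI1]] exI[of _ "f i"] bexI[of _ \<chi>]) (simp_all add: \<Phi>_def)
  next
    case 4
    then have "\<Phi> \<gamma>1 \<noteq> \<Phi> \<gamma>2" by (intro neq\<gamma>) auto
    with 4 show ?thesis by (intro disjI2) (simp add: \<Phi>_def)
  qed
  then show ?thesis
    unfolding nondet_words_def \<Phi>_def[symmetric]
    by (intro bexI[OF _ mem(1)] bexI[OF _ mem(2)] exI[of _ "\<Phi> r"] exI[of _ "\<Phi> s1"]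
        exI[of _ "\<Phi> s2"] bexI[OF _ bw(1)] bexI[OF _ bw(2)])
qed

lemma nondet_words_renumber_iff:
  assumes inj: "inj_on f I" and I: "\<And>w. w \<in> X \<Longrightarrow> snd ` set w \<subseteq> I"
  shows "nondet_words (renumber f ` X) \<longleftrightarrow> nondet_words X"
proof
  assume nd: "nondet_words (renumber f ` X)"
  \<comment> \<open>The converse is the same lemma for the inverse renumbering, which is injective
    on the image of \<open>I\<close>.\<close>
  define g where "g = inv_into I f"
  have "nondet_words (renumber g ` renumber f ` X)"
  proof (rule nondet_words_renumber[of g "f ` I"])
    show "inj_on g (f ` I)" unfolding g_def by (rule inj_on_inv_into) simp
    show "snd ` set w \<subseteq> f ` I" if "w \<in> renumber f ` X" for w
      using that I by fastforce
  qed (rule nd)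
  also have "renumber g ` renumber f ` X = X"
  proof -
    have "renumber g (renumber f w) = w" if "w \<in> X" for w
    proof -
      have "apsnd g (apsnd f x) = x" if "x \<in> set w" for x
      proof -
        have "snd x \<in> I" using that I[OF \<open>w \<in> X\<close>] by blast
        then show ?thesis using inj by (cases x) (simp add: g_def)
      qed
      then show ?thesis by (simp add: map_idI)
    qed
    then show ?thesis by (simp add: image_image)
  qed
  finally show "nondet_words X" .
qed (rule nondet_words_renumber[OF assms])


section \<open>Dereferencing with memories\<close>

text \<open>Left contexts are reversed throughout, as in the definition of dereferencing. \<open>mem_val c x\<close>
  is the memory of \<open>x\<close> that an automaton would hold after reading the context \<open>c\<close>.\<close>

fun mem_val :: "('a, 'v) sym list \<Rightarrow> 'v \<Rightarrow> 'a memory" where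
  "mem_val [] x = ([], Closed)"
| "mem_val (Tm a # c) x = update_memory [a] AKeep (mem_val c x)"
| "mem_val (Vr y # c) x = update_memory (fst (mem_val c y)) AKeep (mem_val c x)"
| "mem_val (Op y # c) x = (if x = y then ([], Opened) else mem_val c x)"
| "mem_val (Cl y # c) x = (if x = y then (fst (mem_val c x), Closed) else mem_val c x)"

fun sym_val :: "('a, 'v) sym list \<Rightarrow> ('a, 'v) sym \<Rightarrow> 'a list" where
  "sym_val c (Tm a) = [a]"
| "sym_val c (Vr y) = fst (mem_val c y)"
| "sym_val c s = []"

fun outp :: "('a, 'v) sym list \<Rightarrow> 'a list" where
  "outp [] = []"
| "outp (s # c) = outp c @ sym_val c s"

text \<open>Excludes the places where memories and \<open>nearest\<close> disagree: inside an open
  binding of \<open>y\<close> the memory holds a partial content, while \<open>nearest\<close> looks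
  for an earlier completed factor; closing a closed memory would extend the factor found by
  \<open>nearest\<close> but not the memory.\<close>

fun well_bracketed :: "('a, 'v) sym list \<Rightarrow> bool" where
  "well_bracketed [] = True"
| "well_bracketed (Tm a # c) = well_bracketed c"
| "well_bracketed (Vr y # c) = (snd (mem_val c y) = Closed \<and> well_bracketed c)"
| "well_bracketed (Op y # c) = well_bracketed c"
| "well_bracketed (Cl y # c) = (snd (mem_val c y) = Opened \<and> well_bracketed c)"

definition recalled :: "('a, 'v) sym list \<Rightarrow> 'v \<Rightarrow> 'a list" where
  "recalled c x = (case nearest x c of None \<Rightarrow> [] | Some (c', v) \<Rightarrow> deref_in c' v)"

lemma deref_in_Vr: "deref_in c (Vr x # r) = recalled c x @ deref_in (Vr x # c) r"
  by (simp add: recalled_def)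

declare deref_in.simps(5)[simp del] deref_in_Vr[simp]

lemma deref_in_append: "deref_in c (r @ s) = deref_in c r @ deref_in (rev r @ c) s"
proof (induction r arbitrary: c)
  case (Cons a r)
  then show ?case by (cases a) simp_all
qed simp

lemma snd_update_keep [simp]: "snd (update_memory v AKeep m) = snd m"
  by (cases "(v, AKeep, m)" rule: update_memory.cases) auto

lemma fst_update_keep: "fst (update_memory v AKeep m) = (if snd m = Opened then fst m @ v else fst m)"
  by (cases "(v, AKeep, m)" rule: update_memory.cases) auto

text \<open>\<open>open_part\<close> and \<open>open_ctxt\<close> are what \<open>nearest\<close>
  would return if \<open>Cl x\<close> were the next symbol: the factor begun by the latest
  \<open>Op x\<close> and its left context.\<close>

definition open_part :: "'v \<Rightarrow> ('a, 'v) sym list \<Rightarrow> ('a, 'v) sym list" where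
  "open_part x c = rev (takeWhile (\<lambda>s. s \<noteq> Op x) c)"

definition open_ctxt :: "'v \<Rightarrow> ('a, 'v) sym list \<Rightarrow> ('a, 'v) sym list" where
  "open_ctxt x c = dropWhile (\<lambda>s. s \<noteq> Op x) c"

lemma open_part_ctxt: "rev (open_part x c) @ open_ctxt x c = c"
  by (simp add: open_part_def open_ctxt_def)

lemma recalled_simps [simp]:
  "recalled [] x = []"
  "recalled (Tm a # c) x = recalled c x"
  "recalled (Vr y # c) x = recalled c x"
  "recalled (Op y # c) x = recalled c x"
  "recalled (Cl y # c) x =
    (if x = y then (if open_ctxt x c = [] then [] else deref_in (open_ctxt x c) (open_part x c))
     else recalled c x)"
  by (simp_all add: recalled_def nearest_def open_part_def open_ctxt_def Let_def
      del: dropWhile_eq_Nil_conv)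

lemma open_simps [simp]:
  "s \<noteq> Op x \<Longrightarrow> open_ctxt x (s # c) = open_ctxt x c"
  "s \<noteq> Op x \<Longrightarrow> open_part x (s # c) = open_part x c @ [s]"
  "open_ctxt x (Op x # c) = Op x # c"
  "open_part x (Op x # c) = []"
  by (simp_all add: open_part_def open_ctxt_def)

text \<open>The claim for closed memories is not inductive alone: at \<open>Cl x\<close> the
  recalled factor is the one that was open until then. The second conjunct therefore follows the
  unfinished factor symbol by symbol.\<close>

lemma mem_val_correct:
  assumes "well_bracketed c"
  shows "(snd (mem_val c x) = Closed \<longrightarrow> recalled c x = fst (mem_val c x)) \<and>
    (snd (mem_val c x) = Opened \<longrightarrow>
      open_ctxt x c \<noteq> [] \<and> deref_in (open_ctxt x c) (open_part x c) = fst (mem_val c x))"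
  using assms
proof (induction c arbitrary: x)
  case (Cons s c)
  show ?case
  proof (cases s)
    case (Tm a)
    then show ?thesis using Cons by (simp add: fst_update_keep deref_in_append)
  next
    case (Vr y)
    then have "recalled c y = fst (mem_val c y)" using Cons by simp
    \<comment> \<open>A reference inside the open factor of \<open>x\<close> is resolved in the
      context of that factor prolonged by the factor itself; by \<open>open_part_ctxt\<close> this
      is the whole context \<open>c\<close>.\<close>
    with Vr show ?thesis using Cons by (simp add: fst_update_keep deref_in_append open_part_ctxt)
  next
    case (Op y)
    then show ?thesis using Cons by (cases "x = y") (simp_all add: deref_in_append)
  next
    case (Cl y)
    then show ?thesis using Cons by (cases "x = y") (simp_all add: deref_in_append)
  qed
qed simp

lemma deref_eq_outp: "well_bracketed c \<Longrightarrow> deref (rev c) = outp c"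
proof (induction c)
  case (Cons s c)
  then show ?case
    using mem_val_correct[of c]
    by (cases s) (simp_all add: deref_def deref_in_append)
qed (simp add: deref_def)

lemma well_bracketed_append: "well_bracketed (u @ c) \<Longrightarrow> well_bracketed c"
proof (induction u)
  case (Cons s u)
  then show ?case by (cases s) auto
qed simp

text \<open>Brackets of one regex nest properly, so all statuses are restored at its end.
  Restoration is what lets the next factor or round start under the same assumption.\<close>

lemma ref_lang_well_bracketed:
  assumes "w \<in> ref_lang \<alpha>" "nonempty_rx A \<alpha>" "\<forall>x \<in> rx_vars \<alpha>. snd (mem_val c x) = Closed"
    and "well_bracketed c"
  shows "well_bracketed (rev w @ c) \<and> (\<forall>x. snd (mem_val (rev w @ c) x) = snd (mem_val c x))"
  using assms
proof (induction \<alpha> arbitrary: w c)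
  case (RCat \<alpha> \<beta>)
  from RCat.prems obtain u v where w: "u \<in> ref_lang \<alpha>" "v \<in> ref_lang \<beta>" "w = u @ v"
    by (auto simp: conc_def)
  have 1: "well_bracketed (rev u @ c) \<and> (\<forall>x. snd (mem_val (rev u @ c) x) = snd (mem_val c x))"
    using RCat.prems w by (intro RCat.IH(1)) auto
  have "well_bracketed (rev v @ rev u @ c) \<and>
      (\<forall>x. snd (mem_val (rev v @ rev u @ c) x) = snd (mem_val (rev u @ c) x))"
    using RCat.prems w 1 by (intro RCat.IH(2)) auto
  then show ?case using 1 w by simp
next
  case (RAlt \<alpha> \<beta>)
  from RAlt.prems(1) consider "w \<in> ref_lang \<alpha>" | "w \<in> ref_lang \<beta>" by auto
  then show ?case
  proof cases
    case 1
    then show ?thesis using RAlt.prems by (intro RAlt.IH(1)) auto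
  next
    case 2
    then show ?thesis using RAlt.prems by (intro RAlt.IH(2)) auto
  qed
next
  case (RPlus \<alpha>)
  from RPlus.prems obtain ws where w: "set ws \<subseteq> ref_lang \<alpha>" "w = concat ws"
    by (auto simp: plus_lang_def)
  from w(1) have "well_bracketed (rev (concat ws) @ c) \<and>
      (\<forall>x. snd (mem_val (rev (concat ws) @ c) x) = snd (mem_val c x))"
  proof (induction ws rule: rev_induct)
    case (snoc u ws)
    then have *: "well_bracketed (rev (concat ws) @ c) \<and>
      (\<forall>x. snd (mem_val (rev (concat ws) @ c) x) = snd (mem_val c x))" by simp
    have "well_bracketed (rev u @ rev (concat ws) @ c) \<and>
      (\<forall>x. snd (mem_val (rev u @ rev (concat ws) @ c) x) = snd (mem_val (rev (concat ws) @ c) x))"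
      using snoc.prems RPlus.prems * by (intro RPlus.IH) auto
    with * show ?case by simp
  qed (use RPlus.prems in auto)
  with w show ?case by simp
next
  case (RBind x \<alpha>)
  from RBind.prems obtain u where w: "u \<in> ref_lang \<alpha>" "w = Op x # u @ [Cl x]"
    by (auto simp: conc_def)
  \<comment> \<open>Opening \<open>x\<close> leaves the variables of the body closed, because
    \<open>x\<close> is not among them.\<close>
  have "well_bracketed (rev u @ Op x # c) \<and>
      (\<forall>y. snd (mem_val (rev u @ Op x # c) y) = snd (mem_val (Op x # c) y))"
    using RBind.prems w by (intro RBind.IH) auto
  with w show ?case using RBind.prems by auto
qed auto

lemma mem_val_lists:
  assumes "\<And>a. Tm a \<in> set c \<Longrightarrow> a \<in> A"
  shows "set (fst (mem_val c x)) \<subseteq> A"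
  using assms
proof (induction c arbitrary: x)
  case (Cons s c)
  then have IH: "set (fst (mem_val c x)) \<subseteq> A" for x by simp
  show ?case
    using IH Cons.prems by (cases s) (auto simp: fst_update_keep split: if_splits)
qed simp

lemma outp_lists:
  assumes "\<And>a. Tm a \<in> set c \<Longrightarrow> a \<in> A"
  shows "set (outp c) \<subseteq> A"
  using assms
proof (induction c)
  case (Cons s c)
  then show ?case using mem_val_lists[of c A] by (cases s) auto
qed simp

text \<open>The action of a bracket followed by the brackets to its right. A later opening or reset
  overwrites what comes before it, an opening that is closed again empties the memory
  (\<open>AReset\<close>), and only an otherwise untouched memory takes the action of its single
  bracket.\<close>

fun act :: "('a, 'v) sym list \<Rightarrow> 'v \<Rightarrow> action" where
  "act [] x = AKeep"
| "act (Op y # g) x = (if x = y then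
     (case act g x of AKeep \<Rightarrow> AOpen | AClose \<Rightarrow> AReset | d \<Rightarrow> d) else act g x)"
| "act (Cl y # g) x = (if x = y \<and> act g x = AKeep then AClose else act g x)"
| "act (s # g) x = act g x"

text \<open>An action takes effect before the consumed word \<open>v\<close> is recorded. So the
  brackets in front of a letter can be folded into the transition of that letter, and the four
  actions are closed under composition with a further bracket on the left.\<close>

lemma update_act:
  assumes "set g \<subseteq> bracket_syms"
  shows "update_memory v (act g x) (mem_val c x) = update_memory v AKeep (mem_val (rev g @ c) x)"
  using assms
proof (induction g arbitrary: c)
  case (Cons s g)
  then have IH: "update_memory v (act g x) (mem_val (s # c) x) =
      update_memory v AKeep (mem_val (rev (s # g) @ c) x)" by simp
  obtain u r where m: "mem_val c x = (u, r)" by (cases "mem_val c x")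
  from Cons.prems consider y where "s = Op y" | y where "s = Cl y"
    by (auto simp: bracket_syms_def)
  then have "update_memory v (act (s # g) x) (mem_val c x) =
      update_memory v (act g x) (mem_val (s # c) x)"
  proof cases
    case 1
    then show ?thesis using m by (cases "x = y"; cases "act g x") auto
  next
    case 2
    then show ?thesis using m by (cases "x = y"; cases "act g x"; cases r) auto
  qed
  with IH show ?case by simp
qed simp

lemma outp_brackets: "set g \<subseteq> bracket_syms \<Longrightarrow> outp (rev g @ c) = outp c"
proof (induction g arbitrary: c)
  case (Cons s g)
  then show ?case by (auto simp: bracket_syms_def)
qed simp

section \<open>The position graph of a regex\<close>

type_synonym nsym = "(nat, nat) sym"
type_synonym entry = "nat \<times> nsym option \<times> nat \<times> nat"

abbreviation len :: "(nat, nat) rx \<Rightarrow> nat" where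
  "len \<alpha> \<equiv> length (rx_code \<alpha>)"

text \<open>A node of the graph is a position of the prefix code; \<open>graph K p e \<alpha>\<close> consists of the nodes for
  \<open>\<alpha>\<close> starting at \<open>p\<close>, left towards \<open>e\<close>. Iterations and bindings need a second node, at offset \<open>K\<close>.
  An entry is a node with the symbol emitted on leaving it and its two (possibly equal) successors.\<close>

fun graph :: "nat \<Rightarrow> nat \<Rightarrow> nat \<Rightarrow> (nat, nat) rx \<Rightarrow> entry set" where
  "graph K p e REmpty = {(p, None, p, p)}"
| "graph K p e REps = {(p, None, e, e)}"
| "graph K p e (RTerm a) = {(p, Some (Tm a), e, e)}"
| "graph K p e (RRef x) = {(p, Some (Vr x), e, e)}"
| "graph K p e (RCat \<alpha> \<beta>) = insert (p, None, Suc p, Suc p)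
     (graph K (Suc p) (Suc p + len \<alpha>) \<alpha> \<union> graph K (Suc p + len \<alpha>) e \<beta>)"
| "graph K p e (RAlt \<alpha> \<beta>) = insert (p, None, Suc p, Suc p + len \<alpha>)
     (graph K (Suc p) e \<alpha> \<union> graph K (Suc p + len \<alpha>) e \<beta>)"
| "graph K p e (RPlus \<alpha>) = insert (p, None, Suc p, Suc p) (insert (K + p, None, Suc p, e)
     (graph K (Suc p) (K + p) \<alpha>))"
| "graph K p e (RBind x \<alpha>) = insert (p, Some (Op x), p + 2, p + 2)
     (insert (K + p, Some (Cl x), e, e) (graph K (p + 2) (K + p) \<alpha>))"

text \<open>Each symbol is numbered by the graph node that emits it instead of consecutively, so
  that the words of walks and the marked words become literally equal.\<close>

fun sexp :: "nat \<Rightarrow> nat \<Rightarrow> (nat, nat) rx \<Rightarrow> (nsym \<times> nat) rexp" where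
  "sexp K p REmpty = Zero"
| "sexp K p REps = One"
| "sexp K p (RTerm a) = Atom (Tm a, p)"
| "sexp K p (RRef x) = Atom (Vr x, p)"
| "sexp K p (RCat \<alpha> \<beta>) = Times (sexp K (Suc p) \<alpha>) (sexp K (Suc p + len \<alpha>) \<beta>)"
| "sexp K p (RAlt \<alpha> \<beta>) = Or (sexp K (Suc p) \<alpha>) (sexp K (Suc p + len \<alpha>) \<beta>)"
| "sexp K p (RPlus \<alpha>) = Iter (sexp K (Suc p) \<alpha>)"
| "sexp K p (RBind x \<alpha>) =
     Times (Atom (Op x, p)) (Times (sexp K (p + 2) \<alpha>) (Atom (Cl x, K + p)))"

lemma ref_rexp_sexp: "ref_rexp \<alpha> = map_rexp fst (sexp K p \<alpha>)"
  by (induction \<alpha> arbitrary: p) simp_all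

lemma ref_lang_sexp: "ref_lang \<alpha> = map fst ` rexp_lang (sexp K p \<alpha>)"
  by (simp add: ref_lang_eq_rexp_lang ref_rexp_sexp[of \<alpha> K p] rexp_lang_map)

lemma len_pos: "0 < len \<alpha>"
  by (induction \<alpha>) simp_all

text \<open>The second interval contains the second nodes of iterations and bindings. Subexpressions
  at disjoint code positions below \<open>K\<close> get disjoint regions.\<close>

definition region :: "nat \<Rightarrow> nat \<Rightarrow> nat \<Rightarrow> nat set" where
  "region K p m = {p..<p + m} \<union> {K + p..<K + p + m}"

lemma set_mark: "cj \<in> set_rexp (mark i r) \<Longrightarrow> i \<le> snd cj \<and> snd cj < i + atoms r"
  by (induction r arbitrary: i) fastforce+

lemma disjoint_mono: "R \<inter> S = {} \<Longrightarrow> A \<subseteq> R \<Longrightarrow> B \<subseteq> S \<Longrightarrow> A \<inter> B = {}"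
  by blast

lemma renumber_merge:
  fixes i m n :: nat
  assumes "inj_on f {i..<i + m}" "inj_on g {i + m..<i + m + n}"
    and "f ` {i..<i + m} \<subseteq> R" "g ` {i + m..<i + m + n} \<subseteq> S" "R \<inter> S = {}"
  shows "\<exists>h. inj_on h {i..<i + (m + n)} \<and> h ` {i..<i + (m + n)} \<subseteq> R \<union> S \<and>
    (\<forall>j\<in>{i..<i + m}. h j = f j) \<and> (\<forall>j\<in>{i + m..<i + m + n}. h j = g j)"
proof -
  define h where "h j = (if j < i + m then f j else g j)" for j
  have split: "{i..<i + (m + n)} = {i..<i + m} \<union> {i + m..<i + m + n}" by auto
  have im: "h ` {i..<i + m} = f ` {i..<i + m}" "h ` {i + m..<i + m + n} = g ` {i + m..<i + m + n}"
    by (rule image_cong; simp add: h_def)+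
  have "inj_on h {i..<i + m}" "inj_on h {i + m..<i + m + n}"
    by (rule inj_on_cong[THEN iffD2, OF _ assms(1)], simp add: h_def,
        rule inj_on_cong[THEN iffD2, OF _ assms(2)], simp add: h_def)
  moreover have "h ` {i..<i + m} \<inter> h ` {i + m..<i + m + n} = {}"
    unfolding im by (rule disjoint_mono[OF assms(5,3,4)])
  then have "h ` ({i..<i + m} - {i + m..<i + m + n}) \<inter> h ` ({i + m..<i + m + n} - {i..<i + m}) = {}"
    by blast
  ultimately have "inj_on h {i..<i + (m + n)}"
    unfolding split inj_on_Un by blast
  moreover have "h ` {i..<i + (m + n)} \<subseteq> R \<union> S"
    unfolding split image_Un im using assms(3,4) by blast
  ultimately show ?thesis by (intro exI[of _ h]) (auto simp: h_def)
qed

lemma map_mark_cong: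
  assumes "\<forall>j\<in>{i..<i + atoms r}. h j = f j"
  shows "map_rexp (apsnd h) (mark i r) = map_rexp (apsnd f) (mark i r)"
proof (rule rexp.map_cong[OF refl])
  fix z assume "z \<in> set_rexp (mark i r)"
  then show "apsnd h z = apsnd f z"
    using set_mark[of z i r] assms by (cases z) auto
qed

text \<open>Locating the image in \<open>region\<close> makes the induction work: the renumberings
  of two subexpressions then have disjoint images and glue to an injective one.\<close>

lemma mark_sexp:
  "p + len \<alpha> \<le> K \<Longrightarrow> \<exists>f. inj_on f {i..<i + atoms (ref_rexp \<alpha>)} \<and>
    f ` {i..<i + atoms (ref_rexp \<alpha>)} \<subseteq> region K p (len \<alpha>) \<and>
    map_rexp (apsnd f) (mark i (ref_rexp \<alpha>)) = sexp K p \<alpha>"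
proof (induction \<alpha> arbitrary: p i)
  case (RTerm a)
  then show ?case by (intro exI[of _ "\<lambda>_. p"]) (auto simp: region_def)
next
  case (RRef x)
  then show ?case by (intro exI[of _ "\<lambda>_. p"]) (auto simp: region_def)
next
  case (RCat \<alpha> \<beta>)
  let ?m = "atoms (ref_rexp \<alpha>)" and ?n = "atoms (ref_rexp \<beta>)"
  obtain f where f: "inj_on f {i..<i + ?m}" "f ` {i..<i + ?m} \<subseteq> region K (Suc p) (len \<alpha>)"
    "map_rexp (apsnd f) (mark i (ref_rexp \<alpha>)) = sexp K (Suc p) \<alpha>"
    using RCat.IH(1)[of "Suc p" i] RCat.prems by auto
  obtain g where g: "inj_on g {i + ?m..<i + ?m + ?n}"
    "g ` {i + ?m..<i + ?m + ?n} \<subseteq> region K (Suc p + len \<alpha>) (len \<beta>)"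
    "map_rexp (apsnd g) (mark (i + ?m) (ref_rexp \<beta>)) = sexp K (Suc p + len \<alpha>) \<beta>"
    using RCat.IH(2)[of "Suc p + len \<alpha>" "i + ?m"] RCat.prems by auto
  have dj: "region K (Suc p) (len \<alpha>) \<inter> region K (Suc p + len \<alpha>) (len \<beta>) = {}"
    using RCat.prems by (auto simp: region_def)
  obtain h where h: "inj_on h {i..<i + (?m + ?n)}"
    "h ` {i..<i + (?m + ?n)} \<subseteq> region K (Suc p) (len \<alpha>) \<union> region K (Suc p + len \<alpha>) (len \<beta>)"
    "\<forall>j\<in>{i..<i + ?m}. h j = f j" "\<forall>j\<in>{i + ?m..<i + ?m + ?n}. h j = g j"
    using renumber_merge[OF f(1) g(1) f(2) g(2) dj] by blast
  have "region K (Suc p) (len \<alpha>) \<union> region K (Suc p + len \<alpha>) (len \<beta>) \<subseteq> region K p (len (RCat \<alpha> \<beta>))"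
    by (auto simp: region_def)
  with h(2) have "h ` {i..<i + (?m + ?n)} \<subseteq> region K p (len (RCat \<alpha> \<beta>))" by blast
  with h(1) f(3) g(3) show ?case
    by (intro exI[of _ h]) (simp add: map_mark_cong[OF h(3)] map_mark_cong[OF h(4)])
next
  case (RAlt \<alpha> \<beta>)
  let ?m = "atoms (ref_rexp \<alpha>)" and ?n = "atoms (ref_rexp \<beta>)"
  obtain f where f: "inj_on f {i..<i + ?m}" "f ` {i..<i + ?m} \<subseteq> region K (Suc p) (len \<alpha>)"
    "map_rexp (apsnd f) (mark i (ref_rexp \<alpha>)) = sexp K (Suc p) \<alpha>"
    using RAlt.IH(1)[of "Suc p" i] RAlt.prems by auto
  obtain g where g: "inj_on g {i + ?m..<i + ?m + ?n}"
    "g ` {i + ?m..<i + ?m + ?n} \<subseteq> region K (Suc p + len \<alpha>) (len \<beta>)"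
    "map_rexp (apsnd g) (mark (i + ?m) (ref_rexp \<beta>)) = sexp K (Suc p + len \<alpha>) \<beta>"
    using RAlt.IH(2)[of "Suc p + len \<alpha>" "i + ?m"] RAlt.prems by auto
  have dj: "region K (Suc p) (len \<alpha>) \<inter> region K (Suc p + len \<alpha>) (len \<beta>) = {}"
    using RAlt.prems by (auto simp: region_def)
  obtain h where h: "inj_on h {i..<i + (?m + ?n)}"
    "h ` {i..<i + (?m + ?n)} \<subseteq> region K (Suc p) (len \<alpha>) \<union> region K (Suc p + len \<alpha>) (len \<beta>)"
    "\<forall>j\<in>{i..<i + ?m}. h j = f j" "\<forall>j\<in>{i + ?m..<i + ?m + ?n}. h j = g j"
    using renumber_merge[OF f(1) g(1) f(2) g(2) dj] by blast
  have "region K (Suc p) (len \<alpha>) \<union> region K (Suc p + len \<alpha>) (len \<beta>) \<subseteq> region K p (len (RAlt \<alpha> \<beta>))"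
    by (auto simp: region_def)
  with h(2) have "h ` {i..<i + (?m + ?n)} \<subseteq> region K p (len (RAlt \<alpha> \<beta>))" by blast
  with h(1) f(3) g(3) show ?case
    by (intro exI[of _ h]) (simp add: map_mark_cong[OF h(3)] map_mark_cong[OF h(4)])
next
  case (RPlus \<alpha>)
  obtain f where "inj_on f {i..<i + atoms (ref_rexp \<alpha>)}"
    "f ` {i..<i + atoms (ref_rexp \<alpha>)} \<subseteq> region K (Suc p) (len \<alpha>)"
    "map_rexp (apsnd f) (mark i (ref_rexp \<alpha>)) = sexp K (Suc p) \<alpha>"
    using RPlus.IH[of "Suc p" i] RPlus.prems by auto
  moreover have "region K (Suc p) (len \<alpha>) \<subseteq> region K p (len (RPlus \<alpha>))"
    by (auto simp: region_def)
  ultimately show ?case by (intro exI[of _ f]) auto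
next
  case (RBind x \<alpha>)
  let ?m = "atoms (ref_rexp \<alpha>)"
  obtain f where f: "inj_on f {Suc i..<Suc i + ?m}"
    "f ` {Suc i..<Suc i + ?m} \<subseteq> region K (p + 2) (len \<alpha>)"
    "map_rexp (apsnd f) (mark (Suc i) (ref_rexp \<alpha>)) = sexp K (p + 2) \<alpha>"
    using RBind.IH[of "p + 2" "Suc i"] RBind.prems by auto
  \<comment> \<open>The opening bracket carries the first number and the closing bracket the last;
    their nodes \<open>p\<close> and \<open>K + p\<close> lie outside the region of the body, which
    starts at \<open>p + 2\<close>.\<close>
  define h where "h j = (if j = i then p else if j = Suc i + ?m then K + p else f j)" for j
  have "{i..<i + atoms (ref_rexp (RBind x \<alpha>))} = insert i (insert (Suc i + ?m) {Suc i..<Suc i + ?m})"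
    by auto
  moreover have "\<forall>j\<in>{Suc i..<Suc i + ?m}. h j = f j" by (simp add: h_def)
  moreover have "inj_on h {Suc i..<Suc i + ?m}"
    using f(1) calculation(2) by (simp add: inj_on_def)
  moreover have "h ` {Suc i..<Suc i + ?m} \<subseteq> region K (p + 2) (len \<alpha>)"
    using f(2) calculation(2) by auto
  moreover have "h i = p" "h (Suc i + ?m) = K + p" by (auto simp: h_def)
  moreover have "p \<notin> region K (p + 2) (len \<alpha>)" "K + p \<notin> region K (p + 2) (len \<alpha>)" "K > 0"
    using RBind.prems by (auto simp: region_def)
  moreover have "region K (p + 2) (len \<alpha>) \<subseteq> region K p (len (RBind x \<alpha>))"
    "p \<in> region K p (len (RBind x \<alpha>))" "K + p \<in> region K p (len (RBind x \<alpha>))"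
    by (auto simp: region_def)
  ultimately show ?case
    using f(3) map_mark_cong[of "Suc i" "ref_rexp \<alpha>" h f]
    by (intro exI[of _ h] conjI) (auto simp: inj_on_insert)
qed auto

lemma graph_Domain: "Domain (graph K p e \<alpha>) \<subseteq> region K p (len \<alpha>)"
proof (induction \<alpha> arbitrary: p e)
  case (RCat \<alpha> \<beta>)
  then show ?case
    using RCat.IH(1)[of "Suc p" "Suc p + len \<alpha>"] RCat.IH(2)[of "Suc p + len \<alpha>" e]
    by (auto simp: region_def Domain_Un_eq subset_iff)
next
  case (RAlt \<alpha> \<beta>)
  then show ?case
    using RAlt.IH(1)[of "Suc p" e] RAlt.IH(2)[of "Suc p + len \<alpha>" e]
    by (auto simp: region_def Domain_Un_eq subset_iff)
next
  case (RPlus \<alpha>)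
  then show ?case
    using RPlus.IH[of "Suc p" "K + p"] by (auto simp: region_def subset_iff)
next
  case (RBind x \<alpha>)
  then show ?case
    using RBind.IH[of "p + 2" "K + p"] by (auto simp: region_def subset_iff)
qed (auto simp: region_def)

lemma single_valued_Un:
  "single_valued A \<Longrightarrow> single_valued B \<Longrightarrow> Domain A \<inter> Domain B = {} \<Longrightarrow> single_valued (A \<union> B)"
  unfolding single_valued_def by blast

lemma single_valued_insert:
  "single_valued A \<Longrightarrow> q \<notin> Domain A \<Longrightarrow> single_valued (insert (q, z) A)"
  unfolding single_valued_def by blast

lemma graph_single_valued: "p + len \<alpha> \<le> K \<Longrightarrow> single_valued (graph K p e \<alpha>)"
proof (induction \<alpha> arbitrary: p e)
  case (RCat \<alpha> \<beta>)
  let ?g = "graph K (Suc p) (Suc p + len \<alpha>) \<alpha>" and ?h = "graph K (Suc p + len \<alpha>) e \<beta>"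
  have D: "Domain ?g \<subseteq> region K (Suc p) (len \<alpha>)" "Domain ?h \<subseteq> region K (Suc p + len \<alpha>) (len \<beta>)"
    by (rule graph_Domain)+
  have "region K (Suc p) (len \<alpha>) \<inter> region K (Suc p + len \<alpha>) (len \<beta>) = {}"
    "p \<notin> region K (Suc p) (len \<alpha>)" "p \<notin> region K (Suc p + len \<alpha>) (len \<beta>)"
    using RCat.prems by (auto simp: region_def)
  with D have "Domain ?g \<inter> Domain ?h = {}" "p \<notin> Domain ?g" "p \<notin> Domain ?h" by blast+
  then show ?case
    using RCat by (simp add: single_valued_insert single_valued_Un Domain_Un_eq)
next
  case (RAlt \<alpha> \<beta>)
  let ?g = "graph K (Suc p) e \<alpha>" and ?h = "graph K (Suc p + len \<alpha>) e \<beta>"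
  have D: "Domain ?g \<subseteq> region K (Suc p) (len \<alpha>)" "Domain ?h \<subseteq> region K (Suc p + len \<alpha>) (len \<beta>)"
    by (rule graph_Domain)+
  have "region K (Suc p) (len \<alpha>) \<inter> region K (Suc p + len \<alpha>) (len \<beta>) = {}"
    "p \<notin> region K (Suc p) (len \<alpha>)" "p \<notin> region K (Suc p + len \<alpha>) (len \<beta>)"
    using RAlt.prems by (auto simp: region_def)
  with D have "Domain ?g \<inter> Domain ?h = {}" "p \<notin> Domain ?g" "p \<notin> Domain ?h" by blast+
  then show ?case
    using RAlt by (simp add: single_valued_insert single_valued_Un Domain_Un_eq)
next
  case (RPlus \<alpha>)
  have "Domain (graph K (Suc p) (K + p) \<alpha>) \<subseteq> region K (Suc p) (len \<alpha>)" by (rule graph_Domain)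
  then have "p \<notin> Domain (graph K (Suc p) (K + p) \<alpha>)" "K + p \<notin> Domain (graph K (Suc p) (K + p) \<alpha>)"
    "K > 0"
    using RPlus.prems by (auto simp: region_def subset_iff)
  then show ?case using RPlus by (simp add: single_valued_insert)
next
  case (RBind x \<alpha>)
  have "Domain (graph K (p + 2) (K + p) \<alpha>) \<subseteq> region K (p + 2) (len \<alpha>)" by (rule graph_Domain)
  then have "p \<notin> Domain (graph K (p + 2) (K + p) \<alpha>)" "K + p \<notin> Domain (graph K (p + 2) (K + p) \<alpha>)"
    "K > 0"
    using RBind.prems by (auto simp: region_def subset_iff)
  then show ?case using RBind by (simp add: single_valued_insert)
qed (simp_all add: single_valued_def)

lemma graph_start: "p \<in> Domain (graph K p e \<alpha>)"
  by (cases \<alpha>) auto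

text \<open>Nothing leaves the graph of a subexpression except through \<open>e\<close>. That
  branching is always silent justifies following only the first successor in
  \<open>walk_sym\<close>.\<close>

lemma graph_closed:
  "(q, l, a, b) \<in> graph K p e \<alpha> \<Longrightarrow>
    {a, b} \<subseteq> insert e (Domain (graph K p e \<alpha>)) \<and> (l \<noteq> None \<longrightarrow> a = b)"
proof (induction \<alpha> arbitrary: p e)
  case (RCat \<alpha> \<beta>)
  have "Suc p \<in> Domain (graph K (Suc p) (Suc p + len \<alpha>) \<alpha>)"
    "Suc p + len \<alpha> \<in> Domain (graph K (Suc p + len \<alpha>) e \<beta>)" by (rule graph_start)+
  then show ?case
    using RCat.prems RCat.IH(1)[of "Suc p" "Suc p + len \<alpha>"] RCat.IH(2)[of "Suc p + len \<alpha>" e]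
    by (auto simp: Domain_Un_eq)
next
  case (RAlt \<alpha> \<beta>)
  have "Suc p \<in> Domain (graph K (Suc p) e \<alpha>)"
    "Suc p + len \<alpha> \<in> Domain (graph K (Suc p + len \<alpha>) e \<beta>)" by (rule graph_start)+
  then show ?case
    using RAlt.prems RAlt.IH(1)[of "Suc p" e] RAlt.IH(2)[of "Suc p + len \<alpha>" e]
    by (auto simp: Domain_Un_eq)
next
  case (RPlus \<alpha>)
  have "Suc p \<in> Domain (graph K (Suc p) (K + p) \<alpha>)" by (rule graph_start)
  then show ?case
    using RPlus.prems RPlus.IH[of "Suc p" "K + p"] by auto
next
  case (RBind x \<alpha>)
  have "p + 2 \<in> Domain (graph K (p + 2) (K + p) \<alpha>)" by (rule graph_start)
  then show ?case
    using RBind.prems RBind.IH[of "p + 2" "K + p"] by auto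
qed auto


section \<open>Walks\<close>

text \<open>A visible step is marked with the node it leaves, while silent steps leave no trace.
  Different walks may therefore carry the same word.\<close>

inductive walk :: "entry set \<Rightarrow> nat \<Rightarrow> (nsym \<times> nat) list \<Rightarrow> nat \<Rightarrow> bool" for G where
  walk_refl: "walk G q [] q"
| walk_eps: "(q, None, a, b) \<in> G \<Longrightarrow> q' = a \<or> q' = b \<Longrightarrow> walk G q' w r \<Longrightarrow> walk G q w r"
| walk_sym: "(q, Some l, a, b) \<in> G \<Longrightarrow> walk G a w r \<Longrightarrow> walk G q ((l, q) # w) r"

inductive walkn :: "entry set \<Rightarrow> nat \<Rightarrow> nat \<Rightarrow> (nsym \<times> nat) list \<Rightarrow> nat \<Rightarrow> bool" for G where
  walkn_refl: "walkn G 0 q [] q"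
| walkn_eps: "(q, None, a, b) \<in> G \<Longrightarrow> q' = a \<or> q' = b \<Longrightarrow> walkn G n q' w r \<Longrightarrow> walkn G (Suc n) q w r"
| walkn_sym: "(q, Some l, a, b) \<in> G \<Longrightarrow> walkn G n a w r \<Longrightarrow> walkn G (Suc n) q ((l, q) # w) r"

lemma walk_iff_walkn: "walk G q w r \<longleftrightarrow> (\<exists>n. walkn G n q w r)"
proof
  show "walk G q w r \<Longrightarrow> \<exists>n. walkn G n q w r"
    by (induction rule: walk.induct) (blast intro: walkn.intros)+
  have "walkn G n q w r \<Longrightarrow> walk G q w r" for n
    by (induction rule: walkn.induct) (blast intro: walk.intros)+
  then show "\<exists>n. walkn G n q w r \<Longrightarrow> walk G q w r" by blast
qed

lemma walk_append: "walk G q u m \<Longrightarrow> walk G m v r \<Longrightarrow> walk G q (u @ v) r"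
  by (induction rule: walk.induct) (auto intro: walk.intros)

lemma walk_single: "(q, None, a, b) \<in> G \<Longrightarrow> walk G q [] a" "(q, None, a, b) \<in> G \<Longrightarrow> walk G q [] b"
  by (blast intro: walk.intros)+

lemma walk_single_sym: "(q, Some l, a, b) \<in> G \<Longrightarrow> walk G q [(l, q)] a"
  by (blast intro: walk.intros)

text \<open>Since the number of a symbol is the node that emitted it, every occurrence in a word
  reveals where the walk was at that moment.\<close>

lemma walk_splitE:
  assumes "walk G q (u @ (l, i) # v) r"
  obtains a b where "walk G q u i" "(i, Some l, a, b) \<in> G" "walk G a v r"
proof -
  have "\<exists>a b. walk G q u i \<and> (i, Some l, a, b) \<in> G \<and> walk G a v r"
    using assms
  proof (induction q "u @ (l, i) # v" r arbitrary: u rule: walk.induct)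
    case (walk_eps q a b q' r)
    then show ?case by (blast intro: walk.walk_eps)
  next
    case (walk_sym q l' a b w r)
    show ?case
    proof (cases u)
      case Nil
      with walk_sym show ?thesis by (auto intro: walk.walk_refl)
    next
      case (Cons x u')
      with walk_sym show ?thesis by (auto intro: walk.walk_sym)
    qed
  qed auto
  with that show thesis by blast
qed

lemma walk_snocE:
  assumes "walk G q (u @ [(l, i)]) r"
  obtains a b where "walk G q u i" "(i, Some l, a, b) \<in> G" "walk G a [] r"
  using walk_splitE[of G q u l i "[]" r] assms by blast

lemma walkn_first:
  assumes "walkn G n q w r" "q \<noteq> r" "single_valued G" "(q, l, a, b) \<in> G"
  shows "\<exists>m q' w'. n = Suc m \<and> (q' = a \<or> l = None \<and> q' = b) \<and> walkn G m q' w' r \<and>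
    w = (case l of None \<Rightarrow> w' | Some s \<Rightarrow> (s, q) # w')"
proof -
  have *: "l' = l \<and> a' = a \<and> b' = b" if "(q, l', a', b') \<in> G" for l' a' b'
    using assms(3,4) that unfolding single_valued_def by blast
  from assms(1) show ?thesis
  proof cases
    case walkn_refl
    with assms show ?thesis by simp
  next
    case (walkn_eps a' b' q' m)
    with *[OF walkn_eps(2)] show ?thesis by auto
  next
    case (walkn_sym l' a' b' m w')
    with *[OF walkn_sym(3)] show ?thesis by auto
  qed
qed

lemma concI: "u \<in> A \<Longrightarrow> v \<in> B \<Longrightarrow> u @ v \<in> conc A B"
  by (auto simp: conc_def)

lemma sexp_walk:
  assumes "w \<in> rexp_lang (sexp K p \<alpha>)" "graph K p e \<alpha> \<subseteq> G"
  shows "walk G p w e"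
  using assms
proof (induction \<alpha> arbitrary: p e w)
  case REps
  then show ?case using walk_single(1) by auto
next
  case (RTerm a)
  then show ?case using walk_single_sym by auto
next
  case (RRef x)
  then show ?case using walk_single_sym by auto
next
  case (RCat \<alpha> \<beta>)
  then obtain u v where "u \<in> rexp_lang (sexp K (Suc p) \<alpha>)" "v \<in> rexp_lang (sexp K (Suc p + len \<alpha>) \<beta>)"
    "w = u @ v" by (auto simp: conc_def)
  with RCat.prems have "walk G (Suc p) w e"
    using RCat.IH(1)[of u "Suc p" "Suc p + len \<alpha>"] RCat.IH(2)[of v "Suc p + len \<alpha>" e]
    by (auto intro: walk_append)
  with RCat.prems show ?case by (auto intro: walk_eps)
next
  case (RAlt \<alpha> \<beta>)
  then have "walk G (Suc p) w e \<or> walk G (Suc p + len \<alpha>) w e"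
    using RAlt.IH(1)[of w "Suc p" e] RAlt.IH(2)[of w "Suc p + len \<alpha>" e] by auto
  with RAlt.prems show ?case by (auto intro: walk_eps)
next
  case (RPlus \<alpha>)
  from RPlus.prems obtain ws where ws: "ws \<noteq> []" "set ws \<subseteq> rexp_lang (sexp K (Suc p) \<alpha>)" "w = concat ws"
    by (auto simp: plus_lang_def)
  have jumps: "walk G (K + p) [] (Suc p)" "walk G (K + p) [] e" "walk G p [] (Suc p)"
    using RPlus.prems by (auto intro: walk_single)
  from ws(1,2) have "walk G (Suc p) (concat ws) (K + p)"
  proof (induction ws rule: list_nonempty_induct)
    case (single u)
    then show ?case using RPlus.IH[of u "Suc p" "K + p"] RPlus.prems by auto
  next
    case (cons u us)
    then have "walk G (Suc p) u (K + p)" "walk G (Suc p) (concat us) (K + p)"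
      using RPlus.IH[of u "Suc p" "K + p"] RPlus.prems by auto
    then show ?case using jumps(1) walk_append[of G "Suc p" u "K + p" "concat us" "K + p"]
        walk_append[of G "K + p" "[]" "Suc p" "concat us" "K + p"] by auto
  qed
  with jumps(2,3) ws(3) show ?case
    using walk_append[of G p "[]" "Suc p" w "K + p"] walk_append[of G p w "K + p" "[]" e] by simp
next
  case (RBind x \<alpha>)
  then obtain u where u: "u \<in> rexp_lang (sexp K (p + 2) \<alpha>)" "w = (Op x, p) # u @ [(Cl x, K + p)]"
    by (auto simp: conc_def)
  then have "walk G (p + 2) u (K + p)" using RBind.prems RBind.IH[of u "p + 2" "K + p"] by auto
  moreover have "walk G (K + p) [(Cl x, K + p)] e" using RBind.prems by (auto intro: walk_single_sym)
  ultimately have "walk G (p + 2) (u @ [(Cl x, K + p)]) e" by (rule walk_append)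
  with u RBind.prems show ?case by (auto intro: walk_sym)
qed auto

text \<open>The first exit from the subgraph of \<open>\<alpha>\<close> splits the walk; the strictly decreasing length is
  needed for the iteration, whose body may emit nothing.\<close>

lemma walk_sexp:
  assumes "walkn G n p w r" "graph K p e \<alpha> \<subseteq> G" "single_valued G"
    and "r \<notin> region K p (len \<alpha>)" "p + len \<alpha> \<le> K" "nonempty_rx A \<alpha>"
  shows "\<exists>u v m. m < n \<and> w = u @ v \<and> u \<in> rexp_lang (sexp K p \<alpha>) \<and> walkn G m e v r"
  using assms
proof (induction \<alpha> arbitrary: n p e w)
  case REps
  from REps.prems have "p \<noteq> r" "(p, None, e, e) \<in> G" by (auto simp: region_def)
  from walkn_first[OF REps.prems(1) this(1) REps.prems(3) this(2)] show ?case by auto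
next
  case (RTerm a)
  from RTerm.prems have "p \<noteq> r" "(p, Some (Tm a), e, e) \<in> G" by (auto simp: region_def)
  from walkn_first[OF RTerm.prems(1) this(1) RTerm.prems(3) this(2)] show ?case by auto
next
  case (RRef x)
  from RRef.prems have "p \<noteq> r" "(p, Some (Vr x), e, e) \<in> G" by (auto simp: region_def)
  from walkn_first[OF RRef.prems(1) this(1) RRef.prems(3) this(2)] show ?case by auto
next
  case (RCat \<alpha> \<beta>)
  from RCat.prems have "p \<noteq> r" "(p, None, Suc p, Suc p) \<in> G" by (auto simp: region_def)
  from walkn_first[OF RCat.prems(1) this(1) RCat.prems(3) this(2)]
  obtain m where m: "n = Suc m" "walkn G m (Suc p) w r" by auto
  obtain u v m1 where 1: "m1 < m" "w = u @ v" "u \<in> rexp_lang (sexp K (Suc p) \<alpha>)"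
    "walkn G m1 (Suc p + len \<alpha>) v r"
    using RCat.IH(1)[OF m(2), of "Suc p + len \<alpha>"] RCat.prems by (auto simp: region_def)
  obtain u' v' m2 where 2: "m2 < m1" "v = u' @ v'" "u' \<in> rexp_lang (sexp K (Suc p + len \<alpha>) \<beta>)"
    "walkn G m2 e v' r"
    using RCat.IH(2)[OF 1(4), of e] RCat.prems by (auto simp: region_def)
  from 1 2 m show ?case
    by (intro exI[of _ "u @ u'"] exI[of _ v'] exI[of _ m2]) (simp add: concI)
next
  case (RAlt \<alpha> \<beta>)
  from RAlt.prems have "p \<noteq> r" "(p, None, Suc p, Suc p + len \<alpha>) \<in> G" by (auto simp: region_def)
  from walkn_first[OF RAlt.prems(1) this(1) RAlt.prems(3) this(2)]
  obtain m q' where m: "n = Suc m" "walkn G m q' w r" "q' = Suc p \<or> q' = Suc p + len \<alpha>" by auto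
  from m(3) show ?case
  proof
    assume "q' = Suc p"
    with m RAlt.IH(1)[of m "Suc p" w e] RAlt.prems obtain u v m1 where
      "m1 < m" "w = u @ v" "u \<in> rexp_lang (sexp K (Suc p) \<alpha>)" "walkn G m1 e v r"
      by (auto simp: region_def)
    with m show ?thesis by (intro exI[of _ u] exI[of _ v] exI[of _ m1]) auto
  next
    assume "q' = Suc p + len \<alpha>"
    with m RAlt.IH(2)[of m "Suc p + len \<alpha>" w e] RAlt.prems obtain u v m1 where
      "m1 < m" "w = u @ v" "u \<in> rexp_lang (sexp K (Suc p + len \<alpha>) \<beta>)" "walkn G m1 e v r"
      by (auto simp: region_def)
    with m show ?thesis by (intro exI[of _ u] exI[of _ v] exI[of _ m1]) auto
  qed
next
  case (RPlus \<alpha>)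
  let ?L = "rexp_lang (sexp K (Suc p) \<alpha>)"
  from RPlus.prems have p: "p \<noteq> r" "(p, None, Suc p, Suc p) \<in> G"
    and Kp: "K + p \<noteq> r" "(K + p, None, Suc p, e) \<in> G" by (auto simp: region_def)
  from walkn_first[OF RPlus.prems(1) p(1) RPlus.prems(3) p(2)]
  obtain m where m: "n = Suc m" "walkn G m (Suc p) w r" by auto
  from m(2) have "\<exists>u v m1. m1 < m \<and> w = u @ v \<and> u \<in> plus_lang ?L \<and> walkn G m1 e v r"
  proof (induction m arbitrary: w rule: less_induct)
    case (less m)
    obtain u v m1 where 1: "m1 < m" "w = u @ v" "u \<in> ?L" "walkn G m1 (K + p) v r"
      using RPlus.IH[OF less.prems, of "K + p"] RPlus.prems by (auto simp: region_def)
    obtain m2 q' where 2: "m1 = Suc m2" "q' = Suc p \<or> q' = e" "walkn G m2 q' v r"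
      using walkn_first[OF 1(4) Kp(1) RPlus.prems(3) Kp(2)] by auto
    from 2(2) show ?case
    proof
      assume "q' = Suc p"
      with less.IH[of m2 v] 1 2 obtain u' v' m3 where
        3: "m3 < m2" "v = u' @ v'" "u' \<in> plus_lang ?L" "walkn G m3 e v' r" by auto
      then obtain ws where "ws \<noteq> []" "set ws \<subseteq> ?L" "u' = concat ws" by (auto simp: plus_lang_def)
      with 1 have "u @ u' \<in> plus_lang ?L"
        unfolding plus_lang_def by (intro CollectI exI[of _ "u # ws"]) auto
      with 1 2 3 show ?thesis by (intro exI[of _ "u @ u'"] exI[of _ v'] exI[of _ m3]) auto
    next
      assume "q' = e"
      moreover have "u \<in> plus_lang ?L"
        unfolding plus_lang_def using 1(3) by (intro CollectI exI[of _ "[u]"]) auto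
      ultimately show ?thesis using 1 2 by (intro exI[of _ u] exI[of _ v] exI[of _ m2]) auto
    qed
  qed
  then obtain u v m1 where "m1 < m" "w = u @ v" "u \<in> plus_lang ?L" "walkn G m1 e v r" by blast
  with m show ?case by (intro exI[of _ u] exI[of _ v] exI[of _ m1]) auto
next
  case (RBind x \<alpha>)
  from RBind.prems have p: "p \<noteq> r" "(p, Some (Op x), p + 2, p + 2) \<in> G"
    and Kp: "K + p \<noteq> r" "(K + p, Some (Cl x), e, e) \<in> G" by (auto simp: region_def)
  from walkn_first[OF RBind.prems(1) p(1) RBind.prems(3) p(2)]
  obtain m w1 where m: "n = Suc m" "walkn G m (p + 2) w1 r" "w = (Op x, p) # w1" by auto
  obtain u v m1 where 1: "m1 < m" "w1 = u @ v" "u \<in> rexp_lang (sexp K (p + 2) \<alpha>)" "walkn G m1 (K + p) v r"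
    using RBind.IH[OF m(2), of "K + p"] RBind.prems by (auto simp: region_def)
  obtain m2 v' where "m1 = Suc m2" "walkn G m2 e v' r" "v = (Cl x, K + p) # v'"
    using walkn_first[OF 1(4) Kp(1) RBind.prems(3) Kp(2)] by auto
  moreover have "[(Op x, p)] @ u @ [(Cl x, K + p)] \<in> rexp_lang (sexp K p (RBind x \<alpha>))"
    using 1(3) by (simp only: sexp.simps rexp_lang.simps) (intro concI; simp)
  ultimately show ?case using 1 m
    by (intro exI[of _ "(Op x, p) # u @ [(Cl x, K + p)]"] exI[of _ v'] exI[of _ m2]) simp
qed auto

lemma conc_nonempty: "A \<noteq> {} \<Longrightarrow> B \<noteq> {} \<Longrightarrow> conc A B \<noteq> {}"
  using concI by blast

lemma rexp_lang_nonempty: "nonempty_rx A \<alpha> \<Longrightarrow> rexp_lang (sexp K p \<alpha>) \<noteq> {}"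
proof (induction \<alpha> arbitrary: p)
  case (RCat \<alpha> \<beta>)
  then show ?case by (simp add: conc_nonempty)
next
  case (RPlus \<alpha>)
  then obtain u where "u \<in> rexp_lang (sexp K (Suc p) \<alpha>)" by (metis ex_in_conv nonempty_rx.simps(7))
  then have "concat [u] \<in> plus_lang (rexp_lang (sexp K (Suc p) \<alpha>))"
    unfolding plus_lang_def by (intro CollectI exI[of _ "[u]"]) auto
  then show ?case by auto
next
  case (RBind x \<alpha>)
  then show ?case by (simp add: conc_nonempty)
qed auto

text \<open>\<open>REmpty\<close> is the only source of dead ends. Without it each subexpression has
  a word, whose walk leads to its exit (\<open>through\<close>), and the exit leads on to
  \<open>r\<close>.\<close>

lemma coreachable:
  assumes "nonempty_rx A \<alpha>" "graph K p e \<alpha> \<subseteq> G" "\<exists>w. walk G e w r" "q \<in> Domain (graph K p e \<alpha>)"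
  shows "\<exists>w. walk G q w r"
proof -
  have through: "\<exists>w. walk G p w r"
    if "nonempty_rx A \<alpha>" "graph K p e \<alpha> \<subseteq> G" "\<exists>w. walk G e w r" for p e \<alpha>
    using rexp_lang_nonempty[OF that(1), of K p] sexp_walk[OF _ that(2)] that(3) walk_append by blast
  show ?thesis using assms
  proof (induction \<alpha> arbitrary: p e)
    case (RCat \<alpha> \<beta>)
    have "\<exists>w. walk G (Suc p + len \<alpha>) w r" using through[of \<beta> "Suc p + len \<alpha>" e] RCat.prems by auto
    moreover have "\<exists>w. walk G p w r" using through[of "RCat \<alpha> \<beta>" p e] RCat.prems by blast
    ultimately show ?case
      using RCat.prems RCat.IH(1)[of "Suc p" "Suc p + len \<alpha>"] RCat.IH(2)[of "Suc p + len \<alpha>" e]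
      by (auto simp: Domain_Un_eq)
  next
    case (RAlt \<alpha> \<beta>)
    have "\<exists>w. walk G p w r" using through[of "RAlt \<alpha> \<beta>" p e] RAlt.prems by blast
    then show ?case
      using RAlt.prems RAlt.IH(1)[of "Suc p" e] RAlt.IH(2)[of "Suc p + len \<alpha>" e]
      by (auto simp: Domain_Un_eq)
  next
    case (RPlus \<alpha>)
    have "\<exists>w. walk G p w r" using through[of "RPlus \<alpha>" p e] RPlus.prems by blast
    moreover have "\<exists>w. walk G (K + p) w r" using RPlus.prems by (auto intro: walk_eps)
    ultimately show ?case using RPlus.prems RPlus.IH[of "Suc p" "K + p"] by auto
  next
    case (RBind x \<alpha>)
    have "\<exists>w. walk G p w r" using through[of "RBind x \<alpha>" p e] RBind.prems by blast
    moreover have "\<exists>w. walk G (K + p) w r" using RBind.prems by (auto intro: walk_sym)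
    ultimately show ?case using RBind.prems RBind.IH[of "p + 2" "K + p"] by auto
  next
    case REps
    then show ?case using through[of REps p e] by auto
  next
    case (RTerm a)
    then show ?case using through[of "RTerm a" p e] by auto
  next
    case (RRef x)
    then show ?case using through[of "RRef x" p e] by auto
  qed auto
qed

lemma walk_extend:
  assumes "walk G i w q" "(q, l, a, b) \<in> G"
  shows "\<exists>w. walk G i w a" and "l = None \<Longrightarrow> \<exists>w. walk G i w b"
proof -
  show "\<exists>w. walk G i w a"
  proof (cases l)
    case None
    then have "walk G q [] a" using assms(2) by (intro walk_single(1)) simp
    with walk_append[OF assms(1)] show ?thesis by blast
  next
    case (Some s)
    then have "walk G q [(s, q)] a" using assms(2) by (intro walk_single_sym) simp
    with walk_append[OF assms(1)] show ?thesis by blast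
  qed
  assume "l = None"
  then have "walk G q [] b" using assms(2) by (intro walk_single(2)) simp
  with walk_append[OF assms(1)] show "\<exists>w. walk G i w b" by blast
qed

text \<open>The forward counterpart: a subexpression is entered at its first node, and since it has
  a word it can be crossed to whatever follows it.\<close>

lemma reachable:
  assumes "nonempty_rx A \<alpha>" "graph K p e \<alpha> \<subseteq> G" "\<exists>w. walk G i w p" "q \<in> Domain (graph K p e \<alpha>)"
  shows "\<exists>w. walk G i w q"
proof -
  have through: "\<exists>w. walk G i w e"
    if "nonempty_rx A \<alpha>" "graph K p e \<alpha> \<subseteq> G" "\<exists>w. walk G i w p" for p e \<alpha>
    using rexp_lang_nonempty[OF that(1), of K p] sexp_walk[OF _ that(2)] that(3) walk_append by blast
  show ?thesis using assms
  proof (induction \<alpha> arbitrary: p e)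
    case (RCat \<alpha> \<beta>)
    then have "(p, None, Suc p, Suc p) \<in> G" by auto
    then have 1: "\<exists>w. walk G i w (Suc p)" using RCat.prems(3) walk_extend(1)[of G i _ p] by blast
    then have "\<exists>w. walk G i w (Suc p + len \<alpha>)"
      using through[of \<alpha> "Suc p" "Suc p + len \<alpha>"] RCat.prems by auto
    with 1 show ?case
      using RCat.prems RCat.IH(1)[of "Suc p" "Suc p + len \<alpha>"] RCat.IH(2)[of "Suc p + len \<alpha>" e]
      by (auto simp: Domain_Un_eq)
  next
    case (RAlt \<alpha> \<beta>)
    then have "(p, None, Suc p, Suc p + len \<alpha>) \<in> G" by auto
    then have "\<exists>w. walk G i w (Suc p)" "\<exists>w. walk G i w (Suc p + len \<alpha>)"
      using RAlt.prems(3) walk_extend[of G i _ p] by blast+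
    then show ?case
      using RAlt.prems RAlt.IH(1)[of "Suc p" e] RAlt.IH(2)[of "Suc p + len \<alpha>" e]
      by (auto simp: Domain_Un_eq)
  next
    case (RPlus \<alpha>)
    then have "(p, None, Suc p, Suc p) \<in> G" by auto
    then have 1: "\<exists>w. walk G i w (Suc p)" using RPlus.prems(3) walk_extend(1)[of G i _ p] by blast
    then have "\<exists>w. walk G i w (K + p)"
      using through[of \<alpha> "Suc p" "K + p"] RPlus.prems by auto
    with 1 show ?case using RPlus.prems RPlus.IH[of "Suc p" "K + p"] by auto
  next
    case (RBind x \<alpha>)
    then have "(p, Some (Op x), p + 2, p + 2) \<in> G" by auto
    then have 1: "\<exists>w. walk G i w (p + 2)" using RBind.prems(3) walk_extend(1)[of G i _ p] by blast
    then have "\<exists>w. walk G i w (K + p)"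
      using through[of \<alpha> "p + 2" "K + p"] RBind.prems by auto
    with 1 show ?case using RBind.prems RBind.IH[of "p + 2" "K + p"] by auto
  qed auto
qed

section \<open>The automaton of a regex\<close>

lemma sym_cases: "l \<in> letter_syms \<or> l \<in> bracket_syms"
  by (cases l) (auto simp: letter_syms_def bracket_syms_def)

lemma bracket_words_append [simp]:
  "u @ v \<in> bracket_words \<longleftrightarrow> u \<in> bracket_words \<and> v \<in> bracket_words"
  by (simp add: bracket_words_def)

lemma bracket_words_Cons [simp]:
  "(l, i) # v \<in> bracket_words \<longleftrightarrow> l \<in> bracket_syms \<and> v \<in> bracket_words"
  by (auto simp: bracket_words_def)

lemma bracket_words_Nil [simp]: "[] \<in> bracket_words"
  by (simp add: bracket_words_def)

lemma bracket_words_fst: "\<gamma> \<in> bracket_words \<Longrightarrow> set (map fst \<gamma>) \<subseteq> bracket_syms"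
  by (auto simp: bracket_words_def)

lemma last_letter_split:
  "\<exists>c \<gamma>. w = c @ \<gamma> \<and> \<gamma> \<in> bracket_words \<and>
    (c = [] \<or> (\<exists>c' l i. c = c' @ [(l, i)] \<and> l \<in> letter_syms))"
proof (induction w rule: rev_induct)
  case (snoc x w)
  obtain l i where x: "x = (l, i)" by (cases x)
  from snoc obtain c \<gamma> where c: "w = c @ \<gamma>" "\<gamma> \<in> bracket_words"
    "c = [] \<or> (\<exists>c' l i. c = c' @ [(l, i)] \<and> l \<in> letter_syms)" by blast
  from sym_cases[of l] show ?case
  proof
    assume "l \<in> letter_syms"
    then show ?thesis using x by (intro exI[of _ "w @ [x]"] exI[of _ "[]"]) auto
  next
    assume "l \<in> bracket_syms"
    then show ?thesis using x c by (intro exI[of _ c] exI[of _ "\<gamma> @ [x]"]) simp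
  qed
qed simp

lemma first_letter_split:
  "\<exists>\<gamma> v. w = \<gamma> @ v \<and> \<gamma> \<in> bracket_words \<and>
    (v = [] \<or> (\<exists>v' l i. v = (l, i) # v' \<and> l \<in> letter_syms))"
proof (induction w)
  case (Cons x w)
  obtain l i where x: "x = (l, i)" by (cases x)
  from Cons obtain \<gamma> v where c: "w = \<gamma> @ v" "\<gamma> \<in> bracket_words"
    "v = [] \<or> (\<exists>v' l i. v = (l, i) # v' \<and> l \<in> letter_syms)" by blast
  from sym_cases[of l] show ?case
  proof
    assume "l \<in> letter_syms"
    then show ?thesis using x by (intro exI[of _ "[]"] exI[of _ "x # w"]) auto
  next
    assume "l \<in> bracket_syms"
    then show ?thesis using x c by (intro exI[of _ "x # \<gamma>"] exI[of _ v]) simp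
  qed
qed simp

text \<open>Repetitions are kept: every occurrence of a variable has its own memory, and all
  memories of one variable are updated alike. This spares removing duplicates, and there are still
  at most |\<alpha>| memories.\<close>

fun var_list :: "('a, 'v) rx \<Rightarrow> 'v list" where
  "var_list (RRef x) = [x]"
| "var_list (RCat \<alpha> \<beta>) = var_list \<alpha> @ var_list \<beta>"
| "var_list (RAlt \<alpha> \<beta>) = var_list \<alpha> @ var_list \<beta>"
| "var_list (RPlus \<alpha>) = var_list \<alpha>"
| "var_list (RBind x \<alpha>) = x # var_list \<alpha>"
| "var_list _ = []"

text \<open>The last occurrence of \<open>x\<close>, counted from 1, and 0 if there is none. The
  last one is what remains in a table that is overwritten whenever \<open>x\<close> is appended to
  the list.\<close>

definition mem_index :: "'v list \<Rightarrow> 'v \<Rightarrow> nat" where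
  "mem_index vs x = length vs - length (takeWhile (\<lambda>y. y \<noteq> x) (rev vs))"

lemma mem_index_simps:
  "mem_index [] x = 0"
  "mem_index (vs @ [y]) x = (if x = y then Suc (length vs) else mem_index vs x)"
  by (auto simp: mem_index_def)

lemma mem_index_nth:
  "x \<in> set vs \<Longrightarrow> 1 \<le> mem_index vs x \<and> mem_index vs x \<le> length vs \<and> vs ! (mem_index vs x - 1) = x"
  by (induction vs rule: rev_induct) (auto simp: mem_index_simps nth_append)

fun letters :: "nat \<Rightarrow> (nat, nat) rx \<Rightarrow> nat list" where
  "letters p (RTerm a) = [p]"
| "letters p (RRef x) = [p]"
| "letters p (RCat \<alpha> \<beta>) = letters (Suc p) \<alpha> @ letters (Suc p + len \<alpha>) \<beta>"
| "letters p (RAlt \<alpha> \<beta>) = letters (Suc p) \<alpha> @ letters (Suc p + len \<alpha>) \<beta>"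
| "letters p (RPlus \<alpha>) = letters (Suc p) \<alpha>"
| "letters p (RBind x \<alpha>) = letters (p + 2) \<alpha>"
| "letters p _ = []"

lemma length_letters: "length (letters p \<alpha>) = occurrences \<alpha>"
  by (induction \<alpha> arbitrary: p) auto

lemma letters_range: "set (letters p \<alpha>) \<subseteq> {p..<p + len \<alpha>}"
proof (induction \<alpha> arbitrary: p)
  case (RCat \<alpha> \<beta>)
  then show ?case using RCat.IH(1)[of "Suc p"] RCat.IH(2)[of "Suc p + len \<alpha>"] by fastforce
next
  case (RAlt \<alpha> \<beta>)
  then show ?case using RAlt.IH(1)[of "Suc p"] RAlt.IH(2)[of "Suc p + len \<alpha>"] by fastforce
next
  case (RPlus \<alpha>)
  then show ?case using RPlus.IH[of "Suc p"] by fastforce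
next
  case (RBind x \<alpha>)
  then show ?case using RBind.IH[of "p + 2"] by fastforce
qed auto

lemma distinct_letters: "distinct (letters p \<alpha>)"
proof (induction \<alpha> arbitrary: p)
  case (RCat \<alpha> \<beta>)
  then show ?case using letters_range[of "Suc p" \<alpha>] letters_range[of "Suc p + len \<alpha>" \<beta>] by fastforce
next
  case (RAlt \<alpha> \<beta>)
  then show ?case using letters_range[of "Suc p" \<alpha>] letters_range[of "Suc p + len \<alpha>" \<beta>] by fastforce
qed auto

lemma set_letters:
  "q \<in> set (letters p \<alpha>) \<longleftrightarrow> (\<exists>l a b. (q, Some l, a, b) \<in> graph K p e \<alpha> \<and> l \<in> letter_syms)"
proof (induction \<alpha> arbitrary: p e)
  case (RCat \<alpha> \<beta>)
  show ?case
    unfolding letters.simps set_append Un_iff RCat.IH(1)[of "Suc p" "Suc p + len \<alpha>"]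
      RCat.IH(2)[of "Suc p + len \<alpha>" e] graph.simps by blast
next
  case (RAlt \<alpha> \<beta>)
  show ?case
    unfolding letters.simps set_append Un_iff RAlt.IH(1)[of "Suc p" e]
      RAlt.IH(2)[of "Suc p + len \<alpha>" e] graph.simps by blast
next
  case (RPlus \<alpha>)
  show ?case unfolding letters.simps RPlus.IH[of "Suc p" "K + p"] graph.simps by blast
next
  case (RBind x \<alpha>)
  show ?case unfolding letters.simps RBind.IH[of "p + 2" "K + p"] graph.simps
    by (auto simp: letter_syms_def)
qed (auto simp: letter_syms_def)

lemma graph_symbols:
  "(q, Some l, a, b) \<in> graph K p e \<alpha> \<Longrightarrow> nonempty_rx A \<alpha> \<Longrightarrow>
    (case l of Tm c \<Rightarrow> c \<in> A | Vr x \<Rightarrow> x \<in> set (var_list \<alpha>) | Op x \<Rightarrow> x \<in> set (var_list \<alpha>)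
      | Cl x \<Rightarrow> x \<in> set (var_list \<alpha>))"
proof (induction \<alpha> arbitrary: p e)
  case (RCat \<alpha> \<beta>)
  then show ?case by (fastforce split: sym.splits)
next
  case (RAlt \<alpha> \<beta>)
  then show ?case by (fastforce split: sym.splits)
next
  case (RPlus \<alpha>)
  then show ?case by (fastforce split: sym.splits)
next
  case (RBind x \<alpha>)
  then show ?case by (fastforce split: sym.splits)
qed auto

text \<open>A recall requires \<open>AClose\<close> at the recalled memory. For a closed reference
  without reset, \<open>act g x\<close> is \<open>AKeep\<close> or \<open>AClose\<close>, and both
  leave the same closed memory. Brackets get a dummy value; only letters carry transitions.\<close>

fun trans :: "nat list \<Rightarrow> nsym \<Rightarrow> nsym list \<Rightarrow> nat label \<times> action list" where
  "trans vs (Tm a) g = (LTerm a, map (act g) vs)"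
| "trans vs (Vr x) g = (if act g x = AReset then (LEps, map (act g) vs)
     else (LMem (mem_index vs x), map ((act g)(x := AClose)) vs))"
| "trans vs s g = (LEps, [])"

text \<open>The letters that may not leave a common state. A reference is in conflict with every
  letter, just as the labels \<open>LMem\<close> and \<open>LEps\<close> exclude every other label
  in a deterministic automaton.\<close>

definition conflict :: "nsym \<Rightarrow> nsym \<Rightarrow> bool" where
  "conflict l1 l2 \<longleftrightarrow> l1 = l2 \<or> l1 \<in> range Vr \<or> l2 \<in> range Vr"

text \<open>States: 0 is initial, 1 is the trap, and every occurrence of a terminal or reference is
  represented by its position in the code, which starts at \<open>p0\<close>.\<close>

locale regex_graph =
  fixes A :: "nat set" and \<alpha> :: "(nat, nat) rx" and p0 :: nat
  assumes finite_A: "finite A" and rx: "\<alpha> \<in> RX A" and p0: "2 \<le> p0"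
begin

text \<open>\<open>K\<close> is the first cell after the code, so the second nodes
  \<open>K + q\<close> lie beyond all positions; twice \<open>K\<close> lies beyond these and serves
  as the final node \<open>F\<close>.\<close>

definition K :: nat where "K = p0 + len \<alpha>"

definition F :: nat where "F = K + K"

text \<open>The silent loop at \<open>F\<close> gives every successor an entry of its own, so the
  search can treat \<open>F\<close> like any other node. The entry at 0 lets the initial state be
  treated like a letter.\<close>

definition G :: "entry set" where
  "G = insert (0, None, p0, p0) (insert (F, None, F, F) (graph K p0 F \<alpha>))"

section \<open>Sources, bracket walks and the two kinds of nondeterminism\<close>

definition letter :: "nat \<Rightarrow> nsym \<Rightarrow> bool" where
  "letter q l \<longleftrightarrow> (\<exists>a b. (q, Some l, a, b) \<in> G) \<and> l \<in> letter_syms"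

text \<open>State \<open>s\<close> means that the letter at \<open>s\<close> has just been read; the
  walk resumes at \<open>a\<close>.\<close>

definition source :: "nat \<Rightarrow> nat \<Rightarrow> bool" where
  "source s a \<longleftrightarrow> s = 0 \<and> a = p0 \<or> (\<exists>l b. (s, Some l, a, b) \<in> G \<and> l \<in> letter_syms)"

definition bwalk :: "nat \<Rightarrow> (nsym \<times> nat) list \<Rightarrow> nat \<Rightarrow> bool" where
  "bwalk a \<gamma> q \<longleftrightarrow> \<gamma> \<in> bracket_words \<and> walk G a \<gamma> q"

text \<open>\<open>ambiguous\<close> stands for the last two disjuncts of
  \<open>nondeterministic_rx\<close> (a letter or the end reached by two bracket words),
  \<open>conflicting\<close> for the first two. Ambiguity is required of arbitrary nodes
  \<open>q\<close>, which is what the search can observe.\<close>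

definition ambiguous :: "nat \<Rightarrow> bool" where
  "ambiguous a \<longleftrightarrow> (\<exists>\<gamma>1 \<gamma>2 q. bwalk a \<gamma>1 q \<and> bwalk a \<gamma>2 q \<and> \<gamma>1 \<noteq> \<gamma>2)"

definition conflicting :: "nat \<Rightarrow> bool" where
  "conflicting a \<longleftrightarrow> (\<exists>\<gamma>1 \<gamma>2 q1 q2 l1 l2. bwalk a \<gamma>1 q1 \<and> bwalk a \<gamma>2 q2 \<and>
    letter q1 l1 \<and> letter q2 l2 \<and> q1 \<noteq> q2 \<and> conflict l1 l2)"

lemma Domain_graph: "Domain (graph K p0 F \<alpha>) \<subseteq> region K p0 (len \<alpha>)"
  by (rule graph_Domain)

lemma nonempty_or: "\<alpha> = REmpty \<or> nonempty_rx A \<alpha>"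
  using rx by (auto simp: RX_def)

lemma bounds: "q \<in> Domain (graph K p0 F \<alpha>) \<Longrightarrow> p0 \<le> q \<and> q < F"
  using Domain_graph p0 by (auto simp: region_def K_def F_def)

lemma p0_F: "p0 < F" "F \<noteq> 0"
  using p0 len_pos[of \<alpha>] by (auto simp: F_def K_def)

lemma single_valued_G: "single_valued G"
proof -
  have "single_valued (graph K p0 F \<alpha>)" by (rule graph_single_valued) (simp add: K_def)
  moreover have "F \<notin> Domain (graph K p0 F \<alpha>)" "0 \<notin> Domain (graph K p0 F \<alpha>)"
    using bounds p0 by fastforce+
  ultimately show ?thesis
    unfolding G_def using p0_F by (intro single_valued_insert) auto
qed

lemma G_fun: "(q, l, a, b) \<in> G \<Longrightarrow> (q, l', a', b') \<in> G \<Longrightarrow> l' = l \<and> a' = a \<and> b' = b"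
  using single_valued_G unfolding single_valued_def by blast

lemma G_Some: "(q, Some l, a, b) \<in> G \<longleftrightarrow> (q, Some l, a, b) \<in> graph K p0 F \<alpha>"
  by (auto simp: G_def)

lemma letter_unique: "letter q l \<Longrightarrow> letter q l' \<Longrightarrow> l = l'"
  unfolding letter_def using G_fun by blast

lemma letter_ge: "letter q l \<Longrightarrow> 2 \<le> q \<and> q < F"
  unfolding letter_def G_Some using bounds p0 by fastforce

lemma source_unique: "source s a \<Longrightarrow> source s a' \<Longrightarrow> a = a'"
proof -
  assume s: "source s a" "source s a'"
  show ?thesis
  proof (cases "s = 0")
    case True
    then have "\<not> letter s l" for l using letter_ge[of s l] by auto
    with s show ?thesis unfolding source_def letter_def by blast
  next
    case False
    with s obtain l b l' b' where "(s, Some l, a, b) \<in> G" "(s, Some l', a', b') \<in> G"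
      unfolding source_def by blast
    then show ?thesis using G_fun by blast
  qed
qed

lemma letter_source: "letter q l \<Longrightarrow> \<exists>a. source q a"
  unfolding letter_def source_def by blast

lemma source_cases: "source s a \<Longrightarrow> s = 0 \<or> (\<exists>l. letter s l)"
  unfolding letter_def source_def by blast

lemma not_source_1: "\<not> source 1 a"
  using source_cases[of 1 a] letter_ge[of 1] by auto

lemma G_closed: "(q, l, a, b) \<in> G \<Longrightarrow> a \<in> Domain G \<and> b \<in> Domain G"
proof -
  assume "(q, l, a, b) \<in> G"
  then consider "(q, l, a, b) \<in> graph K p0 F \<alpha>" | "a = p0 \<and> b = p0" | "a = F \<and> b = F"
    by (auto simp: G_def)
  then show ?thesis
  proof cases
    case 1
    then show ?thesis using graph_closed[OF 1] by (auto simp: G_def)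
  next
    case 2
    then show ?thesis using graph_start[of p0 K F \<alpha>] by (auto simp: G_def)
  qed (auto simp: G_def)
qed

lemma walk_Domain: "walk G q w r \<Longrightarrow> q \<in> Domain G \<Longrightarrow> r \<in> Domain G"
proof (induction rule: walk.induct)
  case (walk_eps q a b q' w r)
  then show ?case using G_closed by blast
next
  case (walk_sym q l a b w r)
  then show ?case using G_closed by blast
qed

lemma p0_Domain: "p0 \<in> Domain G"
  using graph_start[of p0 K F \<alpha>] by (auto simp: G_def)

lemma F_entry: "(F, None, F, F) \<in> G" and init_entry: "(0, None, p0, p0) \<in> G"
  by (simp_all add: G_def)

lemma walk_F: "walk G q w r \<Longrightarrow> q = F \<Longrightarrow> w = [] \<and> r = F"
proof (induction rule: walk.induct)
  case (walk_eps q a b q' w r)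
  then have "a = F \<and> b = F" using G_fun[OF F_entry, of None a b] by simp
  with walk_eps show ?case by blast
next
  case (walk_sym q l a b w r)
  then show ?case using G_fun[OF F_entry, of "Some l" a b] by simp
qed simp

lemma empty_G: "\<alpha> = REmpty \<Longrightarrow> G = {(0, None, p0, p0), (F, None, F, F), (p0, None, p0, p0)}"
proof -
  have "\<beta> = REmpty \<Longrightarrow> graph k p f \<beta> = {(p, None, p, p)}" for k p f \<beta> by simp
  moreover assume "\<alpha> = REmpty"
  ultimately show ?thesis unfolding G_def by blast
qed

lemma empty_walk:
  assumes "\<alpha> = REmpty" "walk G q w r"
  shows "w = [] \<and> (q = p0 \<longrightarrow> r = p0)"
  using assms(2)
proof (induction rule: walk.induct)
  case (walk_eps q a b q' w r)
  moreover have "(p0, None, p0, p0) \<in> G" unfolding empty_G[OF assms(1)] by blast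
  from G_fun[OF this, of None a b] have "q = p0 \<longrightarrow> q' = p0" using walk_eps(1,2) by auto
  ultimately show ?case by blast
next
  case (walk_sym q l a b w r)
  then show ?case unfolding empty_G[OF assms(1)] by blast
qed simp

text \<open>Splitting off a word of the regex leaves a walk from \<open>F\<close> to
  \<open>F\<close>, and that emits nothing because \<open>F\<close> only loops silently. For
  \<open>REmpty\<close> the start node loops on itself and never reaches \<open>F\<close>.\<close>

lemma walk_lang: "walk G p0 w F \<longleftrightarrow> w \<in> rexp_lang (sexp K p0 \<alpha>)"
proof
  assume w: "walk G p0 w F"
  show "w \<in> rexp_lang (sexp K p0 \<alpha>)"
  proof (cases "\<alpha> = REmpty")
    case True
    with empty_walk[OF True w] p0_F show ?thesis by simp
  next
    case False
    with nonempty_or have ne: "nonempty_rx A \<alpha>" by blast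
    from w obtain n where "walkn G n p0 w F" by (auto simp: walk_iff_walkn)
    from walk_sexp[OF this _ single_valued_G _ _ ne, of K F]
    obtain u v m where "w = u @ v" "u \<in> rexp_lang (sexp K p0 \<alpha>)" "walkn G m F v F"
      by (auto simp: G_def region_def F_def K_def)
    moreover from this have "v = []" using walk_F walk_iff_walkn by blast
    ultimately show ?thesis by simp
  qed
qed (rule sexp_walk, auto simp: G_def)

lemma coreach:
  assumes "nonempty_rx A \<alpha>" "q \<in> Domain G"
  shows "\<exists>w. walk G q w F"
proof -
  have g: "\<exists>w. walk G q w F" if "q \<in> Domain (graph K p0 F \<alpha>)" for q
    by (rule coreachable[OF assms(1) _ _ that]) (auto simp: G_def intro: walk_refl)
  from g[OF graph_start] obtain w where "walk G p0 w F" ..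
  then have "walk G 0 w F" by (rule walk_eps[OF init_entry disjI1[OF refl]])
  moreover have "walk G F [] F" by (rule walk_refl)
  moreover from assms(2) have "q = 0 \<or> q = F \<or> q \<in> Domain (graph K p0 F \<alpha>)" by (auto simp: G_def)
  ultimately show ?thesis using g by blast
qed

text \<open>The prefix \<open>r\<close> is chosen before the continuation \<open>w\<close>, so two
  continuations from one source share it; this supplies the common prefix of the two marked
  words.\<close>

lemma source_reach:
  assumes "nonempty_rx A \<alpha>" "source s a"
  shows "\<exists>r. \<forall>w q. walk G a w q \<longrightarrow> walk G p0 (r @ w) q"
proof (cases "s = 0 \<and> a = p0")
  case True
  then show ?thesis by (intro exI[of _ "[]"]) simp
next
  case False
  with assms(2) obtain l b where e: "(s, Some l, a, b) \<in> G" by (auto simp: source_def)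
  then have "s \<in> Domain (graph K p0 F \<alpha>)" by (auto simp: G_Some)
  with reachable[OF assms(1), of K p0 F G p0 s] obtain u where u: "walk G p0 u s"
    by (auto simp: G_def intro: walk_refl)
  show ?thesis
  proof (intro exI[of _ "u @ [(l, s)]"] allI impI)
    fix w q assume "walk G a w q"
    with e have "walk G s ((l, s) # w) q" by (rule walk_sym)
    with u show "walk G p0 ((u @ [(l, s)]) @ w) q" by (simp add: walk_append)
  qed
qed

lemma bwalk_letter_split:
  assumes "walk G a (\<gamma> @ (l, q) # v) r" "\<gamma> \<in> bracket_words" "l \<in> letter_syms"
  shows "bwalk a \<gamma> q \<and> letter q l"
  by (rule walk_splitE[OF assms(1)]) (use assms(2,3) in \<open>auto simp: bwalk_def letter_def\<close>)

text \<open>The marked prefixes after which the automaton is in state \<open>s\<close>: those cut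
  immediately after a letter, and the empty one.\<close>

definition pre :: "(nsym \<times> nat) list \<Rightarrow> nat \<Rightarrow> bool" where
  "pre c s \<longleftrightarrow> c = [] \<and> s = 0 \<or> (\<exists>c' l. c = c' @ [(l, s)] \<and> letter s l \<and> walk G p0 c' s)"

lemma pre_split:
  assumes "walk G p0 (c @ u) r" "c = [] \<or> (\<exists>c' l i. c = c' @ [(l, i)] \<and> l \<in> letter_syms)"
  shows "\<exists>a. pre c (if c = [] then 0 else snd (last c)) \<and>
    source (if c = [] then 0 else snd (last c)) a \<and> walk G a u r"
  using assms(2)
proof
  assume "c = []"
  then show ?thesis using assms(1) by (auto simp: pre_def source_def)
next
  assume "\<exists>c' l i. c = c' @ [(l, i)] \<and> l \<in> letter_syms"
  then obtain c' l i where c: "c = c' @ [(l, i)]" "l \<in> letter_syms" by blast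
  with assms(1) obtain a b where "walk G p0 c' i" "(i, Some l, a, b) \<in> G" "walk G a u r"
    using walk_splitE[of G p0 c' l i u r] by auto
  with c show ?thesis by (auto simp: pre_def source_def letter_def)
qed

lemma pre_decomp:
  assumes "walk G p0 w r"
  shows "\<exists>c \<gamma> s a. w = c @ \<gamma> \<and> pre c s \<and> source s a \<and> bwalk a \<gamma> r"
proof -
  obtain c \<gamma> where "w = c @ \<gamma>" "\<gamma> \<in> bracket_words"
    "c = [] \<or> (\<exists>c' l i. c = c' @ [(l, i)] \<and> l \<in> letter_syms)"
    using last_letter_split by blast
  with pre_split[of c \<gamma> r] assms show ?thesis unfolding bwalk_def by blast
qed

lemma pre_walk:
  assumes "pre c s" "source s a" "walk G a u r"
  shows "walk G p0 (c @ u) r"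
  using assms(1) unfolding pre_def
proof
  assume "c = [] \<and> s = 0"
  moreover from this have "a = p0" using source_unique[OF assms(2)] by (auto simp: source_def)
  ultimately show ?thesis using assms(3) by simp
next
  assume "\<exists>c' l. c = c' @ [(l, s)] \<and> letter s l \<and> walk G p0 c' s"
  then obtain c' l where c: "c = c' @ [(l, s)]" "letter s l" "walk G p0 c' s" by blast
  then obtain a' b where e: "(s, Some l, a', b) \<in> G" "l \<in> letter_syms" by (auto simp: letter_def)
  then have "a' = a" using source_unique[OF assms(2), of a'] by (auto simp: source_def)
  with e assms(3) have "walk G s ((l, s) # u) r" by (auto intro: walk_sym)
  with c show ?thesis by (simp add: walk_append)
qed

section \<open>Nondeterminism of the regex as a property of its sources\<close>

lemma nondet_iff_words: "nondeterministic_rx \<alpha> \<longleftrightarrow> nondet_words (rexp_lang (sexp K p0 \<alpha>))"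
proof -
  let ?r = "mark 0 (ref_rexp \<alpha>)" and ?I = "{0..<0 + atoms (ref_rexp \<alpha>)}"
  obtain f where f: "inj_on f ?I" "map_rexp (apsnd f) ?r = sexp K p0 \<alpha>"
    using mark_sexp[of p0 \<alpha> K 0] by (auto simp: K_def)
  have "snd ` set w \<subseteq> ?I" if "w \<in> rexp_lang ?r" for w
    using rexp_lang_set[OF that] set_mark[of _ 0 "ref_rexp \<alpha>"] by fastforce
  from nondet_words_renumber_iff[OF f(1) this]
  show ?thesis
    unfolding nondeterministic_rx_words marked_lang_def f(2)[symmetric] rexp_lang_map by blast
qed

lemma nondet_sources:
  assumes "nondet_words (rexp_lang (sexp K p0 \<alpha>))"
  shows "\<exists>s a. source s a \<and> (ambiguous a \<or> conflicting a)"
proof -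
  from assms obtain \<rho>1 \<rho>2 r s1 s2 \<gamma>1 \<gamma>2 where
    \<rho>: "\<rho>1 \<in> rexp_lang (sexp K p0 \<alpha>)" "\<rho>2 \<in> rexp_lang (sexp K p0 \<alpha>)"
    and \<gamma>: "\<gamma>1 \<in> bracket_words" "\<gamma>2 \<in> bracket_words" and
    cs: "(\<exists>a i j. \<rho>1 = r @ \<gamma>1 @ (Tm a, i) # s1 \<and> \<rho>2 = r @ \<gamma>2 @ (Tm a, j) # s2 \<and> i \<noteq> j)
     \<or> (\<exists>x i j. \<exists>\<chi> \<in> letter_syms.
          \<rho>1 = r @ \<gamma>1 @ (Vr x, i) # s1 \<and> \<rho>2 = r @ \<gamma>2 @ (\<chi>, j) # s2 \<and> i \<noteq> j)
     \<or> (\<exists>i. \<exists>\<chi> \<in> letter_syms.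
          \<rho>1 = r @ \<gamma>1 @ (\<chi>, i) # s1 \<and> \<rho>2 = r @ \<gamma>2 @ (\<chi>, i) # s2 \<and> \<gamma>1 \<noteq> \<gamma>2)
     \<or> (\<rho>1 = r @ \<gamma>1 \<and> \<rho>2 = r @ \<gamma>2 \<and> \<gamma>1 \<noteq> \<gamma>2)"
    unfolding nondet_words_def by (elim bexE exE) (rule that)
  \<comment> \<open>The common prefix \<open>r\<close> may end in brackets. They are moved into the
    bracket words, so that the remaining prefix \<open>c\<close> ends at a state; prepending the
    same \<open>\<gamma>0\<close> to both words keeps them different.\<close>
  obtain c \<gamma>0 where c: "r = c @ \<gamma>0" "\<gamma>0 \<in> bracket_words"
    "c = [] \<or> (\<exists>c' l i. c = c' @ [(l, i)] \<and> l \<in> letter_syms)"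
    using last_letter_split by blast
  define s where "s = (if c = [] then 0 else snd (last c))"
  have start: "\<exists>a. source s a \<and> walk G a u F" if "r @ u' \<in> rexp_lang (sexp K p0 \<alpha>)" "u = \<gamma>0 @ u'" for u u'
    using pre_split[of c u F] c that walk_lang unfolding s_def by auto
  have two: "\<exists>a. source s a \<and> walk G a (\<gamma>0 @ u) F \<and> walk G a (\<gamma>0 @ v) F"
    if "\<rho>1 = r @ u" "\<rho>2 = r @ v" for u v
    using start[of u] start[of v] \<rho> that source_unique by metis
  have cf: "conflict (Tm c) (Tm c)" "conflict (Vr x) l" "Tm c \<in> letter_syms" "Vr x \<in> letter_syms" for c x l
    by (auto simp: conflict_def letter_syms_def)
  from cs have "(\<exists>l1 l2 i j. l1 \<in> letter_syms \<and> l2 \<in> letter_syms \<and> conflict l1 l2 \<and> i \<noteq> j \<and>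
      \<rho>1 = r @ \<gamma>1 @ (l1, i) # s1 \<and> \<rho>2 = r @ \<gamma>2 @ (l2, j) # s2) \<or>
    (\<exists>l i. l \<in> letter_syms \<and> \<rho>1 = r @ \<gamma>1 @ (l, i) # s1 \<and> \<rho>2 = r @ \<gamma>2 @ (l, i) # s2 \<and> \<gamma>1 \<noteq> \<gamma>2) \<or>
    (\<rho>1 = r @ \<gamma>1 \<and> \<rho>2 = r @ \<gamma>2 \<and> \<gamma>1 \<noteq> \<gamma>2)"
  proof (elim disjE exE conjE bexE, goal_cases)
    case (1 a i j)
    then show ?case using cf
      by (intro disjI1 exI[of _ "Tm a"] exI[of _ "Tm a"] exI[of _ i] exI[of _ j]) simp
  next
    case (2 x i j \<chi>)
    then show ?case using cf
      by (intro disjI1 exI[of _ "Vr x"] exI[of _ \<chi>] exI[of _ i] exI[of _ j]) simp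
  next
    case (3 i \<chi>)
    then show ?case
      by (intro disjI2[OF disjI1] exI[of _ \<chi>] exI[of _ i]) simp
  next
    case 4
    then show ?case by (intro disjI2) simp
  qed
  then consider
      (1) l1 l2 i j where "l1 \<in> letter_syms" "l2 \<in> letter_syms" "conflict l1 l2" "i \<noteq> j"
        "\<rho>1 = r @ \<gamma>1 @ (l1, i) # s1" "\<rho>2 = r @ \<gamma>2 @ (l2, j) # s2"
    | (2) l i where "l \<in> letter_syms" "\<rho>1 = r @ \<gamma>1 @ (l, i) # s1"
        "\<rho>2 = r @ \<gamma>2 @ (l, i) # s2" "\<gamma>1 \<noteq> \<gamma>2"
    | (3) "\<rho>1 = r @ \<gamma>1" "\<rho>2 = r @ \<gamma>2" "\<gamma>1 \<noteq> \<gamma>2"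
    by (elim disjE exE conjE) (rule that, assumption+)+
  then show ?thesis
  proof cases
    case 1
    from two[OF 1(5,6)] obtain a where a: "source s a"
      "walk G a (\<gamma>0 @ \<gamma>1 @ (l1, i) # s1) F" "walk G a (\<gamma>0 @ \<gamma>2 @ (l2, j) # s2) F" by blast
    from bwalk_letter_split[of a "\<gamma>0 @ \<gamma>1" l1 i s1 F] bwalk_letter_split[of a "\<gamma>0 @ \<gamma>2" l2 j s2 F]
    have "bwalk a (\<gamma>0 @ \<gamma>1) i" "letter i l1" "bwalk a (\<gamma>0 @ \<gamma>2) j" "letter j l2"
      using a 1 c(2) \<gamma> by auto
    with 1 have "conflicting a" unfolding conflicting_def by blast
    with a show ?thesis by blast
  next
    case 2
    from two[OF 2(2,3)] obtain a where a: "source s a"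
      "walk G a (\<gamma>0 @ \<gamma>1 @ (l, i) # s1) F" "walk G a (\<gamma>0 @ \<gamma>2 @ (l, i) # s2) F" by blast
    from bwalk_letter_split[of a "\<gamma>0 @ \<gamma>1" l i s1 F] bwalk_letter_split[of a "\<gamma>0 @ \<gamma>2" l i s2 F]
    have "bwalk a (\<gamma>0 @ \<gamma>1) i" "bwalk a (\<gamma>0 @ \<gamma>2) i" "\<gamma>0 @ \<gamma>1 \<noteq> \<gamma>0 @ \<gamma>2"
      using a 2 c(2) \<gamma> by auto
    then have "ambiguous a" unfolding ambiguous_def by blast
    with a show ?thesis by blast
  next
    case 3
    from two[OF 3(1,2)] obtain a where a: "source s a"
      "walk G a (\<gamma>0 @ \<gamma>1) F" "walk G a (\<gamma>0 @ \<gamma>2) F" by blast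
    then have "bwalk a (\<gamma>0 @ \<gamma>1) F" "bwalk a (\<gamma>0 @ \<gamma>2) F" "\<gamma>0 @ \<gamma>1 \<noteq> \<gamma>0 @ \<gamma>2"
      using 3 c(2) \<gamma> by (auto simp: bwalk_def)
    then have "ambiguous a" unfolding ambiguous_def by blast
    with a show ?thesis by blast
  qed
qed

lemma nondet_wordsI:
  assumes "\<rho>1 \<in> X" "\<rho>2 \<in> X" "\<gamma>1 \<in> bracket_words" "\<gamma>2 \<in> bracket_words"
  shows "\<rho>1 = r @ \<gamma>1 @ (l1, i) # s1 \<Longrightarrow> \<rho>2 = r @ \<gamma>2 @ (l2, j) # s2 \<Longrightarrow>
      l1 \<in> letter_syms \<Longrightarrow> l2 \<in> letter_syms \<Longrightarrow> l1 = l2 \<or> l1 \<in> range Vr \<Longrightarrow> i \<noteq> j \<Longrightarrow> nondet_words X"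
    and "\<rho>1 = r @ \<gamma>1 @ (l, i) # s1 \<Longrightarrow> \<rho>2 = r @ \<gamma>2 @ (l, i) # s2 \<Longrightarrow> l \<in> letter_syms \<Longrightarrow>
      \<gamma>1 \<noteq> \<gamma>2 \<Longrightarrow> nondet_words X"
    and "\<rho>1 = r @ \<gamma>1 \<Longrightarrow> \<rho>2 = r @ \<gamma>2 \<Longrightarrow> \<gamma>1 \<noteq> \<gamma>2 \<Longrightarrow> nondet_words X"
proof -
  assume a: "\<rho>1 = r @ \<gamma>1 @ (l1, i) # s1" "\<rho>2 = r @ \<gamma>2 @ (l2, j) # s2"
    "l1 \<in> letter_syms" "l2 \<in> letter_syms" "l1 = l2 \<or> l1 \<in> range Vr" "i \<noteq> j"
  from a(3,5) consider c where "l1 = Tm c" "l2 = Tm c" | x where "l1 = Vr x"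
    by (auto simp: letter_syms_def)
  then show "nondet_words X"
  proof cases
    case 1
    show ?thesis
      unfolding nondet_words_def
      by (rule bexI[OF _ assms(1)], rule bexI[OF _ assms(2)], rule exI[of _ r], rule exI[of _ s1],
          rule exI[of _ s2], rule bexI[OF _ assms(3)], rule bexI[OF _ assms(4)], rule disjI1)
        (use a 1 in blast)
  next
    case 2
    show ?thesis
      unfolding nondet_words_def
      by (rule bexI[OF _ assms(1)], rule bexI[OF _ assms(2)], rule exI[of _ r], rule exI[of _ s1],
          rule exI[of _ s2], rule bexI[OF _ assms(3)], rule bexI[OF _ assms(4)], rule disjI2, rule disjI1)
        (use a 2 in blast)
  qed
next
  assume a: "\<rho>1 = r @ \<gamma>1 @ (l, i) # s1" "\<rho>2 = r @ \<gamma>2 @ (l, i) # s2" "l \<in> letter_syms" "\<gamma>1 \<noteq> \<gamma>2"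
  show "nondet_words X"
    unfolding nondet_words_def
    by (rule bexI[OF _ assms(1)], rule bexI[OF _ assms(2)], rule exI[of _ r], rule exI[of _ s1],
        rule exI[of _ s2], rule bexI[OF _ assms(3)], rule bexI[OF _ assms(4)], rule disjI2,
        rule disjI2, rule disjI1) (use a in blast)
next
  assume a: "\<rho>1 = r @ \<gamma>1" "\<rho>2 = r @ \<gamma>2" "\<gamma>1 \<noteq> \<gamma>2"
  show "nondet_words X"
    unfolding nondet_words_def
    by (rule bexI[OF _ assms(1)], rule bexI[OF _ assms(2)], rule exI[of _ r], rule exI[of _ "[]"],
        rule exI[of _ "[]"], rule bexI[OF _ assms(3)], rule bexI[OF _ assms(4)], rule disjI2,
        rule disjI2, rule disjI2) (use a in blast)
qed

text \<open>\<open>REmpty\<close> offers neither brackets nor letters. Otherwise the source is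
  reached by some prefix and every node leads on to \<open>F\<close>, so two offending bracket walks
  extend to two marked words with a common prefix.\<close>

lemma sources_nondet:
  assumes s: "source s a" and bad: "ambiguous a \<or> conflicting a"
  shows "nondet_words (rexp_lang (sexp K p0 \<alpha>))"
proof -
  let ?L = "rexp_lang (sexp K p0 \<alpha>)"
  have "\<alpha> \<noteq> REmpty"
  proof
    assume e: "\<alpha> = REmpty"
    have "\<not> letter q l" for q l unfolding letter_def empty_G[OF e] by blast
    moreover have "\<gamma> = []" if "bwalk a \<gamma> q" for \<gamma> q using empty_walk[OF e] that by (auto simp: bwalk_def)
    ultimately show False using bad unfolding ambiguous_def conflicting_def by metis
  qed
  with nonempty_or have ne: "nonempty_rx A \<alpha>" by blast
  obtain r where r: "\<And>w q. walk G a w q \<Longrightarrow> walk G p0 (r @ w) q"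
    using source_reach[OF ne s] by blast
  have "a \<in> Domain G" using s p0_Domain G_closed unfolding source_def by blast
  then have alive: "\<exists>w. walk G q w F" if "bwalk a \<gamma> q" for \<gamma> q
    using that walk_Domain coreach[OF ne] unfolding bwalk_def by blast
  have L: "r @ \<gamma> @ w \<in> ?L" if "bwalk a \<gamma> q" "walk G q w F" for \<gamma> q w
    using that r walk_lang walk_append unfolding bwalk_def by blast
  from bad show ?thesis
  proof
    assume "ambiguous a"
    then obtain \<gamma>1 \<gamma>2 q where b: "bwalk a \<gamma>1 q" "bwalk a \<gamma>2 q" "\<gamma>1 \<noteq> \<gamma>2"
      unfolding ambiguous_def by blast
    from alive[OF b(1)] obtain w where w: "walk G q w F" ..
    \<comment> \<open>The node \<open>q\<close> need not be a letter. The brackets at the start of a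
      common continuation are appended to both words, which stay different; whether a letter or the
      end follows decides which disjunct applies.\<close>
    obtain \<gamma> v where v: "w = \<gamma> @ v" "\<gamma> \<in> bracket_words"
      "v = [] \<or> (\<exists>v' l i. v = (l, i) # v' \<and> l \<in> letter_syms)"
      using first_letter_split by blast
    have bw: "\<gamma>1 @ \<gamma> \<in> bracket_words" "\<gamma>2 @ \<gamma> \<in> bracket_words" "\<gamma>1 @ \<gamma> \<noteq> \<gamma>2 @ \<gamma>"
      using v(2) b by (auto simp: bwalk_def)
    have in_L: "r @ (\<gamma>1 @ \<gamma>) @ v \<in> ?L" "r @ (\<gamma>2 @ \<gamma>) @ v \<in> ?L"
      using L[OF b(1) w] L[OF b(2) w] v by simp_all
    from v(3) show ?thesis
    proof
      assume "v = []"
      then show ?thesis using in_L bw by (intro nondet_wordsI(3)[OF in_L bw(1,2)]) auto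
    next
      assume "\<exists>v' l i. v = (l, i) # v' \<and> l \<in> letter_syms"
      then obtain v' l i where "v = (l, i) # v'" "l \<in> letter_syms" by blast
      then show ?thesis using bw by (intro nondet_wordsI(2)[OF in_L bw(1,2)]) auto
    qed
  next
    assume "conflicting a"
    then obtain \<gamma>1 \<gamma>2 q1 q2 l1 l2 where b: "bwalk a \<gamma>1 q1" "bwalk a \<gamma>2 q2" "letter q1 l1"
      "letter q2 l2" "q1 \<noteq> q2" "conflict l1 l2" unfolding conflicting_def by blast
    have go: "\<exists>w. r @ \<gamma> @ (l, q) # w \<in> ?L" if "bwalk a \<gamma> q" "letter q l" for \<gamma> q l
    proof -
      from that(2) obtain c d where e: "(q, Some l, c, d) \<in> G" by (auto simp: letter_def)
      with G_closed coreach[OF ne] obtain w where "walk G c w F" by blast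
      with e have "walk G q ((l, q) # w) F" by (rule walk_sym)
      from L[OF that(1) this] show ?thesis by blast
    qed
    from go[OF b(1,3)] go[OF b(2,4)] obtain w1 w2 where
      w: "r @ \<gamma>1 @ (l1, q1) # w1 \<in> ?L" "r @ \<gamma>2 @ (l2, q2) # w2 \<in> ?L" by blast
    have bw: "\<gamma>1 \<in> bracket_words" "\<gamma>2 \<in> bracket_words" "l1 \<in> letter_syms" "l2 \<in> letter_syms"
      using b by (auto simp: bwalk_def letter_def)
    from b(6) consider "l1 = l2 \<or> l1 \<in> range Vr" | "l2 \<in> range Vr" unfolding conflict_def by blast
    then show ?thesis
    proof cases
      case 1
      then show ?thesis using b bw by (intro nondet_wordsI(1)[OF w bw(1,2) refl refl]) auto
    next
      \<comment> \<open>\<open>conflict\<close> is symmetric, but the disjunct asks for the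
        reference in the first word, so the two words change roles.\<close>
      case 2
      then show ?thesis using b bw
        by (intro nondet_wordsI(1)[OF w(2,1) bw(2,1) refl refl]) auto
    qed
  qed
qed

lemma nondet_iff: "nondeterministic_rx \<alpha> \<longleftrightarrow> (\<exists>s a. source s a \<and> (ambiguous a \<or> conflicting a))"
  unfolding nondet_iff_words using nondet_sources sources_nondet by blast

end

section \<open>The automaton and its determinism\<close>

context regex_graph
begin

abbreviation vs :: "nat list" where "vs \<equiv> var_list \<alpha>"

abbreviation k :: nat where "k \<equiv> length vs"

definition core_delta :: "nat \<Rightarrow> nat label \<Rightarrow> (nat \<times> action list) set" where
  "core_delta s b = {(q, ss). \<exists>a \<gamma> l. source s a \<and> bwalk a \<gamma> q \<and> letter q l \<and>
     trans vs l (map fst \<gamma>) = (b, ss)}"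

definition trap_delta :: "nat \<Rightarrow> nat label \<Rightarrow> (nat \<times> action list) set" where
  "trap_delta s b = (if s = 1 \<and> b \<in> LTerm ` A then {(1, replicate k AKeep)} else {})"

text \<open>Different sequences of brackets may have the same effect on the memories, so the core of the
  automaton may be deterministic although the regex is not. In that case two useless
  transitions from the initial state enforce nondeterminism.\<close>

definition extra_delta :: "nat \<Rightarrow> nat label \<Rightarrow> (nat \<times> action list) set" where
  "extra_delta s b = (if s = 0 \<and> b = LEps \<and> nondeterministic_rx \<alpha>
     then {(0, replicate k AKeep), (1, replicate k AKeep)} else {})"

definition automaton :: "(nat, nat) tmfa" where
  "automaton = \<lparr>states = {0, 1} \<union> set (letters p0 \<alpha>), alphabet = A, memories = k,
     delta = (\<lambda>s b. core_delta s b \<union> trap_delta s b \<union> extra_delta s b), init = 0,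
     final = {s. \<exists>a \<gamma>. source s a \<and> bwalk a \<gamma> F}, trap = 1\<rparr>"

lemma set_letters_iff: "q \<in> set (letters p0 \<alpha>) \<longleftrightarrow> (\<exists>l. letter q l)"
  unfolding letter_def G_Some set_letters[of q p0 \<alpha> K F] by blast

lemma source_state: "source s a \<Longrightarrow> s \<in> {0, 1} \<union> set (letters p0 \<alpha>)"
  using source_cases set_letters_iff by blast

lemma letter_symbols: "letter q l \<Longrightarrow> (\<exists>c\<in>A. l = Tm c) \<or> (\<exists>x\<in>set vs. l = Vr x)"
proof -
  assume "letter q l"
  then obtain a b where e: "(q, Some l, a, b) \<in> graph K p0 F \<alpha>" and l: "l \<in> letter_syms"
    unfolding letter_def G_Some by blast
  show ?thesis
  proof (cases "\<alpha> = REmpty")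
    case True
    with e have False by (cases \<alpha>) auto
    then show ?thesis ..
  next
    case False
    with nonempty_or have "nonempty_rx A \<alpha>" by blast
    from graph_symbols[OF e this] l show ?thesis by (auto simp: letter_syms_def)
  qed
qed

lemma trans_label:
  assumes "letter q l" "trans vs l g = (b, ss)"
  shows "length ss = k" "b \<in> LTerm ` A \<union> {LEps} \<union> LMem ` {1..k}"
proof -
  from letter_symbols[OF assms(1)]
  have "length ss = k \<and> b \<in> LTerm ` A \<union> {LEps} \<union> LMem ` {1..k}"
  proof (elim disjE bexE)
    fix x assume "x \<in> set vs" "l = Vr x"
    with assms(2) mem_index_nth[of x vs] show ?thesis by (auto split: if_splits)
  qed (use assms(2) in auto)
  then show "length ss = k" "b \<in> LTerm ` A \<union> {LEps} \<union> LMem ` {1..k}" by blast+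
qed

lemma core_delta_D:
  assumes "(q, ss) \<in> core_delta s b"
  shows "q \<in> {0, 1} \<union> set (letters p0 \<alpha>)" "length ss = k" "s \<in> {0, 1} \<union> set (letters p0 \<alpha>)"
    "b \<in> LTerm ` A \<union> {LEps} \<union> LMem ` {1..k}"
  using assms trans_label source_state set_letters_iff unfolding core_delta_def by blast+

lemma core_delta_1: "core_delta 1 b = {}"
  using not_source_1 by (auto simp: core_delta_def)

lemma delta_automaton:
  "delta automaton s b = core_delta s b \<union> trap_delta s b \<union> extra_delta s b"
  by (simp add: automaton_def)

lemma automaton_sel [simp]:
  "states automaton = {0, 1} \<union> set (letters p0 \<alpha>)" "alphabet automaton = A" "memories automaton = k"
  "init automaton = 0" "trap automaton = 1"
  by (simp_all add: automaton_def)

lemma automaton_rej: "is_tmfa_rej automaton"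
proof -
  have delta: "(p, ss) \<in> delta automaton s b \<Longrightarrow> p \<in> states automaton \<and> length ss = k \<and>
      s \<in> states automaton \<and> b \<in> labels automaton" for p ss s b
    unfolding delta_automaton
  proof (elim UnE)
    assume "(p, ss) \<in> core_delta s b"
    from core_delta_D[OF this] show ?thesis by (simp add: labels_def)
  qed (auto simp: trap_delta_def extra_delta_def labels_def split: if_splits)
  have trap: "delta automaton (trap automaton) b =
      (if b \<in> LTerm ` A then {(1, replicate k AKeep)} else {})" for b
    using core_delta_1[of b] by (simp add: delta_automaton trap_delta_def extra_delta_def)
  have "delta automaton q b \<subseteq> states automaton \<times> {ss. length ss = memories automaton}" for q b
    using delta by (intro subsetI) (metis (mono_tags) SigmaI automaton_sel(3) mem_Collect_eq surj_pair)
  moreover have "q \<notin> states automaton \<or> b \<notin> labels automaton \<longrightarrow> delta automaton q b = {}" for q b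
    using delta by (metis equals0I surj_pair)
  moreover have "final automaton \<subseteq> states automaton" "trap automaton \<notin> final automaton"
    using source_state not_source_1 unfolding automaton_def by auto
  moreover have "delta automaton (trap automaton) (LTerm a) =
      {(trap automaton, replicate (memories automaton) AKeep)}" if "a \<in> alphabet automaton" for a
    using that trap by simp
  moreover have "delta automaton (trap automaton) b = {}" if "b \<notin> LTerm ` alphabet automaton" for b
    using that trap by simp
  moreover have "finite (states automaton)" "finite (alphabet automaton)"
    "init automaton \<in> states automaton" "trap automaton \<in> states automaton"
    using finite_A by simp_all
  ultimately show ?thesis unfolding is_tmfa_rej_def is_tmfa_def by blast
qed

lemma card_states: "card (states automaton) = occurrences \<alpha> + 2"
proof -
  have "card ({0, 1} \<union> set (letters p0 \<alpha>)) = card {0 :: nat, 1} + card (set (letters p0 \<alpha>))"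
    using letters_range[of p0 \<alpha>] p0 by (intro card_Un_disjoint) auto
  then show ?thesis
    by (simp add: distinct_card[OF distinct_letters] length_letters)
qed

text \<open>For a nondeterministic regex the two extra \<epsilon>-transitions violate the
  cardinality bound. For a deterministic one, two core transitions from one state coincide unless
  they read different terminals (\<open>same\<close>), which yields both the cardinality bound and
  the exclusion of other labels beside \<epsilon> and recalls.\<close>

lemma deterministic_automaton: "deterministic_tmfa automaton \<longleftrightarrow> deterministic_rx \<alpha>"
proof
  assume det: "deterministic_tmfa automaton"
  show "deterministic_rx \<alpha>"
  proof (rule ccontr)
    assume "\<not> deterministic_rx \<alpha>"
    then have sub: "{(0, replicate k AKeep), (1, replicate k AKeep)} \<subseteq> delta automaton 0 LEps"
      by (simp add: deterministic_rx_def delta_automaton extra_delta_def)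
    have "finite (delta automaton 0 LEps)" "card (delta automaton 0 LEps) \<le> 1"
      using det unfolding deterministic_tmfa_def labels_def by (simp_all only: automaton_sel) blast+
    with card_mono[OF this(1) sub] show False by simp
  qed
next
  assume "deterministic_rx \<alpha>"
  then have nd: "\<not> nondeterministic_rx \<alpha>" by (simp add: deterministic_rx_def)
  then have good: "\<not> ambiguous a" "\<not> conflicting a" if "source s a" for s a
    using nondet_iff that by blast+
  have delta: "delta automaton s b = core_delta s b \<union> trap_delta s b" for s b
    using nd by (simp add: delta_automaton extra_delta_def)
  have same: "l = l' \<and> \<gamma> = \<gamma>' \<and> q = q' \<or> (\<exists>c c'. l = Tm c \<and> l' = Tm c' \<and> c \<noteq> c')"
    if "source s a" "source s a'" "bwalk a \<gamma> q" "bwalk a' \<gamma>' q'" "letter q l" "letter q' l'"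
    for s a a' \<gamma> \<gamma>' q q' l l'
  proof -
    have [simp]: "a' = a" using that source_unique by blast
    show ?thesis
    proof (cases "q = q'")
      case True
      moreover from this that have "bwalk a \<gamma>' q" by simp
      then have "\<gamma> \<noteq> \<gamma>' \<Longrightarrow> ambiguous a" unfolding ambiguous_def using that(3) by blast
      then have "\<gamma> = \<gamma>'" using good(1)[OF that(1)] by blast
      moreover have "l = l'" using that(5,6) True letter_unique by blast
      ultimately show ?thesis by blast
    next
      case False
      moreover have "bwalk a \<gamma>' q'" using that by simp
      ultimately have "conflict l l' \<Longrightarrow> conflicting a"
        unfolding conflicting_def using that(3,5,6) by blast
      then have "\<not> conflict l l'" using good(2)[OF that(1)] by blast
      with letter_symbols[OF that(5)] letter_symbols[OF that(6)] show ?thesis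
        by (auto simp: conflict_def)
    qed
  qed
  have one: "x = y" if "x \<in> delta automaton s b" "y \<in> delta automaton s b" for s b x y
  proof (cases "s = 1")
    case True
    then show ?thesis using that core_delta_1 by (auto simp: delta trap_delta_def split: if_splits)
  next
    case False
    then have "x \<in> core_delta s b" "y \<in> core_delta s b" using that by (auto simp: delta trap_delta_def)
    then obtain q ss a \<gamma> l q' ss' a' \<gamma>' l' where
      x: "x = (q, ss)" "source s a" "bwalk a \<gamma> q" "letter q l" "trans vs l (map fst \<gamma>) = (b, ss)" and
      y: "y = (q', ss')" "source s a'" "bwalk a' \<gamma>' q'" "letter q' l'" "trans vs l' (map fst \<gamma>') = (b, ss')"
      unfolding core_delta_def by blast
    from same[OF x(2) y(2) x(3) y(3) x(4) y(4)] x y show ?thesis by auto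
  qed
  have card: "finite (delta automaton s b) \<and> card (delta automaton s b) \<le> 1" for s b
  proof (cases "delta automaton s b = {}")
    case False
    then obtain x where "x \<in> delta automaton s b" by blast
    with one have "delta automaton s b = {x}" by blast
    then show ?thesis by simp
  qed simp
  have excl: "delta automaton s b' = {}"
    if "b = LEps \<or> b \<in> LMem ` {1..k}" "delta automaton s b \<noteq> {}" "b' \<noteq> b" for s b b'
  proof (rule ccontr)
    assume ne: "delta automaton s b' \<noteq> {}"
    have nt: "trap_delta s b = {}" using that(1) by (auto simp: trap_delta_def)
    with that(2) have s1: "s \<noteq> 1" "core_delta s b \<noteq> {}" using core_delta_1 by (auto simp: delta)
    with ne have "core_delta s b' \<noteq> {}" by (auto simp: delta trap_delta_def)
    with s1 obtain q ss a \<gamma> l q' ss' a' \<gamma>' l' where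
      x: "source s a" "bwalk a \<gamma> q" "letter q l" "trans vs l (map fst \<gamma>) = (b, ss)" and
      y: "source s a'" "bwalk a' \<gamma>' q'" "letter q' l'" "trans vs l' (map fst \<gamma>') = (b', ss')"
      unfolding core_delta_def by auto
    from same[OF x(1) y(1) x(2) y(2) x(3) y(3)] x(4) y(4) that show False by auto
  qed
  show "deterministic_tmfa automaton"
    unfolding deterministic_tmfa_def
  proof (intro conjI ballI impI)
    fix s x y
    assume "x \<in> {LEps} \<union> LMem ` {1..memories automaton}" "delta automaton s x \<noteq> {}" "y \<noteq> x"
    then show "delta automaton s y = {}" by (intro excl[of x]) auto
  qed (use card in blast)+
qed

section \<open>Runs of the automaton and its language\<close>

definition ctx :: "(nsym \<times> nat) list \<Rightarrow> nsym list" where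
  "ctx c = rev (map fst c)"

lemma ctx_simps [simp]: "ctx [] = []" "ctx (u @ [(l, q)]) = l # ctx u" "ctx (u @ v) = ctx v @ ctx u"
  by (simp_all add: ctx_def)

definition mems :: "(nsym \<times> nat) list \<Rightarrow> nat memory list" where
  "mems c = map (mem_val (ctx c)) vs"

lemma lang_well_bracketed:
  assumes "w \<in> rexp_lang (sexp K p0 \<alpha>)" "nonempty_rx A \<alpha>"
  shows "well_bracketed (ctx w)"
proof -
  from assms(1) have "map fst w \<in> ref_lang \<alpha>" by (simp add: ref_lang_sexp[of \<alpha> K p0])
  from ref_lang_well_bracketed[OF this assms(2), of "[]"] show ?thesis by (simp add: ctx_def)
qed

text \<open>A walk from the start can be completed to a marked word, and well-bracketedness passes
  to prefixes. This makes the invariant available in the middle of a run.\<close>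

lemma walk_well_bracketed:
  assumes "walk G p0 c r"
  shows "well_bracketed (ctx c)"
proof (cases "\<alpha> = REmpty")
  case True
  with empty_walk assms have "c = []" by blast
  then show ?thesis by simp
next
  case False
  with nonempty_or have ne: "nonempty_rx A \<alpha>" by blast
  have "r \<in> Domain G" using assms walk_Domain p0_Domain by blast
  with coreach[OF ne] obtain w where "walk G r w F" by blast
  with assms have "c @ w \<in> rexp_lang (sexp K p0 \<alpha>)" using walk_append walk_lang by blast
  from lang_well_bracketed[OF this ne] show ?thesis by (simp add: well_bracketed_append)
qed

text \<open>A recall reads the memory before the brackets of its transition take effect, whereas
  dereferencing sees it after them. If the memory is closed afterwards, it cannot just have been
  opened, and only \<open>AReset\<close> has changed its content.\<close>

lemma recall_memory:
  assumes "set g \<subseteq> bracket_syms" "snd (mem_val (rev g @ c) y) = Closed"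
  shows "if act g y = AReset then mem_val (rev g @ c) y = ([], Closed)
    else (act g y = AKeep \<or> act g y = AClose) \<and> mem_val (rev g @ c) y = (fst (mem_val c y), Closed)"
proof -
  obtain u where u: "mem_val (rev g @ c) y = (u, Closed)"
    using assms(2) by (cases "mem_val (rev g @ c) y") simp
  obtain u' r' where m: "mem_val c y = (u', r')" by (cases "mem_val c y")
  have "(u, Closed) = update_memory [] (act g y) (mem_val c y)"
    using update_act[OF assms(1), of "[]" y c] u by simp
  with m u show ?thesis by (cases "act g y"; cases r') auto
qed

text \<open>One transition corresponds to prolonging a prefix by brackets and one letter, and
  \<open>v\<close> is the input it consumes. Both inclusions between the languages rest on
  this.\<close>

lemma step_effect:
  assumes pre: "pre c s" and s: "source s a" and b: "bwalk a \<gamma> q" and l: "letter q l"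
    and t: "trans vs l (map fst \<gamma>) = (b, ss)"
  defines "c' \<equiv> c @ \<gamma> @ [(l, q)]"
  defines "v \<equiv> sym_val (ctx (c @ \<gamma>)) l"
  shows "pre c' q" "outp (ctx c') = outp (ctx c) @ v"
    "mems c' = map2 (update_memory v) ss (mems c)"
    "(\<exists>d. b = LTerm d \<and> v = [d]) \<or> (b = LEps \<and> v = []) \<or>
      (\<exists>i. b = LMem i \<and> ss ! (i - 1) = AClose \<and> v = fst (mems c ! (i - 1)))"
proof -
  define g where "g = map fst \<gamma>"
  have g: "set g \<subseteq> bracket_syms" using b bracket_words_fst by (auto simp: bwalk_def g_def)
  have ctx': "ctx c' = l # rev g @ ctx c" "ctx (c @ \<gamma>) = rev g @ ctx c"
    by (simp_all add: c'_def g_def ctx_def)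
  have v_eq: "v = sym_val (rev g @ ctx c) l" unfolding v_def ctx' ..
  have w: "walk G p0 (c @ \<gamma>) q" using pre_walk[OF pre s] b by (simp add: bwalk_def)
  with l show pre': "pre c' q" unfolding pre_def c'_def by auto
  show "outp (ctx c') = outp (ctx c) @ v"
    unfolding v_eq ctx' by (simp add: outp_brackets[OF g])
  from pre' obtain a' where a': "source q a'" using letter_source[OF l] by blast
  from walk_well_bracketed[OF pre_walk[OF pre' a' walk_refl]]
  have wb: "well_bracketed (l # rev g @ ctx c)" using ctx' by simp
  from letter_symbols[OF l] have "mems c' = map2 (update_memory v) ss (mems c) \<and>
    ((\<exists>d. b = LTerm d \<and> v = [d]) \<or> (b = LEps \<and> v = []) \<or>
      (\<exists>i. b = LMem i \<and> ss ! (i - 1) = AClose \<and> v = fst (mems c ! (i - 1))))"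
  proof (elim disjE bexE)
    fix d assume d: "l = Tm d"
    with t have "b = LTerm d" "ss = map (act g) vs" by (auto simp: g_def)
    with d show ?thesis
      by (simp add: mems_def ctx' v_eq map2_map_map update_act[OF g])
  next
    fix x assume x: "l = Vr x" "x \<in> set vs"
    let ?m = "mem_val (rev g @ ctx c) x"
    have closed: "snd ?m = Closed" using wb x by simp
    have v: "v = fst ?m" by (simp add: v_eq x)
    note rm = recall_memory[OF g closed]
    show ?thesis
    proof (cases "act g x = AReset")
      case True
      with t x have "b = LEps" "ss = map (act g) vs" by (auto simp: g_def)
      moreover have "v = []" using rm True v by simp
      moreover have "mems c' = map2 (update_memory v) ss (mems c)"
        using calculation by (simp add: mems_def ctx' x map2_map_map update_act[OF g] v)
      ultimately show ?thesis by blast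
    next
      case False
      with t x have bs: "b = LMem (mem_index vs x)" "ss = map ((act g)(x := AClose)) vs"
        by (auto simp: g_def)
      have m: "?m = (v, Closed)" "fst (mem_val (ctx c) x) = v" using rm False v by auto
      \<comment> \<open>At \<open>x\<close> the forced \<open>AClose\<close> gives the right memory
        because the content is unchanged and the memory is closed after the brackets; elsewhere the
        action is the original one.\<close>
      have "update_memory v (((act g)(x := AClose)) y) (mem_val (ctx c) y) = mem_val (ctx c') y" for y
      proof (cases "y = x")
        case True
        with m show ?thesis
          by (cases "mem_val (ctx c) x") (simp add: ctx' x)
      next
        case False
        then show ?thesis by (simp add: ctx' x update_act[OF g] v)
      qed
      then have "mems c' = map2 (update_memory v) ss (mems c)"
        unfolding mems_def bs map2_map_map by simp
      moreover have "ss ! (mem_index vs x - 1) = AClose" "v = fst (mems c ! (mem_index vs x - 1))"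
        using mem_index_nth[OF x(2)] m by (auto simp: bs mems_def)
      ultimately show ?thesis using bs by blast
    qed
  qed
  then show "mems c' = map2 (update_memory v) ss (mems c)"
    "(\<exists>d. b = LTerm d \<and> v = [d]) \<or> (b = LEps \<and> v = []) \<or>
      (\<exists>i. b = LMem i \<and> ss ! (i - 1) = AClose \<and> v = fst (mems c ! (i - 1)))" by blast+
qed

lemma mems_Nil: "mems [] = replicate k ([], Closed)"
  by (rule nth_equalityI) (simp_all add: mems_def)

abbreviation moves :: "(nat, nat) config \<Rightarrow> (nat, nat) config \<Rightarrow> bool" where
  "moves \<equiv> (move automaton)\<^sup>*\<^sup>*"

text \<open>Cutting the prefix before its last letter and the brackets in front of it gives a
  shorter prefix of the same kind and one transition. The unread input \<open>w\<close> is
  arbitrary, so that the shorter run can leave the last consumed word behind.\<close>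

lemma run_prefix: "pre c s \<Longrightarrow> moves (0, outp (ctx c) @ w, mems []) (s, w, mems c)"
proof (induction "length c" arbitrary: c s w rule: less_induct)
  case less
  from less.prems show ?case unfolding pre_def
  proof
    assume "c = [] \<and> s = 0"
    then show ?thesis by simp
  next
    assume "\<exists>c' l. c = c' @ [(l, s)] \<and> letter s l \<and> walk G p0 c' s"
    then obtain c' l where c: "c = c' @ [(l, s)]" "letter s l" "walk G p0 c' s" by blast
    from pre_decomp[OF c(3)] obtain c0 \<gamma> s0 a where
      d: "c' = c0 @ \<gamma>" "pre c0 s0" "source s0 a" "bwalk a \<gamma> s" by blast
    obtain b ss where t: "trans vs l (map fst \<gamma>) = (b, ss)" by fastforce
    define v where "v = sym_val (ctx (c0 @ \<gamma>)) l"
    note eff = step_effect[OF d(2-4) c(2) t, folded v_def]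
    have c_eq: "c = c0 @ \<gamma> @ [(l, s)]" by (simp add: c(1) d(1))
    have del: "(s, ss) \<in> delta automaton s0 b"
      using d c(2) t by (auto simp: automaton_def core_delta_def)
    have "move automaton (s0, v @ w, mems c0) (s, w, mems c)"
      unfolding c_eq eff(3) using eff(4)
    proof (elim disjE exE conjE)
      fix x assume "b = LTerm x" "v = [x]"
      with del show "move automaton (s0, v @ w, mems c0) (s, w, map2 (update_memory v) ss (mems c0))"
        using move.read[of s ss automaton s0 x w "mems c0"] by simp
    next
      assume "b = LEps" "v = []"
      with del show "move automaton (s0, v @ w, mems c0) (s, w, map2 (update_memory v) ss (mems c0))"
        using move.eps[of s ss automaton s0 w "mems c0"] by simp
    next
      fix i assume "b = LMem i" "ss ! (i - 1) = AClose" "v = fst (mems c0 ! (i - 1))"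
      with del show "move automaton (s0, v @ w, mems c0) (s, w, map2 (update_memory v) ss (mems c0))"
        by (auto intro: move.recall)
    qed
    moreover have "moves (0, outp (ctx c0) @ v @ w, mems []) (s0, v @ w, mems c0)"
      using d(2) by (intro less.hyps) (simp_all add: c_eq)
    ultimately show ?thesis
      using eff(2) unfolding c_eq by simp
  qed
qed

lemma move_trap: "move automaton (1, w, ms) (q, w', ms') \<Longrightarrow> q = 1"
proof (cases rule: move.cases, assumption)
  fix p ss q' a w0 ms0
  assume "(1, w, ms) = (q', [a] @ w0, ms0)" "(q, w', ms') = (p, w0, map2 (update_memory [a]) ss ms0)"
    "(p, ss) \<in> delta automaton q' (LTerm a)"
  then show ?thesis using core_delta_1
    by (auto simp: automaton_def trap_delta_def extra_delta_def split: if_splits)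
next
  fix p ss q' w0 ms0
  assume "(1, w, ms) = (q', w0, ms0)" "(q, w', ms') = (p, w0, map2 (update_memory []) ss ms0)"
    "(p, ss) \<in> delta automaton q' LEps"
  then show ?thesis using core_delta_1
    by (auto simp: automaton_def trap_delta_def extra_delta_def split: if_splits)
next
  fix p ss q' i v ms0 w0
  assume "(1, w, ms) = (q', v @ w0, ms0)" "(q, w', ms') = (p, w0, map2 (update_memory v) ss ms0)"
    "(p, ss) \<in> delta automaton q' (LMem i)"
  then show ?thesis using core_delta_1
    by (auto simp: automaton_def trap_delta_def extra_delta_def split: if_splits)
next
  fix w0 ms0
  assume "(q, w', ms') = (trap automaton, w0, ms0)"
  then show ?thesis by (simp add: automaton_def)
qed

text \<open>Recall failures and one of the extra transitions lead into the trap, which is never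
  left. The other extra transition loops at the initial state without changing anything, so the
  prefix stays the same.\<close>

lemma run_invariant:
  assumes "moves (0, w, mems []) (q, w', ms)"
  shows "q = 1 \<or> (\<exists>c. pre c q \<and> w = outp (ctx c) @ w' \<and> ms = mems c)"
  using assms
proof (induction "(0 :: nat, w, mems [])" "(q, w', ms)" arbitrary: q w' ms rule: rtranclp.induct)
  case rtrancl_refl
  then show ?case by (auto simp: pre_def)
next
  case (rtrancl_into_rtrancl cfg)
  obtain q1 w1 ms1 where cfg: "cfg = (q1, w1, ms1)" by (cases cfg)
  with rtrancl_into_rtrancl have mv: "move automaton (q1, w1, ms1) (q, w', ms)"
    and IH: "q1 = 1 \<or> (\<exists>c. pre c q1 \<and> w = outp (ctx c) @ w1 \<and> ms1 = mems c)" by auto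
  show ?case
  proof (cases "q1 = 1 \<or> q = 1")
    case True
    then show ?thesis using move_trap mv by blast
  next
    case False
    with IH obtain c where c: "pre c q1" "w = outp (ctx c) @ w1" "ms1 = mems c" by blast
    have core: "\<exists>c. pre c q \<and> w = outp (ctx c) @ w' \<and> ms = mems c"
      if core: "(q, ss) \<in> core_delta q1 b" and w1: "w1 = v @ w'"
        and ms: "ms = map2 (update_memory v) ss (mems c)" and
        b: "b = LTerm d \<and> v = [d] \<or> b = LEps \<and> v = [] \<or> b = LMem i \<and> v = fst (mems c ! (i - 1))"
      for b ss v d i
    proof -
      from core obtain a \<gamma> l where d: "source q1 a" "bwalk a \<gamma> q" "letter q l"
        "trans vs l (map fst \<gamma>) = (b, ss)" unfolding core_delta_def by blast
      note eff = step_effect[OF c(1) d]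
      have "v = sym_val (ctx (c @ \<gamma>)) l" using eff(4) b by auto
      then show ?thesis using eff(1-3) c(2) w1 ms by (intro exI[of _ "c @ \<gamma> @ [(l, q)]"]) simp
    qed
    have sub: "(q, ss) \<in> core_delta q1 b \<or>
        (b = LEps \<and> q = 0 \<and> q1 = 0 \<and> ss = replicate k AKeep)" if "(q, ss) \<in> delta automaton q1 b" for b ss
      using that False by (auto simp: automaton_def trap_delta_def extra_delta_def split: if_splits)
    have keep: "map2 (update_memory []) (replicate k AKeep) (mems c) = mems c"
    proof -
      have "update_memory [] AKeep m = m" for m :: "nat memory"
        by (cases "([] :: nat list, AKeep, m)" rule: update_memory.cases) auto
      moreover have "replicate k AKeep = map (\<lambda>_. AKeep) vs" by (simp add: map_replicate_const)
      ultimately show ?thesis unfolding mems_def by (simp add: map2_map_map)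
    qed
    from mv show ?thesis
    proof cases
      case (read ss a)
      with sub[OF read(3)] core[of ss "LTerm a" "[a]" a] c(3) show ?thesis by simp
    next
      case (eps ss)
      have "(q, ss) \<in> delta automaton q1 LEps" by (rule eps)
      from sub[OF this] show ?thesis
      proof
        assume "(q, ss) \<in> core_delta q1 LEps"
        with core[of ss LEps "[]"] eps c(3) show ?thesis by auto
      next
        assume "LEps = LEps \<and> q = 0 \<and> q1 = 0 \<and> ss = replicate k AKeep"
        with eps c keep show ?thesis by auto
      qed
    next
      case (recall ss i v)
      with sub[OF recall(3)] core[of ss "LMem i" v _ i] c(3) show ?thesis by auto
    next
      case failure
      with False show ?thesis by (simp add: automaton_def)
    qed
  qed
qed

lemma automaton_lang: "tmfa_lang automaton = rx_lang \<alpha>"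
proof (intro equalityI subsetI)
  fix w assume "w \<in> tmfa_lang automaton"
  then obtain s ms where s: "s \<in> final automaton" "moves (0, w, mems []) (s, [], ms)"
    by (auto simp: tmfa_lang_def mems_Nil automaton_def)
  from s(1) obtain a \<gamma> where a: "source s a" "bwalk a \<gamma> F" by (auto simp: automaton_def)
  with not_source_1 have "s \<noteq> 1" by blast
  with run_invariant[OF s(2)] obtain c where c: "pre c s" "w = outp (ctx c)" by auto
  have wk: "walk G p0 (c @ \<gamma>) F" using pre_walk[OF c(1) a(1)] a(2) by (simp add: bwalk_def)
  then have L: "c @ \<gamma> \<in> rexp_lang (sexp K p0 \<alpha>)" by (simp add: walk_lang)
  have "deref (map fst (c @ \<gamma>)) = outp (ctx (c @ \<gamma>))"
    using deref_eq_outp[OF walk_well_bracketed[OF wk]] by (simp add: ctx_def)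
  \<comment> \<open>The brackets after the last letter produce no output, so acceptance can be
    decided in the state of that letter.\<close>
  also have "\<dots> = w"
    using a(2) c(2) outp_brackets[OF bracket_words_fst, of \<gamma> "ctx c"] by (simp add: ctx_def bwalk_def)
  finally show "w \<in> rx_lang \<alpha>"
    using L unfolding rx_lang_def ref_lang_sexp[of \<alpha> K p0] by (metis image_eqI)
next
  fix w assume "w \<in> rx_lang \<alpha>"
  then obtain u where u: "u \<in> rexp_lang (sexp K p0 \<alpha>)" "w = deref (map fst u)"
    unfolding rx_lang_def ref_lang_sexp[of \<alpha> K p0] by blast
  then have wk: "walk G p0 u F" by (simp add: walk_lang)
  have w: "w = outp (ctx u)"
    using deref_eq_outp[OF walk_well_bracketed[OF wk]] u(2) by (simp add: ctx_def)
  from pre_decomp[OF wk] obtain c \<gamma> s a where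
    d: "u = c @ \<gamma>" "pre c s" "source s a" "bwalk a \<gamma> F" by blast
  have wc: "w = outp (ctx c)"
    using d w outp_brackets[OF bracket_words_fst, of \<gamma> "ctx c"] by (simp add: ctx_def bwalk_def)
  \<comment> \<open>\<open>tmfa_lang\<close> admits only words over the alphabet, so the output has
    to be confined to it.\<close>
  have "set w \<subseteq> A"
    unfolding w
  proof (rule outp_lists)
    fix t assume "Tm t \<in> set (ctx u)"
    then obtain q where "(Tm t, q) \<in> set u" by (auto simp: ctx_def)
    then obtain u1 u2 where "u = u1 @ (Tm t, q) # u2" by (auto simp: in_set_conv_decomp)
    with wk obtain x y where "(q, Some (Tm t), x, y) \<in> G" using walk_splitE by blast
    then have "letter q (Tm t)" by (auto simp: letter_def letter_syms_def)
    from letter_symbols[OF this] show "t \<in> A" by auto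
  qed
  moreover have "s \<in> final automaton" using d by (auto simp: automaton_def)
  moreover have "moves (0, w, mems []) (s, [], mems c)" using run_prefix[OF d(2), of "[]"] wc by simp
  ultimately show "w \<in> tmfa_lang automaton"
    by (auto simp: tmfa_lang_def mems_Nil automaton_def)
qed

end

section \<open>Reasoning about programs\<close>

text \<open>A weakest precondition for total correctness with a step count. The equations for the
  program constructors let the simplifier execute straight-line code symbolically.\<close>

definition run :: "prog \<Rightarrow> store \<Rightarrow> (nat \<Rightarrow> store \<Rightarrow> bool) \<Rightarrow> bool" where
  "run c s Q \<longleftrightarrow> (\<exists>t s'. exec c s t s' \<and> Q t s')"

inductive_cases exec_SkipE: "exec Skip s t s'"
inductive_cases exec_PutE: "exec (Put a e1 e2) s t s'"
inductive_cases exec_SeqE: "exec (Seq c1 c2) s t s'"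
inductive_cases exec_CondE: "exec (Cond b c1 c2) s t s'"

lemma run_Skip [simp]: "run Skip s Q \<longleftrightarrow> Q 1 s"
  unfolding run_def using exec_Skip by (metis exec_SkipE)

lemma run_Put [simp]:
  "run (Put a e1 e2) s Q \<longleftrightarrow> Q 1 (s(a := (s a)(eval_exp e1 s := eval_exp e2 s)))"
  unfolding run_def using exec_Put by (metis exec_PutE)

lemma run_Seq [simp]:
  "run (Seq c1 c2) s Q \<longleftrightarrow> run c1 s (\<lambda>t1 s1. run c2 s1 (\<lambda>t2 s2. Q (t1 + t2) s2))"
  unfolding run_def using exec_Seq by (metis exec_SeqE)

lemma run_Cond [simp]:
  "run (Cond b c1 c2) s Q \<longleftrightarrow>
    (if eval_test b s then run c1 s (\<lambda>t. Q (Suc t)) else run c2 s (\<lambda>t. Q (Suc t)))"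
proof (cases "eval_test b s")
  case True
  with exec_Cond_True[OF True, of c1 _ _ c2] show ?thesis
    unfolding run_def by (metis exec_CondE plus_1_eq_Suc)
next
  case False
  with exec_Cond_False[OF False, of c2 _ _ c1] show ?thesis
    unfolding run_def by (metis exec_CondE plus_1_eq_Suc)
qed

lemma run_mono: "run c s P \<Longrightarrow> (\<And>t s'. P t s' \<Longrightarrow> Q t s') \<Longrightarrow> run c s Q"
  unfolding run_def by blast

lemma run_SeqI:
  "run c1 s P \<Longrightarrow> (\<And>t1 s1. P t1 s1 \<Longrightarrow> run c2 s1 (\<lambda>t2 s2. Q (t1 + t2) s2)) \<Longrightarrow> run (Seq c1 c2) s Q"
  unfolding run_Seq by (rule run_mono)

section \<open>Frame conditions and rules for loops\<close>

fun writes :: "prog \<Rightarrow> nat set" where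
  "writes Skip = {}"
| "writes (Put a e1 e2) = {a}"
| "writes (Seq c1 c2) = writes c1 \<union> writes c2"
| "writes (Cond b c1 c2) = writes c1 \<union> writes c2"
| "writes (While b c) = writes c"

text \<open>A frame condition on whole arrays: it comes for free from the program text
  (\<open>exec_same\<close>) and keeps loop invariants restricted to the arrays that change.\<close>

definition same :: "nat set \<Rightarrow> store \<Rightarrow> store \<Rightarrow> bool" where
  "same X s s' \<longleftrightarrow> (\<forall>a. a \<notin> X \<longrightarrow> s' a = s a)"

lemma sameD: "same X s s' \<Longrightarrow> a \<notin> X \<Longrightarrow> s' a = s a"
  by (simp add: same_def)

lemma same_refl [simp]: "same X s s"
  by (simp add: same_def)

lemma same_trans: "same X s s' \<Longrightarrow> same Y s' s'' \<Longrightarrow> same (X \<union> Y) s s''"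
  by (simp add: same_def)

lemma same_mono: "same X s s' \<Longrightarrow> X \<subseteq> Y \<Longrightarrow> same Y s s'"
  by (auto simp: same_def)

lemma exec_same: "exec c s t s' \<Longrightarrow> same (writes c) s s'"
  by (induction rule: exec.induct) (auto simp: same_def)

lemma run_same: "run c s Q \<Longrightarrow> run c s (\<lambda>t s'. Q t s' \<and> same (writes c) s s')"
  unfolding run_def using exec_same by blast

text \<open>\<open>\<Phi>\<close> bounds the remaining time. The strict decrease pays for the loop
  test of each round, and the final test is the extra step in
  \<open>Suc (\<Phi> s0)\<close>.\<close>

lemma run_while:
  fixes \<Phi> :: "store \<Rightarrow> nat"
  assumes "I s0"
    and step: "\<And>s. I s \<Longrightarrow> same (writes c) s0 s \<Longrightarrow> eval_test b s \<Longrightarrow>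
      run c s (\<lambda>t s'. I s' \<and> t + \<Phi> s' < \<Phi> s)"
    and exit: "\<And>t s'. I s' \<Longrightarrow> same (writes c) s0 s' \<Longrightarrow> \<not> eval_test b s' \<Longrightarrow>
      t \<le> Suc (\<Phi> s0) \<Longrightarrow> Q t s'"
  shows "run (While b c) s0 Q"
proof -
  have "\<exists>t s'. exec (While b c) s t s' \<and> I s' \<and> same (writes c) s0 s' \<and> \<not> eval_test b s' \<and> t \<le> Suc (\<Phi> s)"
    if "I s" "same (writes c) s0 s" for s
    using that
  proof (induction "\<Phi> s" arbitrary: s rule: less_induct)
    case less
    show ?case
    proof (cases "eval_test b s")
      case True
      from run_same[OF step[OF less.prems True]] obtain t s' where
        1: "exec c s t s'" "I s'" "t + \<Phi> s' < \<Phi> s" "same (writes c) s s'" unfolding run_def by blast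
      have "same (writes c) s0 s'" using same_trans[OF less.prems(2) 1(4)] by simp
      with less.hyps[of s'] 1 obtain t' s'' where
        2: "exec (While b c) s' t' s''" "I s''" "same (writes c) s0 s''" "\<not> eval_test b s''"
          "t' \<le> Suc (\<Phi> s')" by auto
      from exec_While_True[OF True 1(1) 2(1)] 1 2 show ?thesis
        by (intro exI[of _ "1 + t + t'"] exI[of _ s'']) auto
    next
      case False
      with less.prems show ?thesis
        by (intro exI[of _ 1] exI[of _ s]) (simp add: exec_While_False[unfolded One_nat_def])
    qed
  qed
  from this[OF assms(1)] exit show ?thesis unfolding run_def by auto
qed

abbreviation reg :: "nat \<Rightarrow> exp" where "reg r \<equiv> Get r (Const 0)"

abbreviation put_reg :: "nat \<Rightarrow> exp \<Rightarrow> prog" where "put_reg r e \<equiv> Put r (Const 0) e"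

definition for_upto :: "nat \<Rightarrow> exp \<Rightarrow> prog \<Rightarrow> prog" where
  "for_upto r e c = Seq (put_reg r (Const 0))
     (While (Less (reg r) e) (Seq c (put_reg r (Add (reg r) (Const 1)))))"

lemma writes_for_upto [simp]: "writes (for_upto r e c) = insert r (writes c)"
  by (auto simp: for_upto_def)

text \<open>Each round costs two steps besides the body (test and increment); two more are the
  initialisation and the last test. \<open>stable\<close> demands an invariant that does not look at
  the counter, since the counter is incremented after the body.\<close>

lemma run_for_upto:
  fixes T :: "nat \<Rightarrow> nat"
  assumes r: "r \<notin> writes c"
    and bound: "\<And>s. same (insert r (writes c)) s0 s \<Longrightarrow> eval_exp e s = n"
    and stable: "\<And>i s s'. I i s \<Longrightarrow> same {r} s s' \<Longrightarrow> I i s'"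
    and start: "I 0 s0"
    and step: "\<And>i s. i < n \<Longrightarrow> I i s \<Longrightarrow> s r 0 = i \<Longrightarrow> same (insert r (writes c)) s0 s \<Longrightarrow>
      run c s (\<lambda>t s'. I (Suc i) s' \<and> t \<le> T i)"
    and exit: "\<And>t s'. I n s' \<Longrightarrow> same (insert r (writes c)) s0 s' \<Longrightarrow>
      t \<le> 2 + (\<Sum>i<n. T i + 2) \<Longrightarrow> Q t s'"
  shows "run (for_upto r e c) s0 Q"
proof -
  let ?s = "s0(r := (s0 r)(0 := 0))"
  let ?b = "Seq c (put_reg r (Add (reg r) (Const 1)))"
  define J where "J s \<longleftrightarrow> I (s r 0) s \<and> s r 0 \<le> n" for s
  define \<Phi> where "\<Phi> s = (\<Sum>i\<in>{s r 0..<n}. T i + 2)" for s :: store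
  have s: "same {r} s0 ?s" by (simp add: same_def)
  have w: "writes ?b = insert r (writes c)" by auto
  have tr: "same (insert r (writes c)) s0 s" if "same (insert r (writes c)) ?s s" for s
    using that by (simp add: same_def)
  have "run (While (Less (reg r) e) ?b) ?s (\<lambda>t s'. Q (Suc t) s')"
  proof (rule run_while[of J ?s ?b _ \<Phi>])
    show "J ?s" using stable[OF start s] by (simp add: J_def)
  next
    fix s assume a: "J s" "same (writes ?b) ?s s" "eval_test (Less (reg r) e) s"
    then have f: "same (insert r (writes c)) s0 s" using tr unfolding w by blast
    with a bound[OF f] have i: "s r 0 < n" "I (s r 0) s" by (auto simp: J_def)
    have "run c s (\<lambda>t s'. (I (Suc (s r 0)) s' \<and> t \<le> T (s r 0)) \<and> same (writes c) s s')"
      by (rule run_same[OF step[OF i refl f]])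
    then have "run c s (\<lambda>t1 s1. run (put_reg r (Add (reg r) (Const 1))) s1
        (\<lambda>t2 s2. J s2 \<and> t1 + t2 + \<Phi> s2 < \<Phi> s))"
    proof (rule run_mono)
      fix t s' assume b: "(I (Suc (s r 0)) s' \<and> t \<le> T (s r 0)) \<and> same (writes c) s s'"
      then have r': "s' r = s r" using r by (simp add: same_def)
      have "\<Phi> s = T (s r 0) + 2 + (\<Sum>i\<in>{Suc (s r 0)..<n}. T i + 2)"
        unfolding \<Phi>_def sum.atLeast_Suc_lessThan[OF i(1), of "\<lambda>i. T i + 2"] ..
      moreover have "I (Suc (s r 0)) (s'(r := (s' r)(0 := Suc (s r 0))))"
        using b by (intro stable[of "Suc (s r 0)" s' "s'(r := (s' r)(0 := Suc (s r 0)))"])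
          (simp_all add: same_def)
      ultimately show "run (put_reg r (Add (reg r) (Const 1))) s'
          (\<lambda>t2 s2. J s2 \<and> t + t2 + \<Phi> s2 < \<Phi> s)"
        using b i r' by (simp add: J_def \<Phi>_def)
    qed
    then show "run ?b s (\<lambda>t s'. J s' \<and> t + \<Phi> s' < \<Phi> s)" by simp
  next
    fix t s' assume a: "J s'" "same (writes ?b) ?s s'" "\<not> eval_test (Less (reg r) e) s'" "t \<le> Suc (\<Phi> ?s)"
    then have f: "same (insert r (writes c)) s0 s'" using tr unfolding w by blast
    with a bound[OF f] have "s' r 0 = n" by (auto simp: J_def)
    with a f show "Q (Suc t) s'"
      by (intro exit) (auto simp: J_def \<Phi>_def atLeast0LessThan)
  qed
  then show ?thesis by (simp add: for_upto_def)
qed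

definition arr :: "(nat \<Rightarrow> nat) \<Rightarrow> nat list" where
  "arr f = map (\<lambda>i. f (Suc i)) [0..<f 0]"

lemma length_arr [simp]: "length (arr f) = f 0"
  by (simp add: arr_def)

lemma arr_nth: "i < f 0 \<Longrightarrow> arr f ! i = f (Suc i)"
  by (simp add: arr_def)

lemma result_of_arr: "result_of s = arr (s 1)"
  by (simp add: result_of_def arr_def)

definition push :: "nat \<Rightarrow> exp \<Rightarrow> prog" where
  "push a e = Seq (Put a (Add (reg a) (Const 1)) e) (Put a (Const 0) (Add (reg a) (Const 1)))"

definition pushed :: "store \<Rightarrow> nat \<Rightarrow> nat \<Rightarrow> store" where
  "pushed s a v = s(a := (s a)(Suc (s a 0) := v, 0 := Suc (s a 0)))"

lemma run_push [simp]: "run (push a e) s Q \<longleftrightarrow> Q 2 (pushed s a (eval_exp e s))"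
  by (simp add: push_def pushed_def numeral_2_eq_2)

lemma writes_push [simp]: "writes (push a e) = {a}"
  by (simp add: push_def)

lemma pushed_other [simp]: "b \<noteq> a \<Longrightarrow> pushed s a v b = s b"
  by (simp add: pushed_def)

lemma arr_pushed [simp]: "arr (pushed s a v a) = arr (s a) @ [v]"
  by (simp add: pushed_def arr_def)

lemma pushed_length [simp]: "pushed s a v a 0 = Suc (s a 0)"
  by (simp add: pushed_def)

section \<open>Computing the position graph\<close>

text \<open>Names of arrays; 0 and 1 are reserved for input and output. Those below 20 are tables or
  lists, those from 20 on are registers, of which only cell 0 is used.\<close>

abbreviation (input) END :: nat where "END \<equiv> 2"
abbreviation (input) EXIT :: nat where "EXIT \<equiv> 3"
abbreviation (input) KIND :: nat where "KIND \<equiv> 4"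
abbreviation (input) LABEL :: nat where "LABEL \<equiv> 5"
abbreviation (input) NEXT1 :: nat where "NEXT1 \<equiv> 6"
abbreviation (input) NEXT2 :: nat where "NEXT2 \<equiv> 7"
abbreviation (input) SRC :: nat where "SRC \<equiv> 8"
abbreviation (input) VARS :: nat where "VARS \<equiv> 9"
abbreviation (input) MEM :: nat where "MEM \<equiv> 10"
abbreviation (input) POS :: nat where "POS \<equiv> 20"
abbreviation (input) LIMIT :: nat where "LIMIT \<equiv> 21"
abbreviation (input) BASE :: nat where "BASE \<equiv> 22"

fun list_at :: "(nat \<Rightarrow> nat) \<Rightarrow> nat \<Rightarrow> nat list \<Rightarrow> bool" where
  "list_at f q [] \<longleftrightarrow> True"
| "list_at f q (x # xs) \<longleftrightarrow> f q = x \<and> list_at f (Suc q) xs"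

lemma list_at_append [simp]:
  "list_at f q (xs @ ys) \<longleftrightarrow> list_at f q xs \<and> list_at f (q + length xs) ys"
  by (induction xs arbitrary: q) auto

abbreviation plus1 :: "exp \<Rightarrow> exp" where "plus1 e \<equiv> Add e (Const 1)"

abbreviation plus2 :: "exp \<Rightarrow> exp" where "plus2 e \<equiv> Add e (Const 2)"

abbreviation opcode :: exp where "opcode \<equiv> Get 0 (reg POS)"

text \<open>From right to left, the end of the subexpression starting at each cell of the code. Cells that
  hold an argument are treated in the same way and receive a meaningless value, never used.\<close>

definition end_body :: prog where
  "end_body = Seq (put_reg POS (Sub (reg POS) (Const 1)))
     (Cond (Less opcode (Const 2)) (Put END (reg POS) (plus1 (reg POS)))
     (Cond (Less opcode (Const 4)) (Put END (reg POS) (plus2 (reg POS)))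
     (Cond (Less opcode (Const 6)) (Put END (reg POS) (Get END (Get END (plus1 (reg POS)))))
     (Cond (Less opcode (Const 7)) (Put END (reg POS) (Get END (plus1 (reg POS))))
       (Put END (reg POS) (Get END (plus2 (reg POS))))))))"

definition end_pass :: prog where
  "end_pass = Seq (put_reg POS (reg LIMIT)) (While (Less (reg BASE) (reg POS)) end_body)"

text \<open>A pass from right to left does not know which cells begin a subexpression. The claim is
  therefore made for every regex whose code happens to stand at \<open>q\<close>, accidental ones
  included, and becomes a purely local invariant.\<close>

definition ends_ok :: "store \<Rightarrow> nat \<Rightarrow> nat \<Rightarrow> bool" where
  "ends_ok s p m \<longleftrightarrow> (\<forall>q \<beta>. p \<le> q \<longrightarrow> q + len \<beta> \<le> m \<longrightarrow> list_at (s 0) q (rx_code \<beta>) \<longrightarrow>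
     s END q = q + len \<beta>)"

lemma run_end_body:
  assumes "ends_ok s (s POS 0) m" "0 < s POS 0"
  shows "run end_body s (\<lambda>t s'. ends_ok s' (s' POS 0) m \<and> s' POS 0 = s POS 0 - 1 \<and> t \<le> 6)"
proof -
  define p where "p = s POS 0 - 1"
  have p: "s POS 0 = Suc p" using assms(2) by (simp add: p_def)
  define v where "v = (if s 0 p < 2 then p + 1 else if s 0 p < 4 then p + 2
    else if s 0 p < 6 then s END (s END (p + 1)) else if s 0 p < 7 then s END (p + 1) else s END (p + 2))"
  define s' where "s' = s(POS := (s POS)(0 := p), END := (s END)(p := v))"
  have ok: "s END q = q + len \<beta>" if "p < q" "q + len \<beta> \<le> m" "list_at (s 0) q (rx_code \<beta>)" for q \<beta>
    using assms(1) that p by (simp add: ends_ok_def)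
  have v: "v = p + len \<beta>" if "p + len \<beta> \<le> m" "list_at (s 0) p (rx_code \<beta>)" for \<beta>
  proof (cases \<beta>)
    case (RCat \<beta>1 \<beta>2)
    then show ?thesis using that ok[of "Suc p" \<beta>1] ok[of "Suc p + len \<beta>1" \<beta>2] by (simp add: v_def)
  next
    case (RAlt \<beta>1 \<beta>2)
    then show ?thesis using that ok[of "Suc p" \<beta>1] ok[of "Suc p + len \<beta>1" \<beta>2] by (simp add: v_def)
  next
    case (RPlus \<beta>1)
    then show ?thesis using that ok[of "Suc p" \<beta>1] by (simp add: v_def)
  next
    case (RBind x \<beta>1)
    then show ?thesis using that ok[of "Suc (Suc p)" \<beta>1] by (simp add: v_def)
  qed (use that in \<open>simp_all add: v_def\<close>)
  have "ends_ok s' p m"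
    unfolding ends_ok_def
  proof (intro allI impI)
    fix q \<beta> assume a: "p \<le> q" "q + len \<beta> \<le> m" "list_at (s' 0) q (rx_code \<beta>)"
    then show "s' END q = q + len \<beta>"
      using ok[of q \<beta>] v[of \<beta>] by (cases "q = p") (simp_all add: s'_def)
  qed
  then show ?thesis
    by (cases "s 0 p < 2"; cases "s 0 p < 4"; cases "s 0 p < 6"; cases "s 0 p < 7")
      (simp_all add: end_body_def p s'_def v_def)
qed

lemma run_end_pass:
  assumes "s BASE 0 = p" "s LIMIT 0 = m" "p \<le> m"
  shows "run end_pass s (\<lambda>t s'. ends_ok s' p m \<and> t \<le> 7 * (m - p) + 2)"
proof -
  let ?s = "s(POS := (s POS)(0 := m))"
  have w: "writes end_body = {POS, END}" by (auto simp: end_body_def)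
  have "run (While (Less (reg BASE) (reg POS)) end_body) ?s
    (\<lambda>t s'. ends_ok s' p m \<and> Suc t \<le> 7 * (m - p) + 2)"
  proof (rule run_while[of "\<lambda>s. ends_ok s (s POS 0) m \<and> p \<le> s POS 0" ?s _ _ "\<lambda>s. 7 * (s POS 0 - p)"])
    show "ends_ok ?s (?s POS 0) m \<and> p \<le> ?s POS 0"
    proof -
      have "\<not> (m \<le> q \<and> q + len \<beta> \<le> m)" for q \<beta> using len_pos[of \<beta>] by linarith
      then have "ends_ok ?s m m" unfolding ends_ok_def by blast
      with assms(3) show ?thesis by simp
    qed
  next
    fix s1 assume a: "ends_ok s1 (s1 POS 0) m \<and> p \<le> s1 POS 0" "same (writes end_body) ?s s1"
      "eval_test (Less (reg BASE) (reg POS)) s1"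
    then have "s1 BASE = s BASE" by (simp add: w same_def)
    with a assms(1) have "p < s1 POS 0" by simp
    with a(1) show "run end_body s1 (\<lambda>t s'. (ends_ok s' (s' POS 0) m \<and> p \<le> s' POS 0) \<and>
        t + 7 * (s' POS 0 - p) < 7 * (s1 POS 0 - p))"
      by (intro run_mono[OF run_end_body[of s1 m]]) auto
  next
    fix t s1 assume a: "ends_ok s1 (s1 POS 0) m \<and> p \<le> s1 POS 0" "same (writes end_body) ?s s1"
      "\<not> eval_test (Less (reg BASE) (reg POS)) s1" "t \<le> Suc (7 * (?s POS 0 - p))"
    then have "s1 BASE = s BASE" by (simp add: w same_def)
    with a assms(1) have "s1 POS 0 = p" by simp
    with a show "ends_ok s1 p m \<and> Suc t \<le> 7 * (m - p) + 2" by simp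
  qed
  then show ?thesis by (simp add: end_pass_def assms(2))
qed

definition put_node :: "exp \<Rightarrow> nat \<Rightarrow> exp \<Rightarrow> exp \<Rightarrow> exp \<Rightarrow> prog" where
  "put_node q kind l a b = Seq (Seq (Put KIND q (Const kind)) (Put LABEL q l))
     (Seq (Put NEXT1 q a) (Put NEXT2 q b))"

abbreviation argument :: exp where "argument \<equiv> Get 0 (plus1 (reg POS))"

abbreviation exit_exp :: exp where "exit_exp \<equiv> Get EXIT (reg POS)"

abbreviation second_pos :: exp where "second_pos \<equiv> Get END (plus1 (reg POS))"

abbreviation advance :: "nat \<Rightarrow> prog" where "advance d \<equiv> put_reg POS (Add (reg POS) (Const d))"

definition add_var :: prog where
  "add_var = Seq (push VARS argument) (Put MEM argument (reg VARS))"

text \<open>Works without a stack: the code is in preorder, so the parent has already stored the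
  exit of a subexpression at its first cell in \<open>EXIT\<close>, and \<open>END\<close> tells
  where a second operand starts. Second nodes are placed at offset \<open>LIMIT\<close>, which holds
  \<open>K\<close>.\<close>

definition node_body :: prog where
  "node_body =
    Cond (Equal opcode (Const 0))
      (Seq (put_node (reg POS) 0 (Const 0) (reg POS) (reg POS)) (advance 1))
    (Cond (Equal opcode (Const 1))
      (Seq (put_node (reg POS) 0 (Const 0) exit_exp exit_exp) (advance 1))
    (Cond (Equal opcode (Const 2))
      (Seq (put_node (reg POS) 3 argument exit_exp exit_exp) (Seq (push SRC (reg POS)) (advance 2)))
    (Cond (Equal opcode (Const 3))
      (Seq (put_node (reg POS) 4 argument exit_exp exit_exp) (Seq (push SRC (reg POS))
        (Seq add_var (advance 2))))
    (Cond (Equal opcode (Const 4))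
      (Seq (put_node (reg POS) 0 (Const 0) (plus1 (reg POS)) (plus1 (reg POS)))
        (Seq (Put EXIT second_pos exit_exp) (Seq (Put EXIT (plus1 (reg POS)) second_pos) (advance 1))))
    (Cond (Equal opcode (Const 5))
      (Seq (put_node (reg POS) 0 (Const 0) (plus1 (reg POS)) second_pos)
        (Seq (Put EXIT second_pos exit_exp) (Seq (Put EXIT (plus1 (reg POS)) exit_exp) (advance 1))))
    (Cond (Equal opcode (Const 6))
      (Seq (put_node (reg POS) 0 (Const 0) (plus1 (reg POS)) (plus1 (reg POS)))
        (Seq (put_node (Add (reg LIMIT) (reg POS)) 0 (Const 0) (plus1 (reg POS)) exit_exp)
          (Seq (Put EXIT (plus1 (reg POS)) (Add (reg LIMIT) (reg POS))) (advance 1))))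
      (Seq (put_node (reg POS) 1 argument (plus2 (reg POS)) (plus2 (reg POS)))
        (Seq (put_node (Add (reg LIMIT) (reg POS)) 2 argument exit_exp exit_exp)
          (Seq (Put EXIT (plus2 (reg POS)) (Add (reg LIMIT) (reg POS))) (Seq add_var (advance 2)))))))))))"

definition node_pass :: prog where
  "node_pass = Seq (put_reg POS (reg BASE)) (While (Less (reg POS) (reg LIMIT)) node_body)"

lemma writes_node_body: "writes node_body = {POS, KIND, LABEL, NEXT1, NEXT2, EXIT, SRC, VARS, MEM}"
  by (auto simp: node_body_def put_node_def add_var_def)

text \<open>Ordered so that the nodes a bracket walk may pass (silent or bracket) are those below
  3.\<close>

fun kind_code :: "nsym option \<Rightarrow> nat" where
  "kind_code None = 0"
| "kind_code (Some (Op x)) = 1"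
| "kind_code (Some (Cl x)) = 2"
| "kind_code (Some (Tm a)) = 3"
| "kind_code (Some (Vr x)) = 4"

fun symbol_arg :: "nsym option \<Rightarrow> nat" where
  "symbol_arg None = 0"
| "symbol_arg (Some (Op x)) = x"
| "symbol_arg (Some (Cl x)) = x"
| "symbol_arg (Some (Tm a)) = a"
| "symbol_arg (Some (Vr x)) = x"

fun stored :: "store \<Rightarrow> entry \<Rightarrow> bool" where
  "stored s (q, l, a, b) \<longleftrightarrow> s KIND q = kind_code l \<and> s LABEL q = symbol_arg l \<and>
     s NEXT1 q = a \<and> s NEXT2 q = b"

type_synonym tree = "nat \<times> nat \<times> (nat, nat) rx"

text \<open>Pending subtrees, given by position, exit and regex, tile the unread rest of the
  code.\<close>

fun chain :: "nat \<Rightarrow> tree list \<Rightarrow> nat \<Rightarrow> bool" where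
  "chain p [] m \<longleftrightarrow> p = m"
| "chain p ((q, e, \<beta>) # fs) m \<longleftrightarrow> q = p \<and> chain (p + len \<beta>) fs m"

lemma chain_append: "chain p fs m \<Longrightarrow> chain m gs n \<Longrightarrow> chain p (fs @ gs) n"
  by (induction p fs m rule: chain.induct) auto

lemma chain_bounds: "chain p fs m \<Longrightarrow> (q, e, \<beta>) \<in> set fs \<Longrightarrow> p \<le> q \<and> q + len \<beta> \<le> m"
proof (induction p fs m rule: chain.induct)
  case (2 p q' e' \<beta>' fs m)
  have "p + len \<beta>' \<le> m" if "chain (p + len \<beta>') fs m" for fs
    using that
  proof (induction "p + len \<beta>'" fs m arbitrary: p \<beta>' rule: chain.induct)
    case (2 q e \<gamma> fs m)
    from 2(1)[of "p + len \<beta>'" \<gamma>] 2(2) show ?case by simp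
  qed simp
  with 2 show ?case by fastforce
qed simp

context regex_graph
begin

text \<open>The list \<open>fs\<close> is what a recursive traversal would keep on its stack.
  Nothing is lost: each entry is stored or belongs to a pending subtree, and each output list,
  continued by the contributions of the pending subtrees, is the final one.\<close>

definition forest :: "store \<Rightarrow> tree list \<Rightarrow> bool" where
  "forest s fs \<longleftrightarrow> chain (s POS 0) fs K \<and>
     (\<forall>(q, e, \<beta>) \<in> set fs. list_at (s 0) q (rx_code \<beta>) \<and> s EXIT q = e \<and> graph K q e \<beta> \<subseteq> G) \<and>
     (\<forall>n\<in>G. stored s n \<or> (\<exists>(q, e, \<beta>) \<in> set fs. n \<in> graph K q e \<beta>)) \<and>
     arr (s SRC) @ concat (map (\<lambda>(q, e, \<beta>). letters q \<beta>) fs) = 0 # letters p0 \<alpha> \<and>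
     arr (s VARS) @ concat (map (\<lambda>(q, e, \<beta>). var_list \<beta>) fs) = vs \<and>
     s MEM = mem_index (arr (s VARS))"

text \<open>Common to all constructors: the first pending tree is replaced by its operands
  \<open>kids\<close>, and \<open>N\<close> contains the entries stored for its root. Exits of later
  trees are safe because only cells inside the current tree receive new ones.\<close>

lemma forest_step:
  assumes f: "forest s ((p, e, \<beta>) # fs)"
    and graph: "graph K p e \<beta> = N \<union> (\<Union>(q, e', \<gamma>) \<in> set kids. graph K q e' \<gamma>)"
    and chain: "chain (s' POS 0) kids (p + len \<beta>)"
    and kids: "\<forall>(q, e', \<gamma>) \<in> set kids. list_at (s 0) q (rx_code \<gamma>) \<and> s' EXIT q = e'"
    and keep: "s' 0 = s 0" "\<And>q. p + len \<beta> \<le> q \<Longrightarrow> s' EXIT q = s EXIT q"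
    and N: "\<forall>n\<in>N. stored s' n" "\<And>n. stored s n \<Longrightarrow> fst n \<notin> fst ` N \<Longrightarrow> stored s' n"
    and lists: "arr (s' SRC) @ concat (map (\<lambda>(q, e, \<beta>). letters q \<beta>) kids) = arr (s SRC) @ letters p \<beta>"
      "arr (s' VARS) @ concat (map (\<lambda>(q, e, \<beta>). var_list \<beta>) kids) = arr (s VARS) @ var_list \<beta>"
      "s' MEM = mem_index (arr (s' VARS))"
  shows "forest s' (kids @ fs)"
proof -
  have gG: "graph K p e \<beta> \<subseteq> G" and p: "p = s POS 0" and ch: "chain (p + len \<beta>) fs K"
    using f by (auto simp: forest_def)
  have "chain (s' POS 0) (kids @ fs) K" using chain ch by (rule chain_append)
  moreover have "list_at (s' 0) q (rx_code \<gamma>) \<and> s' EXIT q = e' \<and> graph K q e' \<gamma> \<subseteq> G"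
    if "(q, e', \<gamma>) \<in> set (kids @ fs)" for q e' \<gamma>
  proof -
    from that consider "(q, e', \<gamma>) \<in> set kids" | "(q, e', \<gamma>) \<in> set fs" by auto
    then show ?thesis
    proof cases
      case 1
      then have "list_at (s 0) q (rx_code \<gamma>) \<and> s' EXIT q = e'" using kids by auto
      moreover have "graph K q e' \<gamma> \<subseteq> graph K p e \<beta>" unfolding graph using 1 by auto
      ultimately show ?thesis using gG keep(1) by auto
    next
      case 2
      then have "p + len \<beta> \<le> q" using chain_bounds[OF ch] by blast
      then have "s' EXIT q = s EXIT q" by (rule keep(2))
      moreover have "list_at (s 0) q (rx_code \<gamma>) \<and> s EXIT q = e' \<and> graph K q e' \<gamma> \<subseteq> G"
        using 2 f unfolding forest_def by auto
      ultimately show ?thesis using keep(1) by simp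
    qed
  qed
  moreover have "stored s' n \<or> (\<exists>(q, e, \<beta>) \<in> set (kids @ fs). n \<in> graph K q e \<beta>)" if n: "n \<in> G" for n
  proof -
    from f n have "stored s n \<or> n \<in> graph K p e \<beta> \<or> (\<exists>(q, e, \<beta>) \<in> set fs. n \<in> graph K q e \<beta>)"
      unfolding forest_def list.set ball_simps bex_simps prod.case by blast
    then consider "stored s n" | "n \<in> graph K p e \<beta>" | "\<exists>(q, e, \<beta>) \<in> set fs. n \<in> graph K q e \<beta>" by blast
    then show ?thesis
    proof cases
      case 1
      show ?thesis
      proof (cases "fst n \<in> fst ` N")
        case True
        \<comment> \<open>An entry whose node is written again is not lost: a node has only one
          entry in \<open>G\<close>, so it is rewritten with the same data.\<close>
        then obtain n' where n': "n' \<in> N" "fst n' = fst n" by auto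
        then have "n' \<in> G" using graph gG by blast
        with n n'(2) have "n' = n" using single_valued_G unfolding single_valued_def
          by (metis prod.collapse)
        with n' N(1) show ?thesis by blast
      qed (use 1 N(2) in blast)
    next
      case 2
      then show ?thesis unfolding graph using N(1) by auto
    next
      case 3
      then show ?thesis by auto
    qed
  qed
  ultimately show ?thesis
    using f lists unfolding forest_def by (auto simp flip: append_assoc)
qed

lemma forest_finished: "forest s [] \<Longrightarrow> (\<forall>n\<in>G. stored s n) \<and> arr (s SRC) = 0 # letters p0 \<alpha> \<and>
    arr (s VARS) = vs \<and> s MEM = mem_index vs"
  by (auto simp: forest_def)

lemma run_node_body:
  assumes f: "forest s ((p, e, \<beta>) # fs)" and ends: "ends_ok s p0 K" and "p0 \<le> p" and L: "s LIMIT 0 = K"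
  shows "run node_body s (\<lambda>t s'. (\<exists>fs'. forest s' fs') \<and> s POS 0 < s' POS 0 \<and> t \<le> 24)"
proof -
  have p: "s POS 0 = p" and e: "s EXIT p = e" and at: "list_at (s 0) p (rx_code \<beta>)"
    and K: "p + len \<beta> \<le> K" and m: "s MEM = mem_index (arr (s VARS))"
    using f chain_bounds[of "s POS 0" "(p, e, \<beta>) # fs" K p e \<beta>] by (auto simp: forest_def)
  have E: "s END (Suc p) = Suc p + len \<gamma>"
    if "list_at (s 0) (Suc p) (rx_code \<gamma>)" "Suc p + len \<gamma> \<le> K" for \<gamma>
    using ends that \<open>p0 \<le> p\<close> by (simp add: ends_ok_def)
  have Kp: "K + p \<noteq> p" using p0 by (simp add: K_def)
  note step = forest_step[OF f]
  show ?thesis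
  proof (cases \<beta>)
    case REmpty
    then show ?thesis using p e at m
      apply (simp add: node_body_def put_node_def)
      apply (rule exI, rule step[where kids = "[]" and N = "{(p, None, p, p)}"])
      apply (auto split: if_splits)
      done
  next
    case REps
    then show ?thesis using p e at m
      apply (simp add: node_body_def put_node_def)
      apply (rule exI, rule step[where kids = "[]" and N = "{(p, None, e, e)}"])
      apply (auto split: if_splits)
      done
  next
    case (RTerm a)
    then show ?thesis using p e at m
      apply (simp add: node_body_def put_node_def)
      apply (rule exI, rule step[where kids = "[]" and N = "{(p, Some (Tm a), e, e)}"])
      apply (auto split: if_splits)
      done
  next
    case (RRef x)
    then show ?thesis using p e at m
      apply (simp add: node_body_def put_node_def add_var_def)
      apply (rule exI, rule step[where kids = "[]" and N = "{(p, Some (Vr x), e, e)}"])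
      apply (auto simp: mem_index_simps fun_eq_iff split: if_splits)
      done
  next
    case (RCat \<beta>1 \<beta>2)
    then show ?thesis using p e at m E[of \<beta>1] K len_pos[of \<beta>1] len_pos[of \<beta>2]
      apply (simp add: node_body_def put_node_def)
      apply (rule exI, rule step[where N = "{(p, None, Suc p, Suc p)}" and
            kids = "[(Suc p, Suc p + len \<beta>1, \<beta>1), (Suc p + len \<beta>1, e, \<beta>2)]"])
      apply (auto split: if_splits)
      done
  next
    case (RAlt \<beta>1 \<beta>2)
    then show ?thesis using p e at m E[of \<beta>1] K len_pos[of \<beta>1] len_pos[of \<beta>2]
      apply (simp add: node_body_def put_node_def)
      apply (rule exI, rule step[where N = "{(p, None, Suc p, Suc p + len \<beta>1)}" and
            kids = "[(Suc p, e, \<beta>1), (Suc p + len \<beta>1, e, \<beta>2)]"])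
      apply (auto split: if_splits)
      done
  next
    case (RPlus \<beta>1)
    then show ?thesis using p e at m L Kp len_pos[of \<beta>1]
      apply (simp add: node_body_def put_node_def)
      apply (rule exI, rule step[where N = "{(p, None, Suc p, Suc p), (K + p, None, Suc p, e)}" and
            kids = "[(Suc p, K + p, \<beta>1)]"])
      apply (auto split: if_splits)
      done
  next
    case (RBind x \<beta>1)
    then show ?thesis using p e at m L Kp len_pos[of \<beta>1]
      apply (simp add: node_body_def put_node_def add_var_def)
      apply (rule exI, rule step[where N = "{(p, Some (Op x), p + 2, p + 2), (K + p, Some (Cl x), e, e)}" and
            kids = "[(p + 2, K + p, \<beta>1)]"])
      apply (auto simp: mem_index_simps fun_eq_iff split: if_splits)
      done
  qed
qed

end

text \<open>In array 0 the total length and |\<Sigma>| precede the terminals, so the code starts at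
  cell |\<Sigma>| + 2, the value of \<open>p0\<close> in the end, and \<open>K\<close> is the first
  cell after the input.\<close>

definition init_pass :: prog where
  "init_pass = Seq (put_reg BASE (plus2 (Get 0 (Const 1))))
     (Seq (put_reg LIMIT (plus1 (reg 0)))
     (Seq (Put EXIT (reg BASE) (Add (reg LIMIT) (reg LIMIT)))
     (Seq (put_node (Const 0) 0 (Const 0) (reg BASE) (reg BASE))
     (Seq (put_node (Add (reg LIMIT) (reg LIMIT)) 0 (Const 0) (Add (reg LIMIT) (reg LIMIT))
         (Add (reg LIMIT) (reg LIMIT)))
       (push SRC (Const 0))))))"

definition build :: prog where
  "build = Seq init_pass (Seq end_pass node_pass)"

lemma writes_end_pass: "writes end_pass = {POS, END}"
  by (auto simp: end_pass_def end_body_def)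

lemma writes_build:
  "writes build = {POS, LIMIT, BASE, END, EXIT, KIND, LABEL, NEXT1, NEXT2, SRC, VARS, MEM}"
  by (auto simp: build_def init_pass_def put_node_def writes_end_pass node_pass_def writes_node_body)

section \<open>Breadth-first search for bracket walks\<close>

abbreviation (input) VIS :: nat where "VIS \<equiv> 11"
abbreviation (input) TAG :: nat where "TAG \<equiv> 12"
abbreviation (input) QUEUE :: nat where "QUEUE \<equiv> 13"
abbreviation (input) STAMP :: nat where "STAMP \<equiv> 23"
abbreviation (input) SOURCE :: nat where "SOURCE \<equiv> 24"
abbreviation (input) HEAD :: nat where "HEAD \<equiv> 25"
abbreviation (input) CUR :: nat where "CUR \<equiv> 26"
abbreviation (input) CTAG :: nat where "CTAG \<equiv> 27"
abbreviation (input) OK :: nat where "OK \<equiv> 28"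
abbreviation (input) NODE :: nat where "NODE \<equiv> 29"

text \<open>Breadth-first search for the bracket walks from a source. The tag of a node is the last
  bracket (or 0) on the walk that found it; a second visit with another tag shows that there are two
  different bracket words.\<close>

definition visit :: "exp \<Rightarrow> prog" where
  "visit e = Seq (put_reg NODE e)
     (Cond (Equal (Get VIS (reg NODE)) (reg STAMP))
       (Cond (Equal (Get TAG (reg NODE)) (reg CTAG)) Skip (put_reg OK (Const 0)))
       (Seq (Put VIS (reg NODE) (reg STAMP)) (Seq (Put TAG (reg NODE) (reg CTAG)) (push QUEUE (reg NODE)))))"

definition explore_body :: prog where
  "explore_body = Seq (put_reg HEAD (plus1 (reg HEAD))) (Seq (put_reg CUR (Get QUEUE (reg HEAD)))
     (Cond (Less (Get KIND (reg CUR)) (Const 3))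
       (Seq (Cond (Equal (Get KIND (reg CUR)) (Const 0))
           (put_reg CTAG (Get TAG (reg CUR))) (put_reg CTAG (reg CUR)))
         (Seq (visit (Get NEXT1 (reg CUR))) (visit (Get NEXT2 (reg CUR)))))
       Skip))"

definition explore :: prog where
  "explore = Seq (Put QUEUE (Const 0) (Const 0)) (Seq (put_reg HEAD (Const 0)) (Seq (put_reg CTAG (Const 0))
     (Seq (visit (Get NEXT1 (reg SOURCE))) (While (Less (reg HEAD) (reg QUEUE)) explore_body))))"

lemma writes_visit: "writes (visit e) = {NODE, OK, VIS, TAG, QUEUE}"
  by (auto simp: visit_def)

lemma writes_explore_body: "writes explore_body = {HEAD, CUR, CTAG, NODE, OK, VIS, TAG, QUEUE}"
  by (auto simp: explore_body_def writes_visit)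

lemma writes_explore: "writes explore = {HEAD, CUR, CTAG, NODE, OK, VIS, TAG, QUEUE}"
  by (auto simp: explore_def writes_visit writes_explore_body)

text \<open>The value 0 can stand for the empty word because node 0 emits no symbol
  (\<open>symbol_pos\<close>).\<close>

definition last_tag :: "(nsym \<times> nat) list \<Rightarrow> nat" where
  "last_tag \<gamma> = (if \<gamma> = [] then 0 else snd (last \<gamma>))"

lemma last_tag_simps [simp]: "last_tag [] = 0" "last_tag (\<gamma> @ [(l, q)]) = q"
  by (simp_all add: last_tag_def)

context regex_graph
begin

definition built :: "store \<Rightarrow> bool" where
  "built s \<longleftrightarrow> (\<forall>n\<in>G. stored s n) \<and> arr (s SRC) = 0 # letters p0 \<alpha> \<and> arr (s VARS) = vs \<and>
     s MEM = mem_index vs \<and> s LIMIT 0 = K"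

lemma K_pos: "K \<noteq> 0"
  using p0 by (simp add: K_def)

text \<open>The time is made up of 13 steps of initialisation, 7 per cell for
  \<open>end_pass\<close> and 25 per cell for \<open>node_pass\<close>, each including the loop
  test.\<close>

lemma run_build:
  assumes s: "Suc (s 0 0) = K" "s 0 1 + 2 = p0" "list_at (s 0) p0 (rx_code \<alpha>)"
    and zero: "s SRC = (\<lambda>_. 0)" "s VARS = (\<lambda>_. 0)" "s MEM = (\<lambda>_. 0)"
  shows "run build s (\<lambda>t s'. built s' \<and> t \<le> 32 * len \<alpha> + 18)"
  unfolding build_def
proof (rule run_SeqI[OF run_same])
  let ?P = "\<lambda>(t :: nat) (s' :: store). t = 13 \<and> s' BASE 0 = p0 \<and> s' LIMIT 0 = K \<and> s' EXIT p0 = F \<and>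
      stored s' (0, None, p0, p0) \<and> stored s' (F, None, F, F) \<and> arr (s' SRC) = [0]"
  define s1 where "s1 = s(BASE := (s BASE)(0 := p0), LIMIT := (s LIMIT)(0 := K), EXIT := (s EXIT)(p0 := F))"
  have s1: "s1 BASE 0 = p0" "s1 LIMIT 0 = K" "s1 EXIT p0 = F" "s1 SRC = (\<lambda>_. 0)"
    using zero by (simp_all add: s1_def)
  have "run (Seq (put_node (Const 0) 0 (Const 0) (reg BASE) (reg BASE))
     (Seq (put_node (Add (reg LIMIT) (reg LIMIT)) 0 (Const 0) (Add (reg LIMIT) (reg LIMIT))
         (Add (reg LIMIT) (reg LIMIT))) (push SRC (Const 0)))) s1 (\<lambda>t. ?P (3 + t))"
  proof (rule run_SeqI)
    show "run (put_node (Const 0) 0 (Const 0) (reg BASE) (reg BASE)) s1 (\<lambda>t s'. t = 4 \<and>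
        stored s' (0, None, p0, p0) \<and> same {KIND, LABEL, NEXT1, NEXT2} s1 s')"
      using s1 by (simp add: put_node_def same_def)
    fix t2 :: nat and s2 :: store assume "t2 = 4 \<and> stored s2 (0, None, p0, p0) \<and> same {KIND, LABEL, NEXT1, NEXT2} s1 s2"
    then have s2: "t2 = 4" "stored s2 (0, None, p0, p0)" "s2 BASE 0 = p0" "s2 LIMIT 0 = K" "s2 EXIT p0 = F"
      "s2 SRC = (\<lambda>_. 0)"
      using s1 by (simp_all add: same_def)
    have "arr (\<lambda>_. 0) = []" by (simp add: arr_def)
    then show "run (Seq (put_node (Add (reg LIMIT) (reg LIMIT)) 0 (Const 0) (Add (reg LIMIT) (reg LIMIT))
         (Add (reg LIMIT) (reg LIMIT))) (push SRC (Const 0))) s2 (\<lambda>t s'. ?P (3 + (t2 + t)) s')"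
      using s2 p0_F K_pos by (simp add: put_node_def F_def[symmetric])
  qed
  moreover have "s 0 (Suc 0) + 2 = p0" using s(2) by simp
  moreover have "Suc (Suc (s 0 0 + s 0 0)) = F" unfolding F_def s(1)[symmetric] by simp
  ultimately show "run init_pass s ?P"
    using s(1) by (simp add: init_pass_def s1_def)
next
  fix t1 :: nat and s1 :: store
  assume a: "(t1 = 13 \<and> s1 BASE 0 = p0 \<and> s1 LIMIT 0 = K \<and> s1 EXIT p0 = F \<and>
      stored s1 (0, None, p0, p0) \<and> stored s1 (F, None, F, F) \<and> arr (s1 SRC) = [0]) \<and>
      same (writes init_pass) s s1"
  have w: "writes init_pass = {BASE, LIMIT, EXIT, KIND, LABEL, NEXT1, NEXT2, SRC}"
    by (auto simp: init_pass_def put_node_def)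
  have old: "s1 0 = s 0" "s1 VARS = s VARS" "s1 MEM = s MEM" using a by (auto simp: w same_def)
  show "run (Seq end_pass node_pass) s1 (\<lambda>t2 s2. built s2 \<and> t1 + t2 \<le> 32 * len \<alpha> + 18)"
  proof (rule run_SeqI[OF run_same[OF run_end_pass[of s1 p0 K]]])
    fix t2 :: nat and s2 :: store assume b: "(ends_ok s2 p0 K \<and> t2 \<le> 7 * (K - p0) + 2) \<and> same (writes end_pass) s1 s2"
    let ?s = "s2(POS := (s2 POS)(0 := p0))"
    have keep: "s2 x = s1 x" if "x \<noteq> POS" "x \<noteq> END" for x
      using b that by (simp add: writes_end_pass same_def)
    have "arr (\<lambda>_. 0) = []" by (simp add: arr_def)
    moreover have "mem_index [] = (\<lambda>x :: nat. 0)" by (simp add: mem_index_simps fun_eq_iff)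
    ultimately have init: "forest ?s [(p0, F, \<alpha>)]"
      using a old keep s zero unfolding forest_def by (simp add: K_def[symmetric] G_def) (auto simp: K_def)
    have "run (While (Less (reg POS) (reg LIMIT)) node_body) ?s
      (\<lambda>t s'. built s' \<and> t \<le> 25 * len \<alpha> + 1)"
    proof (rule run_while[of "\<lambda>s. (\<exists>fs. forest s fs) \<and> p0 \<le> s POS 0" _ _ _ "\<lambda>s. 25 * (K - s POS 0)"])
      show "(\<exists>fs. forest ?s fs) \<and> p0 \<le> ?s POS 0" using init by auto
    next
      fix s3 :: store assume c: "(\<exists>fs. forest s3 fs) \<and> p0 \<le> s3 POS 0" "same (writes node_body) ?s s3"
        "eval_test (Less (reg POS) (reg LIMIT)) s3"
      from c(2) have same: "s3 LIMIT = s2 LIMIT" "s3 0 = s2 0" "s3 END = s2 END"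
        by (simp_all add: writes_node_body same_def)
      with keep a c(3) have L: "s3 LIMIT 0 = K" "s3 POS 0 < K" by auto
      have e: "ends_ok s3 p0 K" using b same by (simp add: ends_ok_def)
      from c(1) obtain fs where fs: "forest s3 fs" by blast
      have "fs \<noteq> []" using fs L(2) by (auto simp: forest_def)
      then obtain p e \<beta> fs' where f: "forest s3 ((p, e, \<beta>) # fs')" using fs by (cases fs) auto
      then have "p = s3 POS 0" by (simp add: forest_def)
      with c(1) L show "run node_body s3 (\<lambda>t s'. ((\<exists>fs. forest s' fs) \<and> p0 \<le> s' POS 0) \<and>
          t + 25 * (K - s' POS 0) < 25 * (K - s3 POS 0))"
        by (intro run_mono[OF run_node_body[OF f e]]) auto
    next
      fix t3 :: nat and s3 :: store assume c: "(\<exists>fs. forest s3 fs) \<and> p0 \<le> s3 POS 0" "same (writes node_body) ?s s3"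
        "\<not> eval_test (Less (reg POS) (reg LIMIT)) s3" "t3 \<le> Suc (25 * (K - ?s POS 0))"
      from c(2) have "s3 LIMIT = s2 LIMIT" by (simp_all add: writes_node_body same_def)
      with keep a c(3) have L: "s3 LIMIT 0 = K" "K \<le> s3 POS 0" by auto
      from c(1) obtain fs where fs: "forest s3 fs" by blast
      have "fs = []"
      proof (rule ccontr)
        assume "fs \<noteq> []"
        then obtain p e \<beta> fs' where f: "fs = (p, e, \<beta>) # fs'" by (cases fs) auto
        with fs have ch: "chain (s3 POS 0) fs K" by (simp add: forest_def)
        have "s3 POS 0 \<le> p \<and> p + len \<beta> \<le> K" using chain_bounds[OF ch, of p e \<beta>] f by simp
        with len_pos[of \<beta>] L(2) show False by linarith
      qed
      with fs have "forest s3 []" by simp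
      from forest_finished[OF this] L(1) c(4) show "built s3 \<and> t3 \<le> 25 * len \<alpha> + 1"
        by (simp add: built_def K_def)
    qed
    then have "run node_pass s2 (\<lambda>t s'. built s' \<and> t \<le> 25 * len \<alpha> + 2)"
      using keep a by (simp add: node_pass_def)
    then show "run node_pass s2 (\<lambda>t3 s3. built s3 \<and> t1 + (t2 + t3) \<le> 32 * len \<alpha> + 18)"
      by (rule run_mono) (use a b in \<open>auto simp: K_def\<close>)
  qed (use a in \<open>simp_all add: K_def\<close>)
qed

text \<open>Two possible nodes per cell of the code, together with 0 and \<open>F\<close>.\<close>

definition nodes :: nat where "nodes = 2 * len \<alpha> + 2"

lemma card_Domain: "finite (Domain G)" "card (Domain G) \<le> nodes"
proof -
  let ?X = "insert 0 (insert F (region K p0 (len \<alpha>)))"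
  have sub: "Domain G \<subseteq> ?X" using Domain_graph by (auto simp: G_def)
  have "card (region K p0 (len \<alpha>)) \<le> len \<alpha> + len \<alpha>"
    unfolding region_def using card_Un_le[of "{p0..<p0 + len \<alpha>}" "{K + p0..<K + p0 + len \<alpha>}"] by simp
  moreover have fin: "finite ?X" by (simp add: region_def)
  moreover have "card ?X \<le> card (region K p0 (len \<alpha>)) + 2"
    using card_insert_le_m1 card_insert_if by (simp add: card_insert_if region_def)
  ultimately show "finite (Domain G)" "card (Domain G) \<le> nodes"
    using sub finite_subset card_mono[OF fin sub] by (auto simp: nodes_def)
qed

lemma symbol_pos: "(q, Some l, a, b) \<in> G \<Longrightarrow> q \<noteq> 0"
  using bounds[OF DomainI, of q "(Some l, a, b)"] p0 by (auto simp: G_Some)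

definition tagged :: "nat \<Rightarrow> nat \<Rightarrow> nat \<Rightarrow> bool" where
  "tagged a q t \<longleftrightarrow> (\<exists>\<gamma>. bwalk a \<gamma> q \<and> t = last_tag \<gamma>)"

lemma tagged_start: "tagged a a 0"
  unfolding tagged_def bwalk_def by (intro exI[of _ "[]"]) (simp add: walk_refl)

lemma tagged_step:
  assumes "tagged a q t" "(q, l, b, c) \<in> G" "y = b \<or> y = c" "kind_code l < 3"
  shows "tagged a y (if kind_code l = 0 then t else q)"
proof -
  from assms(1) obtain \<gamma> where \<gamma>: "bwalk a \<gamma> q" "t = last_tag \<gamma>" unfolding tagged_def by blast
  show ?thesis
  proof (cases l)
    case None
    with assms(2,3) have "walk G q [] y" by (auto intro: walk_single)
    with \<gamma> have "bwalk a \<gamma> y" unfolding bwalk_def using walk_append[of G a \<gamma> q "[]" y] by simp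
    with None \<gamma> show ?thesis unfolding tagged_def by auto
  next
    case (Some s)
    with assms(4) have s: "s \<in> bracket_syms" by (cases s) (auto simp: bracket_syms_def)
    have "b = c"
      using graph_closed[of q "Some s" b c] assms(2) Some G_Some by blast
    with assms(2,3) Some have "walk G q [(s, q)] y" by (auto intro: walk_single_sym)
    then have "walk G a (\<gamma> @ [(s, q)]) y" using \<gamma>(1) unfolding bwalk_def by (blast intro: walk_append)
    with \<gamma> s have "bwalk a (\<gamma> @ [(s, q)]) y" unfolding bwalk_def by simp
    moreover have "kind_code l \<noteq> 0" using Some by (cases s) auto
    ultimately show ?thesis unfolding tagged_def by (intro exI[of _ "\<gamma> @ [(s, q)]"]) simp
  qed
qed

lemma tags_ambiguous: "tagged a q t \<Longrightarrow> tagged a q t' \<Longrightarrow> t \<noteq> t' \<Longrightarrow> ambiguous a"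
  unfolding tagged_def ambiguous_def by blast

text \<open>Conversely, unique tags determine the bracket words from right to left.\<close>

lemma unambiguous:
  assumes "\<And>q t t'. tagged a q t \<Longrightarrow> tagged a q t' \<Longrightarrow> t = t'"
  shows "\<not> ambiguous a"
proof -
  have "\<gamma>1 = \<gamma>2" if "bwalk a \<gamma>1 q" "bwalk a \<gamma>2 q" for \<gamma>1 \<gamma>2 q
    using that
  proof (induction \<gamma>1 arbitrary: \<gamma>2 q rule: rev_induct)
    case Nil
    then have "last_tag \<gamma>2 = 0" using assms unfolding tagged_def by (metis last_tag_simps(1))
    show ?case
    proof (cases \<gamma>2 rule: rev_cases)
      case (snoc \<gamma>' x)
      obtain l b where "x = (l, b)" by (cases x)
      with snoc Nil(2) obtain c d where "(b, Some l, c, d) \<in> G" unfolding bwalk_def by (auto elim: walk_snocE)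
      then have "b \<noteq> 0" by (rule symbol_pos)
      with \<open>last_tag \<gamma>2 = 0\<close> snoc \<open>x = (l, b)\<close> show ?thesis by simp
    qed simp
  next
    case (snoc x \<gamma>)
    obtain l b where x: "x = (l, b)" by (cases x)
    with snoc.prems(1) obtain c d where e: "(b, Some l, c, d) \<in> G" "walk G a \<gamma> b"
      unfolding bwalk_def by (auto elim: walk_snocE)
    from symbol_pos[OF e(1)] have "b \<noteq> 0" .
    \<comment> \<open>Equal tags mean that both words end at bracket node \<open>b\<close>, which
      determines the bracket. Removing it leaves two bracket words leading to \<open>b\<close>,
      where the induction hypothesis applies.\<close>
    moreover have "last_tag \<gamma>2 = b"
      using assms snoc.prems x unfolding tagged_def by (metis last_tag_simps(2))
    ultimately obtain \<gamma>' l' where g2: "\<gamma>2 = \<gamma>' @ [(l', b)]"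
      by (cases \<gamma>2 rule: rev_cases) (auto simp: last_tag_def)
    with snoc.prems(2) obtain c' d' where e': "(b, Some l', c', d') \<in> G" "walk G a \<gamma>' b"
      unfolding bwalk_def by (auto elim: walk_snocE)
    have "l' = l" using G_fun[OF e(1) e'(1)] by simp
    moreover have "\<gamma> = \<gamma>'"
      using snoc.prems g2 x e e' by (intro snoc.IH[of b]) (auto simp: bwalk_def)
    ultimately show ?case using g2 x by simp
  qed
  then show ?thesis unfolding ambiguous_def by blast
qed

text \<open>Stamps only grow, so old contents of \<open>VIS\<close> count as unvisited without being
  cleared. \<open>OK\<close> is compared with its value \<open>ok\<close> at the start, because it
  may already have been lowered by an earlier source.\<close>

definition search_inv :: "nat \<Rightarrow> nat \<Rightarrow> nat \<Rightarrow> store \<Rightarrow> bool" where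
  "search_inv a st ok s \<longleftrightarrow> distinct (arr (s QUEUE)) \<and>
     (\<forall>y. s VIS y = st \<longleftrightarrow> y \<in> set (arr (s QUEUE))) \<and> (\<forall>y. s VIS y \<le> st) \<and>
     (\<forall>y \<in> set (arr (s QUEUE)). tagged a y (s TAG y) \<and> y \<in> Domain G) \<and>
     s OK 0 \<le> ok \<and> (s OK 0 < ok \<longrightarrow> ambiguous a)"

definition extends :: "store \<Rightarrow> store \<Rightarrow> bool" where
  "extends s s' \<longleftrightarrow> (\<exists>r. arr (s' QUEUE) = arr (s QUEUE) @ r) \<and>
     (\<forall>z \<in> set (arr (s QUEUE)). s' TAG z = s TAG z) \<and> s' OK 0 \<le> s OK 0"

lemma extends_trans: "extends s s' \<Longrightarrow> extends s' s'' \<Longrightarrow> extends s s''"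
  unfolding extends_def by (auto intro: order_trans)

lemma run_visit:
  assumes inv: "search_inv a st ok s" and t: "tagged a (eval_exp e s) (s CTAG 0)"
    and D: "eval_exp e s \<in> Domain G" and st: "s STAMP 0 = st"
  shows "run (visit e) s (\<lambda>t s'. search_inv a st ok s' \<and> extends s s' \<and>
    eval_exp e s \<in> set (arr (s' QUEUE)) \<and> (s' TAG (eval_exp e s) = s CTAG 0 \<or> s' OK 0 = 0) \<and> t \<le> 6)"
proof -
  define y where "y = eval_exp e s"
  consider (new) "s VIS y \<noteq> st" | (old) "s VIS y = st" "s TAG y = s CTAG 0"
    | (clash) "s VIS y = st" "s TAG y \<noteq> s CTAG 0" by blast
  then show ?thesis
  proof cases
    case new
    let ?s = "s(NODE := (s NODE)(0 := y), VIS := (s VIS)(y := st), TAG := (s TAG)(y := s CTAG 0))"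
    have q: "arr (pushed ?s QUEUE y QUEUE) = arr (s QUEUE) @ [y]" by simp
    have "y \<notin> set (arr (s QUEUE))" using new inv unfolding search_inv_def by blast
    then have "search_inv a st ok (pushed ?s QUEUE y)" "extends s (pushed ?s QUEUE y)"
      using inv t D unfolding search_inv_def extends_def q y_def by auto
    then show ?thesis
      using new st by (simp add: visit_def y_def[symmetric])
  next
    case old
    then have "y \<in> set (arr (s QUEUE))" using inv unfolding search_inv_def by blast
    with old show ?thesis using inv st
      by (simp add: visit_def y_def[symmetric] search_inv_def extends_def)
  next
    case clash
    then have y: "y \<in> set (arr (s QUEUE))" using inv unfolding search_inv_def by blast
    with inv have "tagged a y (s TAG y)" unfolding search_inv_def by blast
    then have "ambiguous a" using tags_ambiguous t clash unfolding y_def by blast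
    with y clash show ?thesis using inv st
      by (simp add: visit_def y_def[symmetric] search_inv_def extends_def)
  qed
qed

text \<open>After a clash the stored tags no longer describe all walks, hence the alternative that
  \<open>OK\<close> is 0.\<close>

definition processed :: "store \<Rightarrow> nat \<Rightarrow> bool" where
  "processed s h \<longleftrightarrow> (\<forall>q \<in> set (take h (arr (s QUEUE))). \<forall>l b c y. (q, l, b, c) \<in> G \<longrightarrow> kind_code l < 3 \<longrightarrow>
     y = b \<or> y = c \<longrightarrow> y \<in> set (arr (s QUEUE)) \<and>
       (s TAG y = (if kind_code l = 0 then s TAG q else q) \<or> s OK 0 = 0))"

lemma processed_extends:
  assumes "processed s h" "extends s s'" "h \<le> s QUEUE 0"
  shows "processed s' h"
proof -
  from assms(2) obtain r where r: "arr (s' QUEUE) = arr (s QUEUE) @ r" unfolding extends_def by blast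
  then have "take h (arr (s' QUEUE)) = take h (arr (s QUEUE))" using assms(3) by simp
  moreover have "set (take h (arr (s QUEUE))) \<subseteq> set (arr (s QUEUE))" by (rule set_take_subset)
  ultimately show ?thesis
    using assms(1,2) unfolding processed_def extends_def by (auto simp: subset_iff)
qed

lemma run_explore_body:
  assumes b: "\<forall>n\<in>G. stored s n" and inv: "search_inv a st ok s" and st: "s STAMP 0 = st"
    and h: "s HEAD 0 < s QUEUE 0" and pr: "processed s (s HEAD 0)"
  shows "run explore_body s (\<lambda>t s'. search_inv a st ok s' \<and> extends s s' \<and>
    s' HEAD 0 = Suc (s HEAD 0) \<and> processed s' (s' HEAD 0) \<and> t \<le> 17)"
proof -
  define q where "q = s QUEUE (Suc (s HEAD 0))"
  have q: "arr (s QUEUE) ! s HEAD 0 = q" using h by (simp add: arr_nth q_def)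
  then have qQ: "q \<in> set (arr (s QUEUE))" using h by (metis length_arr nth_mem)
  with inv have tq: "tagged a q (s TAG q)" "q \<in> Domain G" unfolding search_inv_def by blast+
  then obtain l c d where e: "(q, l, c, d) \<in> G" by auto
  with b have ste: "s KIND q = kind_code l" "s NEXT1 q = c" "s NEXT2 q = d" by auto
  have cd: "c \<in> Domain G" "d \<in> Domain G" using G_closed[OF e] by auto
  have tk: "take (Suc (s HEAD 0)) (arr (s QUEUE)) = take (s HEAD 0) (arr (s QUEUE)) @ [q]"
    using h q by (simp add: take_Suc_conv_app_nth)
  show ?thesis
  proof (cases "kind_code l < 3")
    case False
    let ?s = "s(HEAD := (s HEAD)(0 := Suc (s HEAD 0)), CUR := (s CUR)(0 := q))"
    have "processed ?s (Suc (s HEAD 0))"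
      using pr tk False G_fun[OF e] unfolding processed_def by auto
    moreover have "search_inv a st ok ?s" "extends s ?s"
      using inv by (simp_all add: search_inv_def extends_def)
    ultimately show ?thesis
      using False ste by (simp add: explore_body_def q_def[symmetric])
  next
    case True
    define t where "t = (if kind_code l = 0 then s TAG q else q)"
    let ?s = "s(HEAD := (s HEAD)(0 := Suc (s HEAD 0)), CUR := (s CUR)(0 := q), CTAG := (s CTAG)(0 := t))"
    have i1: "search_inv a st ok ?s" "extends s ?s"
      using inv by (simp_all add: search_inv_def extends_def)
    have tg: "tagged a c t" "tagged a d t" using tagged_step[OF tq(1) e _ True] unfolding t_def by auto
    have "run (Seq (visit (Get NEXT1 (reg CUR))) (visit (Get NEXT2 (reg CUR)))) ?s
      (\<lambda>t s'. search_inv a st ok s' \<and> extends s s' \<and>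
        s' HEAD 0 = Suc (s HEAD 0) \<and> processed s' (s' HEAD 0) \<and> t \<le> 12)"
    proof (rule run_SeqI[OF run_same[OF run_visit[OF i1(1)]]])
      show "tagged a (eval_exp (Get NEXT1 (reg CUR)) ?s) (?s CTAG 0)" using tg ste by simp
      show "eval_exp (Get NEXT1 (reg CUR)) ?s \<in> Domain G" using cd ste by simp
      show "?s STAMP 0 = st" using st by simp
      fix t1 :: nat and s1 :: store assume "(search_inv a st ok s1 \<and> extends ?s s1 \<and>
          eval_exp (Get NEXT1 (reg CUR)) ?s \<in> set (arr (s1 QUEUE)) \<and>
          (s1 TAG (eval_exp (Get NEXT1 (reg CUR)) ?s) = ?s CTAG 0 \<or> s1 OK 0 = 0) \<and> t1 \<le> 6) \<and>
          same (writes (visit (Get NEXT1 (reg CUR)))) ?s s1"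
      then have 1: "search_inv a st ok s1" "extends ?s s1" "c \<in> set (arr (s1 QUEUE))"
        "s1 TAG c = t \<or> s1 OK 0 = 0" "t1 \<le> 6"
        and old1: "\<And>x. x \<notin> {NODE, OK, VIS, TAG, QUEUE} \<Longrightarrow> s1 x = ?s x"
        using ste by (simp_all add: writes_visit same_def)
      show "run (visit (Get NEXT2 (reg CUR))) s1 (\<lambda>t2 s'. search_inv a st ok s' \<and> extends s s' \<and>
        s' HEAD 0 = Suc (s HEAD 0) \<and> processed s' (s' HEAD 0) \<and> t1 + t2 \<le> 12)"
      proof (rule run_mono[OF run_same[OF run_visit[OF 1(1)]]])
        show "tagged a (eval_exp (Get NEXT2 (reg CUR)) s1) (s1 CTAG 0)" using tg ste by (simp add: old1)
        show "eval_exp (Get NEXT2 (reg CUR)) s1 \<in> Domain G" using cd ste by (simp add: old1)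
        show "s1 STAMP 0 = st" using st by (simp add: old1)
        fix t2 :: nat and s2 :: store assume "(search_inv a st ok s2 \<and> extends s1 s2 \<and>
          eval_exp (Get NEXT2 (reg CUR)) s1 \<in> set (arr (s2 QUEUE)) \<and>
          (s2 TAG (eval_exp (Get NEXT2 (reg CUR)) s1) = s1 CTAG 0 \<or> s2 OK 0 = 0) \<and> t2 \<le> 6) \<and>
          same (writes (visit (Get NEXT2 (reg CUR)))) s1 s2"
        then have 2: "search_inv a st ok s2" "extends s1 s2" "d \<in> set (arr (s2 QUEUE))"
          "s2 TAG d = t \<or> s2 OK 0 = 0" "t2 \<le> 6"
          and old2: "\<And>x. x \<notin> {NODE, OK, VIS, TAG, QUEUE} \<Longrightarrow> s2 x = s1 x"
          using ste by (simp_all add: writes_visit same_def old1)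
        have ext: "extends s s2" using i1(2) 1(2) 2(2) extends_trans by blast
        have c2: "c \<in> set (arr (s2 QUEUE))" "s2 TAG c = t \<or> s2 OK 0 = 0"
          using 1(3,4) 2(2) unfolding extends_def by auto
        have q2: "s2 TAG q = s TAG q" using ext qQ unfolding extends_def by blast
        have "take (Suc (s HEAD 0)) (arr (s2 QUEUE)) = take (s HEAD 0) (arr (s2 QUEUE)) @ [q]"
        proof -
          obtain r where "arr (s2 QUEUE) = arr (s QUEUE) @ r" using ext unfolding extends_def by blast
          then show ?thesis using tk h by simp
        qed
        moreover have "processed s2 (s HEAD 0)" using processed_extends[OF pr ext] h by simp
        moreover have "y \<in> set (arr (s2 QUEUE)) \<and>
            (s2 TAG y = (if kind_code l' = 0 then s2 TAG q else q) \<or> s2 OK 0 = 0)"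
          if "(q, l', c', d') \<in> G" "y = c' \<or> y = d'" for l' c' d' y
          using G_fun[OF e that(1)] that(2) c2 2(3,4) q2 unfolding t_def by auto
        ultimately have "processed s2 (Suc (s HEAD 0))" unfolding processed_def by auto
        with 1 2 ext show "search_inv a st ok s2 \<and> extends s s2 \<and>
          s2 HEAD 0 = Suc (s HEAD 0) \<and> processed s2 (s2 HEAD 0) \<and> t1 + t2 \<le> 12"
          by (simp add: old1 old2)
      qed
    qed
    then show ?thesis
      using True ste unfolding explore_body_def t_def
      by (cases "kind_code l = 0") (auto simp: q_def[symmetric] elim!: run_mono)
  qed
qed

definition explored :: "nat \<Rightarrow> nat \<Rightarrow> store \<Rightarrow> bool" where
  "explored a ok s \<longleftrightarrow> distinct (arr (s QUEUE)) \<and> set (arr (s QUEUE)) \<subseteq> Domain G \<and>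
     (\<forall>y \<in> set (arr (s QUEUE)). tagged a y (s TAG y)) \<and>
     s OK 0 \<le> ok \<and> (s OK 0 < ok \<longrightarrow> ambiguous a) \<and>
     (0 < s OK 0 \<longrightarrow> (\<forall>\<gamma> q. bwalk a \<gamma> q \<longrightarrow> q \<in> set (arr (s QUEUE)) \<and> s TAG q = last_tag \<gamma>))"

text \<open>When the queue is exhausted it is closed under silent and bracket steps with matching
  tags, so any bracket walk can be followed inside it.\<close>

lemma search_complete:
  assumes pr: "processed s (s QUEUE 0)" and a: "a \<in> set (arr (s QUEUE))" "s TAG a = 0"
    and ok: "0 < s OK 0" and w: "bwalk a \<gamma> r"
  shows "r \<in> set (arr (s QUEUE)) \<and> s TAG r = last_tag \<gamma>"
proof -
  have pr: "y \<in> set (arr (s QUEUE)) \<and> s TAG y = (if kind_code l = 0 then s TAG q else q)"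
    if "q \<in> set (arr (s QUEUE))" "(q, l, b, c) \<in> G" "kind_code l < 3" "y = b \<or> y = c" for q l b c y
  proof -
    have "take (s QUEUE 0) (arr (s QUEUE)) = arr (s QUEUE)" by simp
    from pr[unfolded processed_def this, rule_format, OF that] ok show ?thesis by simp
  qed
  \<comment> \<open>Generalised to walks from any queued node: its own tag is inherited until the
    first bracket is passed.\<close>
  have "r \<in> set (arr (s QUEUE)) \<and> s TAG r = (if w = [] then s TAG q else snd (last w))"
    if "walk G q w r" "w \<in> bracket_words" "q \<in> set (arr (s QUEUE))" for q w
    using that
  proof (induction rule: walk.induct)
    case (walk_eps q b c q' w r)
    from pr[OF walk_eps.prems(2) walk_eps.hyps(1), of q'] walk_eps show ?case by simp
  next
    case (walk_sym q l b c w r)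
    then have "kind_code (Some l) < 3 \<and> kind_code (Some l) \<noteq> 0"
      by (cases l) (auto simp: bracket_syms_def)
    with pr[OF walk_sym.prems(2) walk_sym.hyps(1), of b] walk_sym show ?case by auto
  qed simp
  from this[of a \<gamma>] w a show ?thesis unfolding bwalk_def last_tag_def by auto
qed

text \<open>A node is enqueued only when first visited, so there are at most \<open>nodes\<close>
  rounds of 17 steps and a test.\<close>

lemma run_explore:
  assumes b: "\<forall>n\<in>G. stored s n" and src: "source (s SOURCE 0) a" and st: "s STAMP 0 = st"
    and fresh: "\<forall>y. s VIS y < st" and ok: "s OK 0 = ok"
  shows "run explore s (\<lambda>t s'. explored a ok s' \<and> (\<forall>y. s' VIS y \<le> st) \<and> t \<le> 18 * nodes + 10)"
proof -
  have "\<exists>l d. (s SOURCE 0, l, a, d) \<in> G"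
    using src unfolding source_def
  proof (elim disjE exE conjE)
    assume "s SOURCE 0 = 0" "a = p0"
    then show ?thesis using init_entry by auto
  qed blast
  then obtain l d where e: "(s SOURCE 0, l, a, d) \<in> G" by blast
  with b have N: "s NEXT1 (s SOURCE 0) = a" by auto
  have aD: "a \<in> Domain G" using G_closed[OF e] by blast
  let ?s = "s(QUEUE := (s QUEUE)(0 := 0), HEAD := (s HEAD)(0 := 0), CTAG := (s CTAG)(0 := 0))"
  have "arr ((s QUEUE)(0 := 0)) = []" by (simp add: arr_def)
  then have inv: "search_inv a st ok ?s" and em: "arr (?s QUEUE) = []"
    using fresh ok by (auto simp: search_inv_def less_imp_le)
  have N': "eval_exp (Get NEXT1 (reg SOURCE)) ?s = a" using N by simp
  have "run (Seq (visit (Get NEXT1 (reg SOURCE))) (While (Less (reg HEAD) (reg QUEUE)) explore_body)) ?s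
    (\<lambda>t s'. explored a ok s' \<and> (\<forall>y. s' VIS y \<le> st) \<and> t \<le> 18 * nodes + 7)"
  proof (rule run_SeqI[OF run_same[OF run_visit[OF inv, of "Get NEXT1 (reg SOURCE)", unfolded N']]])
    show "tagged a a (?s CTAG 0)" using tagged_start by simp
    show "a \<in> Domain G" "?s STAMP 0 = st" using aD st by simp_all
    fix t1 :: nat and s1 :: store assume v: "(search_inv a st ok s1 \<and> extends ?s s1 \<and> a \<in> set (arr (s1 QUEUE)) \<and>
      (s1 TAG a = ?s CTAG 0 \<or> s1 OK 0 = 0) \<and> t1 \<le> 6) \<and> same (writes (visit (Get NEXT1 (reg SOURCE)))) ?s s1"
    have old: "\<And>x. x \<notin> {NODE, OK, VIS, TAG, QUEUE} \<Longrightarrow> s1 x = ?s x"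
      using v by (simp add: writes_visit same_def)
    let ?I = "\<lambda>s'. search_inv a st ok s' \<and> processed s' (s' HEAD 0) \<and> s' HEAD 0 \<le> s' QUEUE 0 \<and>
        a \<in> set (arr (s' QUEUE)) \<and> (s' TAG a = 0 \<or> s' OK 0 = 0)"
    have len: "s' QUEUE 0 \<le> nodes" if "search_inv a st ok s'" for s'
    proof -
      from that have d: "distinct (arr (s' QUEUE))" "set (arr (s' QUEUE)) \<subseteq> Domain G"
        unfolding search_inv_def by blast+
      from card_mono[OF card_Domain(1) d(2)] distinct_card[OF d(1)] card_Domain(2) show ?thesis by simp
    qed
    show "run (While (Less (reg HEAD) (reg QUEUE)) explore_body) s1
      (\<lambda>t2 s'. explored a ok s' \<and> (\<forall>y. s' VIS y \<le> st) \<and> t1 + t2 \<le> 18 * nodes + 7)"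
    proof (rule run_while[of ?I _ _ _ "\<lambda>s'. 18 * (nodes - s' HEAD 0)"])
      show "?I s1" using v by (simp add: old processed_def)
    next
      fix s2 :: store assume I: "?I s2" and sm: "same (writes explore_body) s1 s2"
        and t: "eval_test (Less (reg HEAD) (reg QUEUE)) s2"
      from sm have old2: "\<And>x. x \<notin> {HEAD, CUR, CTAG, NODE, OK, VIS, TAG, QUEUE} \<Longrightarrow> s2 x = s x"
        by (simp add: writes_explore_body same_def old)
      have "stored s2 n" if "n \<in> G" for n using b that by (cases n) (auto simp: old2)
      moreover have "s2 STAMP 0 = st" "s2 HEAD 0 < s2 QUEUE 0" using st t by (simp_all add: old2)
      ultimately show "run explore_body s2 (\<lambda>t s'. ?I s' \<and>
          t + 18 * (nodes - s' HEAD 0) < 18 * (nodes - s2 HEAD 0))"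
      proof (intro run_mono[OF run_explore_body[of s2 a st ok]] ballI)
        fix t :: nat and s' :: store assume r: "search_inv a st ok s' \<and> extends s2 s' \<and>
          s' HEAD 0 = Suc (s2 HEAD 0) \<and> processed s' (s' HEAD 0) \<and> t \<le> 17"
        then obtain r where "arr (s' QUEUE) = arr (s2 QUEUE) @ r" unfolding extends_def by blast
        then have "set (arr (s2 QUEUE)) \<subseteq> set (arr (s' QUEUE))"
          "length (arr (s2 QUEUE)) \<le> length (arr (s' QUEUE))" by simp_all
        then have q: "s2 QUEUE 0 \<le> s' QUEUE 0" "set (arr (s2 QUEUE)) \<subseteq> set (arr (s' QUEUE))" by simp_all
        moreover have "s' TAG a = s2 TAG a" "s' OK 0 \<le> s2 OK 0" using r I unfolding extends_def by auto
        moreover have "s2 HEAD 0 < nodes" using \<open>s2 HEAD 0 < s2 QUEUE 0\<close> len[of s2] I by simp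
        ultimately show "?I s' \<and> t + 18 * (nodes - s' HEAD 0) < 18 * (nodes - s2 HEAD 0)"
          using r I \<open>s2 HEAD 0 < s2 QUEUE 0\<close> by auto
      qed (use I in auto)
    next
      fix t2 :: nat and s2 :: store assume I: "?I s2" and t: "\<not> eval_test (Less (reg HEAD) (reg QUEUE)) s2"
        and time: "t2 \<le> Suc (18 * (nodes - s1 HEAD 0))"
      from I t have h: "s2 HEAD 0 = s2 QUEUE 0" by simp
      have "q \<in> set (arr (s2 QUEUE)) \<and> s2 TAG q = last_tag \<gamma>" if "0 < s2 OK 0" "bwalk a \<gamma> q" for \<gamma> q
        using I that h by (intro search_complete[of s2 a]) auto
      with I have "explored a ok s2" "\<forall>y. s2 VIS y \<le> st"
        unfolding explored_def search_inv_def by auto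
      with time v show "explored a ok s2 \<and> (\<forall>y. s2 VIS y \<le> st) \<and> t1 + t2 \<le> 18 * nodes + 7"
        by (simp add: old)
    qed
  qed
  then show ?thesis by (auto simp: explore_def elim!: run_mono)
qed

lemma explored_unambiguous: "explored a ok s \<Longrightarrow> 0 < s OK 0 \<Longrightarrow> \<not> ambiguous a"
  by (rule unambiguous) (unfold explored_def tagged_def, metis)

end

text \<open>For loops whose remaining time depends on data not recoverable from the store, such as
  the part of a bracket word still to be followed. The least admissible value serves as the variant
  of \<open>run_while\<close>.\<close>

lemma run_while_ghost:
  assumes "I n s0"
    and step: "\<And>n s. I n s \<Longrightarrow> same (writes c) s0 s \<Longrightarrow> eval_test b s \<Longrightarrow>
      run c s (\<lambda>t s'. \<exists>m :: nat. I m s' \<and> t + m < n)"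
    and exit: "\<And>t m s'. I m s' \<Longrightarrow> same (writes c) s0 s' \<Longrightarrow> \<not> eval_test b s' \<Longrightarrow>
      t \<le> Suc n \<Longrightarrow> Q t s'"
  shows "run (While b c) s0 Q"
proof (rule run_while[of "\<lambda>s. \<exists>n. I n s" s0 c b "\<lambda>s. LEAST n. I n s"])
  show "\<exists>n. I n s0" using assms(1) by blast
next
  fix s assume "\<exists>n. I n s" "same (writes c) s0 s" "eval_test b s"
  moreover from this(1) have "I (LEAST n. I n s) s" by (rule LeastI_ex)
  ultimately show "run c s (\<lambda>t s'. (\<exists>n. I n s') \<and> t + (LEAST n. I n s') < (LEAST n. I n s))"
    by (intro run_mono[OF step]) (auto intro: le_less_trans[OF add_left_mono[OF Least_le]])
next
  fix t s' assume "\<exists>n. I n s'" "same (writes c) s0 s'" "\<not> eval_test b s'" "t \<le> Suc (LEAST n. I n s0)"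
  moreover have "(LEAST n. I n s0) \<le> n" using assms(1) by (rule Least_le)
  ultimately show "Q t s'" using exit by (meson Suc_le_mono le_trans)
qed

section \<open>Checking and listing the transitions of a source\<close>

abbreviation (input) SEEN :: nat where "SEEN \<equiv> 14"
abbreviation (input) ACT :: nat where "ACT \<equiv> 15"
abbreviation (input) FINALS :: nat where "FINALS \<equiv> 16"
abbreviation (input) TRANS :: nat where "TRANS \<equiv> 17"
abbreviation (input) COUNT :: nat where "COUNT \<equiv> 30"
abbreviation (input) TERMS :: nat where "TERMS \<equiv> 31"
abbreviation (input) REFS :: nat where "REFS \<equiv> 32"
abbreviation (input) IDX :: nat where "IDX \<equiv> 33"
abbreviation (input) VIDX :: nat where "VIDX \<equiv> 34"
abbreviation (input) WALK :: nat where "WALK \<equiv> 35"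

text \<open>Pairs of letters are not compared: a new letter meets only a summary of the earlier
  ones, namely the stamped terminals in \<open>SEEN\<close> and two flags. This keeps the check
  linear.\<close>

definition check_body :: prog where
  "check_body = Seq (put_reg CUR (Get QUEUE (plus1 (reg IDX))))
     (Cond (Equal (Get KIND (reg CUR)) (Const 3))
       (Seq (Cond (Equal (Get SEEN (Get LABEL (reg CUR))) (reg STAMP)) (put_reg OK (Const 0))
           (Cond (Equal (reg REFS) (Const 0)) Skip (put_reg OK (Const 0))))
         (Seq (Put SEEN (Get LABEL (reg CUR)) (reg STAMP)) (put_reg TERMS (Const 1))))
     (Cond (Equal (Get KIND (reg CUR)) (Const 4))
       (Seq (Cond (Conj (Equal (reg TERMS) (Const 0)) (Equal (reg REFS) (Const 0))) Skip (put_reg OK (Const 0)))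
         (put_reg REFS (Const 1)))
       Skip))"

definition check :: prog where
  "check = Seq (put_reg TERMS (Const 0)) (Seq (put_reg REFS (Const 0)) (for_upto IDX (reg QUEUE) check_body))"

lemma writes_check_body: "writes check_body = {CUR, OK, SEEN, TERMS, REFS}"
  by (auto simp: check_body_def)

lemma writes_check: "writes check = {CUR, OK, SEEN, TERMS, REFS, IDX}"
  by (auto simp: check_def writes_check_body)

text \<open>The brackets of a walk are met from right to left, which is how \<open>act\<close> is defined.\<close>

definition walk_body :: prog where
  "walk_body = Seq
     (Cond (Equal (Get ACT (Get LABEL (reg WALK))) (Const 3))
       (Cond (Equal (Get KIND (reg WALK)) (Const 1))
         (Put ACT (Get LABEL (reg WALK)) (Const 0)) (Put ACT (Get LABEL (reg WALK)) (Const 1)))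
       (Cond (Conj (Equal (Get ACT (Get LABEL (reg WALK))) (Const 1)) (Equal (Get KIND (reg WALK)) (Const 1)))
         (Put ACT (Get LABEL (reg WALK)) (Const 2)) Skip))
     (put_reg WALK (Get TAG (reg WALK)))"

text \<open>Only the cells of variables in the regex are reset. From the current letter the links in
  \<open>TAG\<close> then lead back from bracket to bracket until 0.\<close>

definition actions :: prog where
  "actions = Seq (for_upto VIDX (reg VARS) (Put ACT (Get VARS (plus1 (reg VIDX))) (Const 3)))
     (Seq (put_reg WALK (Get TAG (reg CUR))) (While (Less (Const 0) (reg WALK)) walk_body))"

text \<open>For a recall, \<open>ACT\<close> is set to the code of \<open>AClose\<close> once the
  label is written, so that the list of actions printed afterwards is that of \<open>trans\<close>.
  All memories of one variable read the same cell.\<close>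

definition put_label :: prog where
  "put_label = Cond (Equal (Get KIND (reg CUR)) (Const 3))
     (Seq (push TRANS (Const 0)) (push TRANS (Get LABEL (reg CUR))))
     (Cond (Equal (Get ACT (Get LABEL (reg CUR))) (Const 2))
       (Seq (push TRANS (Const 1)) (push TRANS (Const 0)))
       (Seq (push TRANS (Const 2)) (Seq (push TRANS (Get MEM (Get LABEL (reg CUR))))
         (Put ACT (Get LABEL (reg CUR)) (Const 1)))))"

definition emit :: prog where
  "emit = Seq actions (Seq (push TRANS (reg SOURCE)) (Seq put_label (Seq (push TRANS (reg CUR))
     (Seq (for_upto VIDX (reg VARS) (push TRANS (Get ACT (Get VARS (plus1 (reg VIDX))))))
       (put_reg COUNT (plus1 (reg COUNT)))))))"

text \<open>\<open>LIMIT\<close> added to itself is the final node \<open>F\<close>: a source that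
  finds it by brackets alone is accepting.\<close>

definition emit_body :: prog where
  "emit_body = Seq (put_reg CUR (Get QUEUE (plus1 (reg IDX))))
     (Seq (Cond (Equal (reg CUR) (Add (reg LIMIT) (reg LIMIT))) (push FINALS (reg SOURCE)) Skip)
       (Cond (Less (Const 2) (Get KIND (reg CUR))) emit Skip))"

definition emit_all :: prog where
  "emit_all = for_upto IDX (reg QUEUE) emit_body"

lemma writes_actions: "writes actions = {VIDX, ACT, WALK}"
  by (auto simp: actions_def walk_body_def)

lemma writes_emit: "writes emit = {VIDX, ACT, WALK, TRANS, COUNT}"
  by (auto simp: emit_def writes_actions put_label_def)

lemma writes_emit_body: "writes emit_body = {CUR, VIDX, ACT, WALK, TRANS, COUNT, FINALS}"
  by (auto simp: emit_body_def writes_emit)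

lemma writes_emit_all: "writes emit_all = {CUR, VIDX, ACT, WALK, TRANS, COUNT, FINALS, IDX}"
  by (auto simp: emit_all_def writes_emit_body)

lemma length_var_list: "length (var_list \<alpha>) \<le> len \<alpha>"
  by (induction \<alpha>) auto

context regex_graph
begin

definition clashes :: "nat set \<Rightarrow> bool" where
  "clashes X \<longleftrightarrow> (\<exists>q1\<in>X. \<exists>q2\<in>X. \<exists>l1 l2. letter q1 l1 \<and> letter q2 l2 \<and> q1 \<noteq> q2 \<and> conflict l1 l2)"

lemma clashes_insert:
  assumes "q \<notin> X"
  shows "clashes (insert q X) \<longleftrightarrow> clashes X \<or> (\<exists>l. letter q l \<and> (\<exists>q'\<in>X. \<exists>l'. letter q' l' \<and> conflict l l'))"
proof -
  have "conflict l l' \<longleftrightarrow> conflict l' l" for l l' by (auto simp: conflict_def)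
  with assms show ?thesis unfolding clashes_def by blast
qed

lemma stored_letter:
  assumes "\<forall>n\<in>G. stored s n" "q \<in> Domain G"
  shows "(s KIND q = 3 \<longleftrightarrow> (\<exists>c. letter q (Tm c))) \<and> (s KIND q = 4 \<longleftrightarrow> (\<exists>x. letter q (Vr x))) \<and>
    (\<forall>c. letter q (Tm c) \<longrightarrow> s LABEL q = c) \<and> (\<forall>x. letter q (Vr x) \<longrightarrow> s LABEL q = x) \<and>
    (2 < s KIND q \<longleftrightarrow> (\<exists>l. letter q l))"
proof -
  from assms(2) obtain l a b where e: "(q, l, a, b) \<in> G" by auto
  with assms(1) have st: "s KIND q = kind_code l" "s LABEL q = symbol_arg l" by auto
  have lt: "letter q l' \<longleftrightarrow> l = Some l' \<and> l' \<in> letter_syms" for l'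
    using e G_fun[OF e] unfolding letter_def by blast
  show ?thesis
  proof (cases l)
    case None
    with st lt show ?thesis by simp
  next
    case (Some m)
    with st lt show ?thesis by (cases m) (auto simp: letter_syms_def)
  qed
qed

definition check_inv :: "nat \<Rightarrow> nat \<Rightarrow> nat set \<Rightarrow> store \<Rightarrow> bool" where
  "check_inv st ok X s \<longleftrightarrow> (s TERMS 0 \<noteq> 0 \<longleftrightarrow> (\<exists>q\<in>X. \<exists>c. letter q (Tm c))) \<and>
     (s REFS 0 \<noteq> 0 \<longleftrightarrow> (\<exists>q\<in>X. \<exists>x. letter q (Vr x))) \<and>
     (\<forall>c. s SEEN c = st \<longleftrightarrow> (\<exists>q\<in>X. letter q (Tm c))) \<and> (\<forall>c. s SEEN c \<le> st) \<and>
     s OK 0 = (if clashes X then 0 else ok)"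

lemma run_check_body:
  assumes b: "\<forall>n\<in>G. stored s n" and inv: "check_inv st ok X s" and q: "s QUEUE (Suc (s IDX 0)) = q"
    and qX: "q \<notin> X" "q \<in> Domain G" and st: "s STAMP 0 = st"
  shows "run check_body s (\<lambda>t s'. check_inv st ok (insert q X) s' \<and> t \<le> 7)"
proof -
  note sl = stored_letter[OF b qX(2)]
  note ci = clashes_insert[OF qX(1)]
  consider (tm) c where "letter q (Tm c)" | (vr) x where "letter q (Vr x)" | (no) "\<And>l. \<not> letter q l"
    using letter_symbols by blast
  then show ?thesis
  proof cases
    case tm
    then have k: "s KIND q = 3" "s LABEL q = c" using sl by auto
    have only: "letter q l \<longleftrightarrow> l = Tm c" for l using tm letter_unique by blast
    have "(\<exists>q'\<in>X. \<exists>l'. letter q' l' \<and> conflict (Tm c) l') \<longleftrightarrow> s SEEN c = st \<or> s REFS 0 \<noteq> 0"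
    proof -
      have i: "s SEEN c = st \<longleftrightarrow> (\<exists>q\<in>X. letter q (Tm c))" "s REFS 0 \<noteq> 0 \<longleftrightarrow> (\<exists>q\<in>X. \<exists>x. letter q (Vr x))"
        using inv by (simp_all only: check_inv_def)
      have cf: "conflict (Tm c) l' \<longleftrightarrow> l' = Tm c \<or> (\<exists>x. l' = Vr x)" for l'
        unfolding conflict_def by (cases l') auto
      show ?thesis unfolding i cf by blast
    qed
    then have cl: "clashes (insert q X) \<longleftrightarrow> clashes X \<or> s SEEN c = st \<or> s REFS 0 \<noteq> 0"
      unfolding ci only by auto
    show ?thesis
      using inv k q st unfolding check_inv_def cl by (auto simp: check_body_def only)
  next
    case vr
    then have k: "s KIND q = 4" "s LABEL q = x" using sl by auto
    have only: "letter q l \<longleftrightarrow> l = Vr x" for l using vr letter_unique by blast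
    have "(\<exists>q'\<in>X. \<exists>l'. letter q' l') \<longleftrightarrow> s TERMS 0 \<noteq> 0 \<or> s REFS 0 \<noteq> 0"
      using inv letter_symbols unfolding check_inv_def by blast
    then have cl: "clashes (insert q X) \<longleftrightarrow> clashes X \<or> s TERMS 0 \<noteq> 0 \<or> s REFS 0 \<noteq> 0"
      unfolding ci only by (auto simp: conflict_def)
    show ?thesis
      using inv k q st unfolding check_inv_def cl by (auto simp: check_body_def only)
  next
    case no
    then have k: "s KIND q \<noteq> 3" "s KIND q \<noteq> 4" using sl by auto
    have cl: "clashes (insert q X) \<longleftrightarrow> clashes X" unfolding ci using no by blast
    show ?thesis
      using inv k q st no unfolding check_inv_def cl by (auto simp: check_body_def)
  qed
qed

lemma run_check:
  assumes b: "\<forall>n\<in>G. stored s n" and d: "distinct (arr (s QUEUE))" "set (arr (s QUEUE)) \<subseteq> Domain G"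
    and st: "s STAMP 0 = st" and fresh: "\<forall>c. s SEEN c < st"
  shows "run check s (\<lambda>t s'. s' OK 0 = (if clashes (set (arr (s QUEUE))) then 0 else s OK 0) \<and>
    (\<forall>c. s' SEEN c \<le> st) \<and> t \<le> 9 * s QUEUE 0 + 4)"
proof -
  let ?s = "s(TERMS := (s TERMS)(0 := 0), REFS := (s REFS)(0 := 0))"
  let ?Q = "arr (s QUEUE)"
  have "run (for_upto IDX (reg QUEUE) check_body) ?s (\<lambda>t s'. s' OK 0 = (if clashes (set ?Q) then 0 else s OK 0) \<and>
    (\<forall>c. s' SEEN c \<le> st) \<and> t \<le> 9 * s QUEUE 0 + 2)"
  proof (rule run_for_upto[where n = "s QUEUE 0" and T = "\<lambda>_. 7" and
        I = "\<lambda>i s'. check_inv st (s OK 0) (set (take i ?Q)) s'"])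
    show "check_inv st (s OK 0) (set (take 0 ?Q)) ?s"
      using fresh by (auto simp: check_inv_def clashes_def less_imp_le less_imp_neq)
  next
    fix i :: nat and s' :: store assume i: "i < s QUEUE 0" "check_inv st (s OK 0) (set (take i ?Q)) s'" "s' IDX 0 = i"
      and sm: "same (insert IDX (writes check_body)) ?s s'"
    from sm have old: "\<And>x. x \<notin> {CUR, OK, SEEN, TERMS, REFS, IDX} \<Longrightarrow> s' x = s x"
      by (simp add: writes_check_body same_def)
    have st': "\<forall>n\<in>G. stored s' n"
    proof
      fix n assume "n \<in> G" then show "stored s' n" using b by (cases n) (auto simp: old)
    qed
    have qi: "?Q ! i = s QUEUE (Suc i)" using i by (simp add: arr_nth)
    have tk: "set (take (Suc i) ?Q) = insert (s QUEUE (Suc i)) (set (take i ?Q))"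
      using i qi by (simp add: take_Suc_conv_app_nth)
    have "distinct (take (Suc i) ?Q)" using d(1) by simp
    then have new: "s QUEUE (Suc i) \<notin> set (take i ?Q)" using i qi by (simp add: take_Suc_conv_app_nth)
    have "s QUEUE (Suc i) \<in> Domain G" using d(2) i qi by (metis length_arr nth_mem subsetD)
    from run_check_body[OF st' i(2) _ new this] i st
    show "run check_body s' (\<lambda>t s'. check_inv st (s OK 0) (set (take (Suc i) ?Q)) s' \<and> t \<le> 7)"
      unfolding tk by (simp add: old)
  next
    fix t :: nat and s' :: store assume I: "check_inv st (s OK 0) (set (take (s QUEUE 0) ?Q)) s'"
      and t: "t \<le> 2 + (\<Sum>i<s QUEUE 0. 7 + 2)"
    have "take (s QUEUE 0) ?Q = ?Q" by simp
    with I t show "s' OK 0 = (if clashes (set ?Q) then 0 else s OK 0) \<and> (\<forall>c. s' SEEN c \<le> st) \<and>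
        t \<le> 9 * s QUEUE 0 + 2"
      by (simp add: check_inv_def)
  qed (auto simp: same_def check_inv_def writes_check_body)
  then show ?thesis by (auto simp: check_def elim!: run_mono)
qed

lemma explored_conflicting:
  assumes "explored a ok s" "0 < s OK 0"
  shows "clashes (set (arr (s QUEUE))) \<longleftrightarrow> conflicting a"
proof -
  have m: "q \<in> set (arr (s QUEUE)) \<longleftrightarrow> (\<exists>\<gamma>. bwalk a \<gamma> q)" for q
    using assms unfolding explored_def tagged_def by blast
  show ?thesis unfolding clashes_def conflicting_def Bex_def m by blast
qed

text \<open>Without clashes a reference tolerates no second letter, and otherwise the letters are
  pairwise different terminals. This is the origin of the factor |\<Sigma>| in the running
  time.\<close>

lemma letters_card:
  assumes "\<not> clashes X" "finite X" "A \<noteq> {}"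
  shows "card {q\<in>X. \<exists>l. letter q l} \<le> card A"
proof (cases "\<exists>q\<in>X. \<exists>x. letter q (Vr x)")
  case True
  then obtain q x where q: "q \<in> X" "letter q (Vr x)" by blast
  have "{q\<in>X. \<exists>l. letter q l} \<subseteq> {q}"
    using assms(1) q unfolding clashes_def conflict_def by blast
  then have "card {q\<in>X. \<exists>l. letter q l} \<le> card {q}" by (intro card_mono) auto
  also have "\<dots> \<le> card A" using assms(3) finite_A by (simp add: Suc_le_eq card_gt_0_iff)
  finally show ?thesis .
next
  case False
  define f where "f q = (THE c. letter q (Tm c))" for q
  have f: "letter q (Tm c) \<Longrightarrow> f q = c" for q c
    unfolding f_def using letter_unique by blast
  show ?thesis
  proof (rule card_inj_on_le[of f _ A])
    show "inj_on f {q\<in>X. \<exists>l. letter q l}"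
    proof (rule inj_onI)
      fix q r assume a: "q \<in> {q\<in>X. \<exists>l. letter q l}" "r \<in> {q\<in>X. \<exists>l. letter q l}" "f q = f r"
      then obtain c d where "letter q (Tm c)" "letter r (Tm d)"
        using False letter_symbols by blast
      with a f assms(1) show "q = r" unfolding clashes_def conflict_def by blast
    qed
    show "f ` {q\<in>X. \<exists>l. letter q l} \<subseteq> A"
      using False letter_symbols f by blast
  qed (rule finite_A)
qed

text \<open>A bracket node occurring twice would be reached by the word before its first occurrence
  and by a longer one, which contradicts unambiguity. So no bracket node repeats.\<close>

lemma bwalk_length:
  assumes "\<not> ambiguous a" "bwalk a \<gamma> q"
  shows "length \<gamma> \<le> nodes"
proof -
  have "distinct (map snd \<gamma>) \<and> set (map snd \<gamma>) \<subseteq> Domain G"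
    using assms(2)
  proof (induction \<gamma> arbitrary: q rule: rev_induct)
    case (snoc x \<gamma>)
    obtain l b where x: "x = (l, b)" by (cases x)
    with snoc.prems obtain c d where e: "walk G a \<gamma> b" "(b, Some l, c, d) \<in> G"
      unfolding bwalk_def by (auto elim: walk_snocE)
    then have b: "bwalk a \<gamma> b" using snoc.prems x by (simp add: bwalk_def)
    have "b \<notin> snd ` set \<gamma>"
    proof
      assume "b \<in> snd ` set \<gamma>"
      then obtain l' u v where \<gamma>: "\<gamma> = u @ (l', b) # v" by (auto simp: in_set_conv_decomp)
      with e(1) have "walk G a u b" using walk_splitE[of G a u l' b v b] by blast
      with b \<gamma> have "bwalk a u b" by (simp add: bwalk_def)
      with b \<gamma> have "ambiguous a" unfolding ambiguous_def by (metis append_self_conv list.discI)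
      with assms(1) show False ..
    qed
    with snoc.IH[OF b] x e(2) show ?case by auto
  qed simp
  then have "length \<gamma> = card (set (map snd \<gamma>))" "set (map snd \<gamma>) \<subseteq> Domain G"
    by (metis distinct_card length_map, simp)
  with card_mono[OF card_Domain(1)] card_Domain(2) show ?thesis by (metis le_trans)
qed

lemma bracket_symbols: "(q, Some l, a, b) \<in> G \<Longrightarrow> (\<exists>x. l = Op x \<or> l = Cl x) \<Longrightarrow> symbol_arg (Some l) \<in> set vs"
proof -
  assume e: "(q, Some l, a, b) \<in> G" and l: "\<exists>x. l = Op x \<or> l = Cl x"
  have "\<alpha> \<noteq> REmpty"
  proof
    assume "\<alpha> = REmpty"
    from e show False unfolding empty_G[OF \<open>\<alpha> = REmpty\<close>] by blast
  qed
  with nonempty_or have "nonempty_rx A \<alpha>" by blast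
  from graph_symbols[OF e[unfolded G_Some] this] l show ?thesis by auto
qed

definition acts_at :: "store \<Rightarrow> nsym list \<Rightarrow> bool" where
  "acts_at s g \<longleftrightarrow> (\<forall>x\<in>set vs. s ACT x = action_code (act g x))"

text \<open>With exact tags, the chain of links from a letter spells its only bracket word from
  right to left. Each bracket costs 4 steps and a test, each variable 3 steps.\<close>

lemma run_actions:
  assumes b: "\<forall>n\<in>G. stored s n" and v: "arr (s VARS) = vs"
    and ex: "\<And>\<gamma> q. bwalk a \<gamma> q \<Longrightarrow> s TAG q = last_tag \<gamma>" and un: "\<not> ambiguous a"
    and w: "bwalk a \<gamma> (s CUR 0)"
  shows "run actions s (\<lambda>t s'. acts_at s' (map fst \<gamma>) \<and> t \<le> 3 * k + 5 * nodes + 4)"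
proof -
  have k: "s VARS 0 = k" using v by (metis length_arr)
  have vi: "vs ! i = s VARS (Suc i)" if "i < k" for i
    using arr_nth[of i "s VARS"] that k unfolding v by simp
  show ?thesis
    unfolding actions_def
  proof (rule run_SeqI[OF run_same])
    show "run (for_upto VIDX (reg VARS) (Put ACT (Get VARS (plus1 (reg VIDX))) (Const 3))) s
      (\<lambda>t s'. acts_at s' [] \<and> t \<le> 2 + 3 * k)"
    proof (rule run_for_upto[where n = k and T = "\<lambda>_. 1" and I = "\<lambda>i s'. \<forall>j<i. s' ACT (vs ! j) = 3"])
      fix i :: nat and s' :: store assume "i < k" "\<forall>j<i. s' ACT (vs ! j) = 3" "s' VIDX 0 = i"
        "same (insert VIDX (writes (Put ACT (Get VARS (plus1 (reg VIDX))) (Const 3)))) s s'"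
      moreover from this(4) have "s' VARS = s VARS" by (simp add: same_def)
      ultimately show "run (Put ACT (Get VARS (plus1 (reg VIDX))) (Const 3)) s'
          (\<lambda>t s'. (\<forall>j<Suc i. s' ACT (vs ! j) = 3) \<and> t \<le> 1)"
        using vi[of i] by (simp add: less_Suc_eq)
    next
      fix t :: nat and s' :: store assume "\<forall>j<k. s' ACT (vs ! j) = 3" "t \<le> 2 + (\<Sum>i<k. 1 + 2)"
      then show "acts_at s' [] \<and> t \<le> 2 + 3 * k" by (auto simp: acts_at_def in_set_conv_nth)
    qed (use k in \<open>auto simp: same_def\<close>)
    fix t1 :: nat and s1 :: store
    assume a1: "(acts_at s1 [] \<and> t1 \<le> 2 + 3 * k) \<and>
      same (writes (for_upto VIDX (reg VARS) (Put ACT (Get VARS (plus1 (reg VIDX))) (Const 3)))) s s1"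
    then have old: "\<And>x. x \<notin> {VIDX, ACT} \<Longrightarrow> s1 x = s x" by (simp add: same_def)
    let ?s = "s1(WALK := (s1 WALK)(0 := s TAG (s CUR 0)))"
    have "run (While (Less (Const 0) (reg WALK)) walk_body) ?s
      (\<lambda>t s'. acts_at s' (map fst \<gamma>) \<and> t1 + Suc t \<le> 3 * k + 5 * nodes + 4)"
    \<comment> \<open>The word splits into \<open>\<gamma>1\<close>, still to be followed, and
      \<open>\<gamma>2\<close>, whose effect is already recorded in \<open>ACT\<close>.\<close>
    proof (rule run_while_ghost[where n = "5 * length \<gamma>" and
          I = "\<lambda>n s'. \<exists>\<gamma>1 \<gamma>2. \<gamma> = \<gamma>1 @ \<gamma>2 \<and> s' WALK 0 = last_tag \<gamma>1 \<and> acts_at s' (map fst \<gamma>2) \<and> n = 5 * length \<gamma>1"])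
      show "\<exists>\<gamma>1 \<gamma>2. \<gamma> = \<gamma>1 @ \<gamma>2 \<and> ?s WALK 0 = last_tag \<gamma>1 \<and> acts_at ?s (map fst \<gamma>2) \<and>
          5 * length \<gamma> = 5 * length \<gamma>1"
        using a1 ex[OF w] by (intro exI[of _ \<gamma>] exI[of _ "[]"]) (simp add: acts_at_def)
    next
      fix n :: nat and s2 :: store assume I: "\<exists>\<gamma>1 \<gamma>2. \<gamma> = \<gamma>1 @ \<gamma>2 \<and> s2 WALK 0 = last_tag \<gamma>1 \<and> acts_at s2 (map fst \<gamma>2) \<and>
          n = 5 * length \<gamma>1" and sm: "same (writes walk_body) ?s s2"
        and test: "eval_test (Less (Const 0) (reg WALK)) s2"
      from sm have old2: "\<And>x. x \<notin> {VIDX, ACT, WALK} \<Longrightarrow> s2 x = s x"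
        by (simp add: walk_body_def same_def old)
      from I obtain \<gamma>1 \<gamma>2 where g: "\<gamma> = \<gamma>1 @ \<gamma>2" "s2 WALK 0 = last_tag \<gamma>1" "acts_at s2 (map fst \<gamma>2)"
        "n = 5 * length \<gamma>1" by blast
      with test obtain \<gamma>' l p where g1: "\<gamma>1 = \<gamma>' @ [(l, p)]"
        by (cases \<gamma>1 rule: rev_cases) auto
      have "walk G a (\<gamma>' @ (l, p) # \<gamma>2) (s CUR 0)" and bw: "\<gamma>' \<in> bracket_words" "l \<in> bracket_syms"
        using w g g1 by (auto simp: bwalk_def)
      then obtain c d where e: "walk G a \<gamma>' p" "(p, Some l, c, d) \<in> G" by (auto elim: walk_splitE)
      then have tg: "s TAG p = last_tag \<gamma>'" using ex[of \<gamma>' p] bw by (simp add: bwalk_def)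
      have st: "s2 KIND p = kind_code (Some l)" "s2 LABEL p = symbol_arg (Some l)"
        using b e(2) by (auto simp: old2)
      from bw(2) obtain x where x: "l = Op x \<or> l = Cl x" by (auto simp: bracket_syms_def)
      then have xv: "x \<in> set vs" using bracket_symbols[OF e(2)] by auto
      have wp: "s2 WALK 0 = p" using g(2) g1 by simp
      have ax: "s2 ACT x = action_code (act (map fst \<gamma>2) x)" using g(3) xv by (simp add: acts_at_def)
      define g2 where "g2 = map fst \<gamma>2"
      define y where "y = action_code (act (l # g2) x)"
      have "run walk_body s2 (\<lambda>t s'. t \<le> 4 \<and> s' WALK 0 = last_tag \<gamma>' \<and> s' ACT = (s2 ACT)(x := y))"
        using x
      proof
        assume "l = Op x"
        then show ?thesis using st wp ax tg unfolding y_def g2_def[symmetric]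
          by (cases "act g2 x") (auto simp: walk_body_def old2)
      next
        assume "l = Cl x"
        then show ?thesis using st wp ax tg unfolding y_def g2_def[symmetric]
          by (cases "act g2 x") (auto simp: walk_body_def old2)
      qed
      then show "run walk_body s2 (\<lambda>t s'. \<exists>m. (\<exists>\<gamma>1 \<gamma>2. \<gamma> = \<gamma>1 @ \<gamma>2 \<and> s' WALK 0 = last_tag \<gamma>1 \<and>
          acts_at s' (map fst \<gamma>2) \<and> m = 5 * length \<gamma>1) \<and> t + m < n)"
      proof (rule run_mono)
        fix t :: nat and s' :: store assume r: "t \<le> 4 \<and> s' WALK 0 = last_tag \<gamma>' \<and> s' ACT = (s2 ACT)(x := y)"
        have "act (l # g2) z = act g2 z" if "z \<noteq> x" for z using that x by auto
        then have "acts_at s' (l # g2)"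
          using r g(3) unfolding acts_at_def g2_def[symmetric] y_def by auto
        then show "\<exists>m. (\<exists>\<gamma>1 \<gamma>2. \<gamma> = \<gamma>1 @ \<gamma>2 \<and> s' WALK 0 = last_tag \<gamma>1 \<and>
          acts_at s' (map fst \<gamma>2) \<and> m = 5 * length \<gamma>1) \<and> t + m < n"
          using r g(1,4) g1 by (intro exI[of _ "5 * length \<gamma>'"] conjI exI[of _ \<gamma>'] exI[of _ "(l, p) # \<gamma>2"])
            (auto simp: g2_def)
      qed
    next
      fix t m :: nat and s2 :: store
      assume I: "\<exists>\<gamma>1 \<gamma>2. \<gamma> = \<gamma>1 @ \<gamma>2 \<and> s2 WALK 0 = last_tag \<gamma>1 \<and> acts_at s2 (map fst \<gamma>2) \<and>
          m = 5 * length \<gamma>1" and test: "\<not> eval_test (Less (Const 0) (reg WALK)) s2"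
        and t: "t \<le> Suc (5 * length \<gamma>)"
      then obtain \<gamma>1 \<gamma>2 where g: "\<gamma> = \<gamma>1 @ \<gamma>2" "last_tag \<gamma>1 = 0" "acts_at s2 (map fst \<gamma>2)" by auto
      \<comment> \<open>Tag 0 is never the node of a bracket, so the loop stops only when the whole
        word has been consumed.\<close>
      have "\<gamma>1 = []"
      proof (cases \<gamma>1 rule: rev_cases)
        case (snoc \<gamma>' x)
        obtain l p where x: "x = (l, p)" by (cases x)
        with snoc w g(1) obtain c d where "(p, Some l, c, d) \<in> G"
          unfolding bwalk_def by (auto elim: walk_splitE)
        then have "p \<noteq> 0" by (rule symbol_pos)
        with g(2) snoc x show ?thesis by simp
      qed
      with g a1 t bwalk_length[OF un w] show "acts_at s2 (map fst \<gamma>) \<and> t1 + Suc t \<le> 3 * k + 5 * nodes + 4"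
        by simp
    qed
    then show "run (Seq (put_reg WALK (Get TAG (reg CUR))) (While (Less (Const 0) (reg WALK)) walk_body)) s1
        (\<lambda>t2 s'. acts_at s' (map fst \<gamma>) \<and> t1 + t2 \<le> 3 * k + 5 * nodes + 4)"
      by (simp add: old)
  qed
qed

end

section \<open>Processing all sources\<close>

abbreviation (input) SIDX :: nat where "SIDX \<equiv> 36"

text \<open>Stamps start at 1, above the initial contents of \<open>VIS\<close> and
  \<open>SEEN\<close>. Once \<open>OK\<close> is 0, nothing more is emitted.\<close>

definition source_body :: prog where
  "source_body = Seq (put_reg STAMP (plus1 (reg SIDX))) (Seq (put_reg SOURCE (Get SRC (plus1 (reg SIDX))))
     (Seq explore (Seq check (Cond (Equal (reg OK) (Const 0)) Skip emit_all))))"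

definition sources :: prog where
  "sources = Seq (put_reg OK (Const 1)) (for_upto SIDX (reg SRC) source_body)"

lemma writes_source_body: "writes source_body = {STAMP, SOURCE, HEAD, CUR, CTAG, NODE, OK, VIS, TAG, QUEUE,
    SEEN, TERMS, REFS, IDX, VIDX, ACT, WALK, TRANS, COUNT, FINALS}"
  by (auto simp: source_body_def writes_explore writes_check writes_emit_all)

lemma writes_sources: "writes sources = insert SIDX (writes source_body)"
  by (auto simp: sources_def writes_source_body)

lemma run_PutI: "run c (s(a := (s a)(eval_exp e1 s := eval_exp e2 s))) (\<lambda>t. Q (Suc t)) \<Longrightarrow>
    run (Seq (Put a e1 e2) c) s Q"
  by simp

lemma action_code_eq_2: "action_code d = 2 \<longleftrightarrow> d = AReset"
  by (cases d) auto

lemma concat_transition_length: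
  "\<forall>t\<in>set ts. length (transition_code t) = m \<Longrightarrow> length (concat (map transition_code ts)) = length ts * m"
  by (induction ts) auto

context regex_graph
begin

lemma stored_same: "\<forall>n\<in>G. stored s n \<Longrightarrow> same X s s' \<Longrightarrow> X \<inter> {KIND, LABEL, NEXT1, NEXT2} = {} \<Longrightarrow>
    \<forall>n\<in>G. stored s' n"
proof
  fix n assume a: "\<forall>n\<in>G. stored s n" "same X s s'" "X \<inter> {KIND, LABEL, NEXT1, NEXT2} = {}" "n \<in> G"
  then have "s' KIND = s KIND" "s' LABEL = s LABEL" "s' NEXT1 = s NEXT1" "s' NEXT2 = s NEXT2"
    by (auto simp: same_def)
  with a show "stored s' n" by (cases n) auto
qed

lemma run_put_label:
  assumes b: "\<forall>n\<in>G. stored s n" and m: "s MEM = mem_index vs" and l: "letter (s CUR 0) l"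
    and act: "acts_at s g" and t: "trans vs l g = (b, ss)"
  shows "run put_label s (\<lambda>t s'. arr (s' TRANS) = arr (s TRANS) @ label_code b \<and>
    map (s' ACT) vs = map action_code ss \<and> t \<le> 7)"
proof -
  from l have "s CUR 0 \<in> Domain G" by (auto simp: letter_def)
  note sl = stored_letter[OF b this]
  from letter_symbols[OF l] show ?thesis
  proof (elim disjE bexE)
    fix c assume c: "l = Tm c"
    with l sl have "s KIND (s CUR 0) = 3" "s LABEL (s CUR 0) = c" by auto
    with c t act show ?thesis by (auto simp: put_label_def acts_at_def)
  next
    fix x assume x: "x \<in> set vs" "l = Vr x"
    with l sl have k: "s KIND (s CUR 0) = 4" "s LABEL (s CUR 0) = x" by auto
    have a: "s ACT x = 2 \<longleftrightarrow> act g x = AReset" using act x(1) by (simp add: acts_at_def action_code_eq_2)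
    show ?thesis
    proof (cases "act g x = AReset")
      case True
      with a k x t act show ?thesis by (auto simp: put_label_def acts_at_def)
    next
      case False
      with a k x t act m show ?thesis by (auto simp: put_label_def acts_at_def)
    qed
  qed
qed

lemma run_emit:
  assumes b: "\<forall>n\<in>G. stored s n" and v: "arr (s VARS) = vs" and m: "s MEM = mem_index vs"
    and ex: "\<And>\<gamma> q. bwalk a \<gamma> q \<Longrightarrow> s TAG q = last_tag \<gamma>" and un: "\<not> ambiguous a"
    and w: "bwalk a \<gamma> (s CUR 0)" and l: "letter (s CUR 0) l"
    and t: "trans vs l (map fst \<gamma>) = (b, ss)"
  shows "run emit s (\<lambda>t s'.
    arr (s' TRANS) = arr (s TRANS) @ transition_code (s SOURCE 0, b, s CUR 0, ss) \<and>
    s' COUNT 0 = Suc (s COUNT 0) \<and> t \<le> 7 * k + 5 * nodes + 18)"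
  unfolding emit_def
proof (rule run_SeqI[OF run_same[OF run_actions[OF b v ex un w]]], assumption)
  fix t1 :: nat and s1 :: store
  assume a1: "(acts_at s1 (map fst \<gamma>) \<and> t1 \<le> 3 * k + 5 * nodes + 4) \<and> same (writes actions) s s1"
  then have old: "\<And>x. x \<notin> {VIDX, ACT, WALK} \<Longrightarrow> s1 x = s x" by (simp add: writes_actions same_def)
  define s2 where "s2 = pushed s1 TRANS (s SOURCE 0)"
  have b2: "\<forall>n\<in>G. stored s2 n"
    by (rule stored_same[OF b, of "{VIDX, ACT, WALK, TRANS}"]) (auto simp: same_def s2_def old)
  have pl: "run put_label s2 (\<lambda>t s'. (arr (s' TRANS) = arr (s2 TRANS) @ label_code b \<and>
      map (s' ACT) vs = map action_code ss \<and> t \<le> 7) \<and> same (writes put_label) s2 s')"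
  proof (rule run_same[OF run_put_label[OF b2]])
    show "s2 MEM = mem_index vs" "letter (s2 CUR 0) l" using m l by (simp_all add: s2_def old)
    show "acts_at s2 (map fst \<gamma>)" using a1 by (simp add: s2_def acts_at_def)
  qed (rule t)
  have k: "s VARS 0 = k" using v by (metis length_arr)
  have vi: "vs ! i = s VARS (Suc i)" if "i < k" for i
    using arr_nth[of i "s VARS"] that k unfolding v by simp
  have rest: "run (Seq put_label (Seq (push TRANS (reg CUR))
     (Seq (for_upto VIDX (reg VARS) (push TRANS (Get ACT (Get VARS (plus1 (reg VIDX))))))
       (put_reg COUNT (plus1 (reg COUNT)))))) s2
    (\<lambda>t s'. arr (s' TRANS) = arr (s TRANS) @ transition_code (s SOURCE 0, b, s CUR 0, ss) \<and>
    s' COUNT 0 = Suc (s COUNT 0) \<and> t \<le> 12 + 4 * k)"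
  proof (rule run_SeqI[OF pl])
    fix t3 :: nat and s3 :: store
    assume a3: "(arr (s3 TRANS) = arr (s2 TRANS) @ label_code b \<and> map (s3 ACT) vs = map action_code ss \<and> t3 \<le> 7) \<and>
      same (writes put_label) s2 s3"
    then have old3: "\<And>x. x \<notin> {VIDX, ACT, WALK, TRANS} \<Longrightarrow> s3 x = s x"
      by (simp add: put_label_def same_def s2_def old)
    define s4 where "s4 = pushed s3 TRANS (s CUR 0)"
    have fl: "run (for_upto VIDX (reg VARS) (push TRANS (Get ACT (Get VARS (plus1 (reg VIDX)))))) s4
      (\<lambda>t s'. (arr (s' TRANS) = arr (s4 TRANS) @ map action_code ss \<and> t \<le> 2 + 4 * k) \<and>
        same (writes (for_upto VIDX (reg VARS) (push TRANS (Get ACT (Get VARS (plus1 (reg VIDX))))))) s4 s')"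
    proof (rule run_same[OF run_for_upto[where n = k and T = "\<lambda>_. 2" and
          I = "\<lambda>i s'. arr (s' TRANS) = arr (s4 TRANS) @ map (s3 ACT) (take i vs)"]])
      fix i :: nat and s' :: store
      assume i: "i < k" "arr (s' TRANS) = arr (s4 TRANS) @ map (s3 ACT) (take i vs)" "s' VIDX 0 = i"
        and sm: "same (insert VIDX (writes (push TRANS (Get ACT (Get VARS (plus1 (reg VIDX))))))) s4 s'"
      from sm have "s' ACT = s3 ACT" "s' VARS = s VARS" by (simp_all add: same_def s4_def old3)
      with i vi[OF i(1)] show "run (push TRANS (Get ACT (Get VARS (plus1 (reg VIDX))))) s'
          (\<lambda>t s'. arr (s' TRANS) = arr (s4 TRANS) @ map (s3 ACT) (take (Suc i) vs) \<and> t \<le> 2)"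
        by (simp add: take_Suc_conv_app_nth)
    next
      fix s' assume "same (insert VIDX (writes (push TRANS (Get ACT (Get VARS (plus1 (reg VIDX))))))) s4 s'"
      then show "eval_exp (reg VARS) s' = k" using k by (simp add: same_def s4_def old3)
    qed (use a3 in \<open>auto simp: same_def\<close>)
    show "run (Seq (push TRANS (reg CUR))
       (Seq (for_upto VIDX (reg VARS) (push TRANS (Get ACT (Get VARS (plus1 (reg VIDX))))))
         (put_reg COUNT (plus1 (reg COUNT))))) s3
      (\<lambda>t s'. arr (s' TRANS) = arr (s TRANS) @ transition_code (s SOURCE 0, b, s CUR 0, ss) \<and>
        s' COUNT 0 = Suc (s COUNT 0) \<and> t3 + t \<le> 12 + 4 * k)"
    proof (rule run_SeqI[of _ _ "\<lambda>t s'. t = 2 \<and> s' = s4"])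
      show "run (push TRANS (reg CUR)) s3 (\<lambda>t s'. t = 2 \<and> s' = s4)"
        by (simp add: s4_def old3)
      fix t4 :: nat and s' :: store assume s': "t4 = 2 \<and> s' = s4"
      show "run (Seq (for_upto VIDX (reg VARS) (push TRANS (Get ACT (Get VARS (plus1 (reg VIDX))))))
         (put_reg COUNT (plus1 (reg COUNT)))) s'
        (\<lambda>t s'. arr (s' TRANS) = arr (s TRANS) @ transition_code (s SOURCE 0, b, s CUR 0, ss) \<and>
          s' COUNT 0 = Suc (s COUNT 0) \<and> t3 + (t4 + t) \<le> 12 + 4 * k)"
        unfolding conjunct2[OF s']
        by (rule run_SeqI[OF fl]) (use a3 s' in \<open>auto simp: same_def s4_def old3 s2_def old\<close>)
    qed
  qed
  show "run (Seq (push TRANS (reg SOURCE)) (Seq put_label (Seq (push TRANS (reg CUR))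
     (Seq (for_upto VIDX (reg VARS) (push TRANS (Get ACT (Get VARS (plus1 (reg VIDX))))))
       (put_reg COUNT (plus1 (reg COUNT))))))) s1 (\<lambda>t2 s'.
    arr (s' TRANS) = arr (s TRANS) @ transition_code (s SOURCE 0, b, s CUR 0, ss) \<and>
    s' COUNT 0 = Suc (s COUNT 0) \<and> t1 + t2 \<le> 7 * k + 5 * nodes + 18)"
  proof (rule run_SeqI[of _ _ "\<lambda>t s'. t = 2 \<and> s' = s2"])
    show "run (push TRANS (reg SOURCE)) s1 (\<lambda>t s'. t = 2 \<and> s' = s2)" by (simp add: s2_def old)
    fix t2 :: nat and s' :: store assume s': "t2 = 2 \<and> s' = s2"
    show "run (Seq put_label (Seq (push TRANS (reg CUR))
     (Seq (for_upto VIDX (reg VARS) (push TRANS (Get ACT (Get VARS (plus1 (reg VIDX))))))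
       (put_reg COUNT (plus1 (reg COUNT)))))) s' (\<lambda>t3 s'.
      arr (s' TRANS) = arr (s TRANS) @ transition_code (s SOURCE 0, b, s CUR 0, ss) \<and>
      s' COUNT 0 = Suc (s COUNT 0) \<and> t1 + (t2 + t3) \<le> 7 * k + 5 * nodes + 18)"
      unfolding conjunct2[OF s'] by (rule run_mono[OF rest]) (use a1 s' in auto)
  qed
qed

definition out_edges :: "nat \<Rightarrow> nat set \<Rightarrow> (nat \<times> nat label \<times> nat \<times> action list) set" where
  "out_edges s X = {(s', b, q, ss). s' = s \<and> q \<in> X \<and> (q, ss) \<in> core_delta s b}"

text \<open>The number of transitions is recorded as a number of letters, so that
  \<open>letters_card\<close> can bound it by |\<Sigma>|.\<close>

definition emitted :: "store \<Rightarrow> nat \<Rightarrow> nat set \<Rightarrow> store \<Rightarrow> bool" where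
  "emitted s0 s X s' \<longleftrightarrow> (\<exists>ts. arr (s' TRANS) = arr (s0 TRANS) @ concat (map transition_code ts) \<and>
     s' COUNT 0 = s0 COUNT 0 + length ts \<and> distinct ts \<and> set ts = out_edges s X \<and>
     length ts = card {q\<in>X. \<exists>l. letter q l}) \<and>
     arr (s' FINALS) = arr (s0 FINALS) @ (if F \<in> X then [s] else [])"

lemma run_emit_body:
  assumes b: "\<forall>n\<in>G. stored s n" and v: "arr (s VARS) = vs" and m: "s MEM = mem_index vs"
    and L: "s LIMIT 0 = K" and src: "source (s SOURCE 0) a"
    and ex: "\<And>\<gamma> q. bwalk a \<gamma> q \<Longrightarrow> s TAG q = last_tag \<gamma>" and un: "\<not> ambiguous a"
    and q: "s QUEUE (Suc (s IDX 0)) = q" "q \<notin> X" "finite X" and w: "bwalk a \<gamma> q"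
    and em: "emitted s0 (s SOURCE 0) X s"
  shows "run emit_body s (\<lambda>t s'. emitted s0 (s SOURCE 0) (insert q X) s' \<and>
    t \<le> 6 + (if \<exists>l. letter q l then 7 * k + 5 * nodes + 18 else 0))"
proof -
  let ?u = "s SOURCE 0"
  from em obtain ts where ts: "arr (s TRANS) = arr (s0 TRANS) @ concat (map transition_code ts)"
    "s COUNT 0 = s0 COUNT 0 + length ts" "distinct ts" "set ts = out_edges ?u X"
    "length ts = card {q\<in>X. \<exists>l. letter q l}" and
    fin: "arr (s FINALS) = arr (s0 FINALS) @ (if F \<in> X then [?u] else [])"
    unfolding emitted_def by blast
  \<comment> \<open>Unambiguity leaves a single bracket word to \<open>q\<close>, so a letter
    contributes exactly one transition.\<close>
  have uniq: "\<gamma>' = \<gamma> \<and> a' = a" if "source ?u a'" "bwalk a' \<gamma>' q" for a' \<gamma>'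
    using that source_unique[OF src that(1)] w un unfolding ambiguous_def by blast
  have edges: "out_edges ?u (insert q X) = out_edges ?u X \<union>
      {(?u, b, q, ss) | b ss l. letter q l \<and> trans vs l (map fst \<gamma>) = (b, ss)}"
    unfolding out_edges_def core_delta_def using uniq src w by blast
  show ?thesis
  proof (cases "\<exists>l. letter q l")
    case True
    then obtain l where l: "letter q l" by blast
    have qD: "q \<in> Domain G" using l by (auto simp: letter_def)
    have kind: "2 < s KIND q" using stored_letter[OF b qD] l by blast
    have qF: "q \<noteq> F" using letter_ge[OF l] by simp
    obtain b' ss where t: "trans vs l (map fst \<gamma>) = (b', ss)" by fastforce
    let ?s = "s(CUR := (s CUR)(0 := q))"
    have b2: "\<forall>n\<in>G. stored ?s n" by (rule stored_same[OF b, of "{CUR}"]) (auto simp: same_def)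
    have one: "out_edges ?u (insert q X) = insert (?u, b', q, ss) (out_edges ?u X)"
    proof -
      have "letter q l' \<longleftrightarrow> l' = l" for l' using l letter_unique by blast
      then show ?thesis unfolding edges using t by auto
    qed
    have new: "(?u, b', q, ss) \<notin> out_edges ?u X" using q(2) by (simp add: out_edges_def)
    have "{q'\<in>insert q X. \<exists>l. letter q' l} = insert q {q\<in>X. \<exists>l. letter q l}" using l by auto
    then have cd: "card {q'\<in>insert q X. \<exists>l. letter q' l} = Suc (length ts)" using ts(5) q(2,3) by simp
    have "run emit ?s (\<lambda>t s'. (arr (s' TRANS) = arr (?s TRANS) @ transition_code (?s SOURCE 0, b', ?s CUR 0, ss) \<and>
      s' COUNT 0 = Suc (?s COUNT 0) \<and> t \<le> 7 * k + 5 * nodes + 18) \<and> same (writes emit) ?s s')"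
      by (rule run_same[OF run_emit[OF b2 _ _ _ un _ _ t]]) (use v m ex w l in simp_all)
    then have "run emit ?s (\<lambda>t s'. emitted s0 ?u (insert q X) s' \<and> t \<le> 7 * k + 5 * nodes + 18)"
    proof (rule run_mono)
      fix t :: nat and s' :: store
      assume a: "(arr (s' TRANS) = arr (?s TRANS) @ transition_code (?s SOURCE 0, b', ?s CUR 0, ss) \<and>
        s' COUNT 0 = Suc (?s COUNT 0) \<and> t \<le> 7 * k + 5 * nodes + 18) \<and> same (writes emit) ?s s'"
      then have "s' FINALS = s FINALS" by (simp add: writes_emit same_def)
      then have "arr (s' FINALS) = arr (s0 FINALS) @ (if F \<in> insert q X then [?u] else [])"
        using fin qF by auto
      moreover have "arr (s' TRANS) = arr (s0 TRANS) @ concat (map transition_code (ts @ [(?u, b', q, ss)]))"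
        using a ts(1) by simp
      moreover have "distinct (ts @ [(?u, b', q, ss)])"
        "set (ts @ [(?u, b', q, ss)]) = out_edges ?u (insert q X)"
        using ts(3,4) new one by auto
      ultimately show "emitted s0 ?u (insert q X) s' \<and> t \<le> 7 * k + 5 * nodes + 18"
        unfolding emitted_def using a ts(2) cd
        by (intro conjI exI[of _ "ts @ [(?u, b', q, ss)]"]) simp_all
    qed
    then show ?thesis
      using True kind qF q(1) L by (simp add: emit_body_def F_def) (erule run_mono, simp)
  next
    case False
    then have same: "out_edges ?u (insert q X) = out_edges ?u X" unfolding edges by blast
    have eq: "{q'\<in>insert q X. \<exists>l. letter q' l} = {q\<in>X. \<exists>l. letter q l}" using False by auto
    have "q \<in> Domain G"
    proof -
      have "a \<in> Domain G" using src p0_Domain G_closed unfolding source_def by blast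
      with w show ?thesis using walk_Domain unfolding bwalk_def by blast
    qed
    from stored_letter[OF b this] False have kind: "\<not> 2 < s KIND q" by blast
    show ?thesis
    proof (cases "q = F")
      case True
      with q(2) have "F \<notin> X" by simp
      then have "emitted s0 ?u (insert q X) (pushed (s(CUR := (s CUR)(0 := q))) FINALS ?u)"
        unfolding emitted_def same eq using True fin ts by (intro conjI exI[of _ ts]) simp_all
      moreover have "s LIMIT 0 + s LIMIT 0 = q" using L True by (simp add: F_def)
      ultimately show ?thesis
        using kind q(1) \<open>\<not> (\<exists>l. letter q l)\<close> by (simp add: emit_body_def)
    next
      case False
      then have "emitted s0 ?u (insert q X) (s(CUR := (s CUR)(0 := q)))"
        using em unfolding emitted_def same eq by auto
      with False kind q(1) L \<open>\<not> (\<exists>l. letter q l)\<close> show ?thesis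
        by (simp add: emit_body_def F_def[symmetric])
    qed
  qed
qed

lemma sum_letter_cost:
  assumes "distinct Q"
  shows "(\<Sum>i<length Q. (if \<exists>l. letter (Q ! i) l then B else 0)) = card {q\<in>set Q. \<exists>l. letter q l} * (B :: nat)"
proof -
  have "(\<Sum>i<length Q. (if \<exists>l. letter (Q ! i) l then B else 0)) =
      (\<Sum>q\<in>set Q. (if \<exists>l. letter q l then B else 0))"
    using sum.reindex_bij_betw[OF bij_betw_nth[OF assms refl refl], of "\<lambda>q. if \<exists>l. letter q l then B else 0"] .
  also have "\<dots> = card {q\<in>set Q. \<exists>l. letter q l} * B"
    by (simp add: sum.If_cases Int_def)
  finally show ?thesis .
qed

text \<open>Every node in the queue costs a constant, and only the letters among them, at most
  |\<Sigma>|, incur the cost of a transition.\<close>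

lemma run_emit_all:
  assumes b: "built s" and src: "source (s SOURCE 0) a" and ex: "explored a ok s" "0 < s OK 0"
    and cl: "\<not> clashes (set (arr (s QUEUE)))" and A: "A \<noteq> {}"
  shows "run emit_all s (\<lambda>t s'. emitted s (s SOURCE 0) (set (arr (s QUEUE))) s' \<and>
    t \<le> 2 + 8 * nodes + card A * (7 * k + 5 * nodes + 18))"
  unfolding emit_all_def
proof (rule run_for_upto[where n = "s QUEUE 0" and
      T = "\<lambda>i. 6 + (if \<exists>l. letter (arr (s QUEUE) ! i) l then 7 * k + 5 * nodes + 18 else 0)" and
      I = "\<lambda>i s'. emitted s (s SOURCE 0) (set (take i (arr (s QUEUE)))) s'"])
  let ?Q = "arr (s QUEUE)"
  have un: "\<not> ambiguous a" using explored_unambiguous[OF ex] .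
  have d: "distinct ?Q" "set ?Q \<subseteq> Domain G" using ex unfolding explored_def by auto
  show "emitted s (s SOURCE 0) (set (take 0 ?Q)) s"
    by (auto simp: emitted_def out_edges_def)
  show "emitted s (s SOURCE 0) (set (take i ?Q)) s2"
    if "emitted s (s SOURCE 0) (set (take i ?Q)) s1" "same {IDX} s1 s2" for i s1 s2
    using that unfolding emitted_def by (simp add: same_def)
  fix i :: nat and s' :: store
  assume i: "i < s QUEUE 0" "emitted s (s SOURCE 0) (set (take i ?Q)) s'" "s' IDX 0 = i"
    and sm: "same (insert IDX (writes emit_body)) s s'"
  have old: "\<And>x. x \<notin> {CUR, VIDX, ACT, WALK, TRANS, COUNT, FINALS, IDX} \<Longrightarrow> s' x = s x"
    using sm by (simp add: writes_emit_body same_def)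
  have qi: "?Q ! i = s QUEUE (Suc i)" using i by (simp add: arr_nth)
  have tk: "set (take (Suc i) ?Q) = insert (?Q ! i) (set (take i ?Q))"
    using i by (simp add: take_Suc_conv_app_nth)
  have "distinct (take (Suc i) ?Q)" using d(1) by simp
  then have new: "?Q ! i \<notin> set (take i ?Q)" using i by (simp add: take_Suc_conv_app_nth)
  have "?Q ! i \<in> set ?Q" using i by simp
  then obtain \<gamma> where w: "bwalk a \<gamma> (?Q ! i)" using ex unfolding explored_def tagged_def by blast
  have b': "\<forall>n\<in>G. stored s' n"
    by (rule stored_same[OF _ sm]) (use b in \<open>auto simp: built_def writes_emit_body\<close>)
  have "run emit_body s' (\<lambda>t s''. emitted s (s' SOURCE 0) (insert (?Q ! i) (set (take i ?Q))) s'' \<and>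
    t \<le> 6 + (if \<exists>l. letter (?Q ! i) l then 7 * k + 5 * nodes + 18 else 0))"
  proof (rule run_emit_body[OF b' _ _ _ _ _ un _ new _ w])
    show "arr (s' VARS) = vs" "s' MEM = mem_index vs" "s' LIMIT 0 = K" "source (s' SOURCE 0) a"
      "s' QUEUE (Suc (s' IDX 0)) = ?Q ! i" "emitted s (s' SOURCE 0) (set (take i ?Q)) s'"
      using b src qi i by (simp_all add: built_def old)
    show "s' TAG q = last_tag \<gamma>" if "bwalk a \<gamma> q" for \<gamma> q
      using ex that unfolding explored_def by (simp add: old)
  qed simp
  then show "run emit_body s' (\<lambda>t s''. emitted s (s SOURCE 0) (set (take (Suc i) ?Q)) s'' \<and>
    t \<le> 6 + (if \<exists>l. letter (?Q ! i) l then 7 * k + 5 * nodes + 18 else 0))"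
    unfolding tk by (simp add: old)
next
  let ?Q = "arr (s QUEUE)" and ?B = "7 * k + 5 * nodes + 18"
  have d: "distinct ?Q" "set ?Q \<subseteq> Domain G" using ex unfolding explored_def by auto
  fix t :: nat and s' :: store
  assume e: "emitted s (s SOURCE 0) (set (take (s QUEUE 0) ?Q)) s'" and
    t: "t \<le> 2 + (\<Sum>i<s QUEUE 0. 6 + (if \<exists>l. letter (?Q ! i) l then ?B else 0) + 2)"
  have "s QUEUE 0 \<le> nodes"
    using card_mono[OF card_Domain(1) d(2)] distinct_card[OF d(1)] card_Domain(2) by simp
  have "(\<Sum>i<s QUEUE 0. 6 + (if \<exists>l. letter (?Q ! i) l then ?B else 0) + 2) =
      8 * s QUEUE 0 + (\<Sum>i<length ?Q. (if \<exists>l. letter (?Q ! i) l then ?B else 0))"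
    by (simp add: sum.distrib)
  also have "\<dots> = 8 * s QUEUE 0 + card {q\<in>set ?Q. \<exists>l. letter q l} * ?B"
    unfolding sum_letter_cost[OF d(1)] ..
  also have "\<dots> \<le> 8 * nodes + card A * ?B"
    using \<open>s QUEUE 0 \<le> nodes\<close> letters_card[OF cl _ A] by (intro add_mono mult_right_mono) auto
  finally have "t \<le> 2 + 8 * nodes + card A * ?B" using t by simp
  moreover have "take (s QUEUE 0) ?Q = ?Q" by simp
  ultimately show "emitted s (s SOURCE 0) (set ?Q) s' \<and> t \<le> 2 + 8 * nodes + card A * ?B"
    using e by simp
qed (auto simp: same_def writes_emit_body)

definition good :: "nat \<Rightarrow> bool" where
  "good s \<longleftrightarrow> (\<forall>a. source s a \<longrightarrow> \<not> ambiguous a \<and> \<not> conflicting a)"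

definition listed :: "nat list \<Rightarrow> store \<Rightarrow> bool" where
  "listed ss s' \<longleftrightarrow> (\<exists>ts. arr (s' TRANS) = concat (map transition_code ts) \<and> s' COUNT 0 = length ts \<and>
     distinct ts \<and> set ts = (\<Union>s\<in>set ss. out_edges s UNIV) \<and> length ts \<le> length ss * card A) \<and>
     arr (s' FINALS) = filter (\<lambda>s. s \<in> final automaton) ss"

definition sources_inv :: "nat list \<Rightarrow> nat \<Rightarrow> store \<Rightarrow> bool" where
  "sources_inv ss i s \<longleftrightarrow> (\<forall>y. s VIS y \<le> i) \<and> (\<forall>y. s SEEN y \<le> i) \<and>
     s OK 0 = (if \<forall>x\<in>set ss. good x then 1 else 0) \<and> (s OK 0 = 1 \<longrightarrow> listed ss s)"

text \<open>The coefficient 36 covers searching (18), checking (9) and scanning the queue for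
  letters (8); the product is the cost of writing the transitions.\<close>

definition source_cost :: nat where
  "source_cost = 36 * nodes + card A * (7 * k + 5 * nodes + 18) + 19"

lemma run_source_body:
  assumes b: "built s" and A: "A \<noteq> {}" and u: "s SRC (Suc (s SIDX 0)) = u" and src: "source u a"
    and new: "u \<notin> set ss" and inv: "sources_inv ss (s SIDX 0) s"
  shows "run source_body s (\<lambda>t s'. sources_inv (ss @ [u]) (Suc (s SIDX 0)) s' \<and> t \<le> source_cost)"
proof -
  let ?st = "Suc (s SIDX 0)" and ?ok = "s OK 0"
  let ?s = "s(STAMP := (s STAMP)(0 := ?st), SOURCE := (s SOURCE)(0 := u))"
  have bs: "\<forall>n\<in>G. stored ?s n"
    by (rule stored_same[of s "{STAMP, SOURCE}"]) (use b in \<open>auto simp: built_def same_def\<close>)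
  have ok: "?ok = (if \<forall>x\<in>set ss. good x then 1 else 0)" using inv by (simp add: sources_inv_def)
  have gd: "good u \<longleftrightarrow> \<not> ambiguous a \<and> \<not> conflicting a"
    unfolding good_def using src source_unique by blast
  have "run (Seq explore (Seq check (Cond (Equal (reg OK) (Const 0)) Skip emit_all))) ?s
    (\<lambda>t s'. sources_inv (ss @ [u]) ?st s' \<and> 2 + t \<le> source_cost)"
  proof (rule run_SeqI[OF run_same[OF run_explore[OF bs]]])
    show "source (?s SOURCE 0) a" "?s STAMP 0 = ?st" "?s OK 0 = ?ok" using src by simp_all
    show "\<forall>y. ?s VIS y < ?st" using inv by (simp add: sources_inv_def less_Suc_eq_le)
    fix t1 :: nat and s1 :: store
    assume a1: "(explored a ?ok s1 \<and> (\<forall>y. s1 VIS y \<le> ?st) \<and> t1 \<le> 18 * nodes + 10) \<and> same (writes explore) ?s s1"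
    then have old1: "\<And>x. x \<notin> {HEAD, CUR, CTAG, NODE, OK, VIS, TAG, QUEUE} \<Longrightarrow> s1 x = ?s x"
      by (simp add: writes_explore same_def)
    have b1: "\<forall>n\<in>G. stored s1 n"
      by (rule stored_same[OF bs]) (use a1 in \<open>auto simp: writes_explore\<close>)
    have d: "distinct (arr (s1 QUEUE))" "set (arr (s1 QUEUE)) \<subseteq> Domain G"
      using a1 unfolding explored_def by auto
    have qn: "s1 QUEUE 0 \<le> nodes"
      using card_mono[OF card_Domain(1) d(2)] distinct_card[OF d(1)] card_Domain(2) by simp
    show "run (Seq check (Cond (Equal (reg OK) (Const 0)) Skip emit_all)) s1
      (\<lambda>t2 s'. sources_inv (ss @ [u]) ?st s' \<and> 2 + (t1 + t2) \<le> source_cost)"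
    proof (rule run_SeqI[OF run_same[OF run_check[OF b1 d]]])
      show "s1 STAMP 0 = ?st" by (simp add: old1)
      show "\<forall>c. s1 SEEN c < ?st" using inv by (simp add: sources_inv_def less_Suc_eq_le old1)
      fix t2 :: nat and s2 :: store
      assume a2: "(s2 OK 0 = (if clashes (set (arr (s1 QUEUE))) then 0 else s1 OK 0) \<and>
          (\<forall>c. s2 SEEN c \<le> ?st) \<and> t2 \<le> 9 * s1 QUEUE 0 + 4) \<and> same (writes check) s1 s2"
      then have old2: "\<And>x. x \<notin> {CUR, OK, SEEN, TERMS, REFS, IDX} \<Longrightarrow> s2 x = s1 x"
        by (simp add: writes_check same_def)
      have ex: "explored a ?ok s1" using a1 by blast
      have le: "s1 OK 0 \<le> ?ok" "s1 OK 0 < ?ok \<longrightarrow> ambiguous a" using ex unfolding explored_def by auto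
      \<comment> \<open>The search lowers the flag only for an ambiguous source. If it stays
        positive the tags are exact, so the source is unambiguous and the clashes found are
        precisely its conflicts.\<close>
      have ok2: "s2 OK 0 = (if \<forall>x\<in>set (ss @ [u]). good x then 1 else 0)"
      proof (cases "0 < s1 OK 0")
        case True
        with le ok have 1: "s1 OK 0 = 1" "\<forall>x\<in>set ss. good x" by (auto split: if_splits)
        moreover have "\<not> ambiguous a" using explored_unambiguous[OF ex True] .
        ultimately show ?thesis using a2 explored_conflicting[OF ex True] gd by simp
      next
        case False
        then have "s2 OK 0 = 0" using a2 by simp
        moreover have "\<not> (\<forall>x\<in>set (ss @ [u]). good x)"
        proof (cases "?ok = 0")
          case True
          with ok show ?thesis by (auto split: if_splits)
        next
          case F: False
          with False le have "ambiguous a" by simp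
          with gd show ?thesis by simp
        qed
        ultimately show ?thesis by simp
      qed
      have time: "t1 + t2 \<le> 28 * nodes + 14" using a1 a2 qn by auto
      have vs2: "\<forall>y. s2 VIS y \<le> ?st" "\<forall>y. s2 SEEN y \<le> ?st" using a1 a2 by (simp_all add: old2)
      show "run (Cond (Equal (reg OK) (Const 0)) Skip emit_all) s2
        (\<lambda>t3 s'. sources_inv (ss @ [u]) ?st s' \<and> 2 + (t1 + (t2 + t3)) \<le> source_cost)"
      proof (cases "s2 OK 0 = 0")
        case True
        then show ?thesis using ok2 vs2 time by (simp add: sources_inv_def source_cost_def split: if_splits)
      next
        case False
        with ok2 a2 have s2ok: "s2 OK 0 = 1" "s1 OK 0 = 1" and ncl: "\<not> clashes (set (arr (s2 QUEUE)))"
          by (auto simp: old2 split: if_splits)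
        have "\<forall>x\<in>set (ss @ [u]). good x" using ok2 s2ok(1) by (metis zero_neq_one)
        then have "\<forall>x\<in>set ss. good x" by simp
        then have "?ok = 1" unfolding ok by simp
        with inv have lst: "listed ss s" unfolding sources_inv_def by blast
        have b2: "built s2"
        proof -
          have "\<forall>n\<in>G. stored s2 n" by (rule stored_same[OF b1]) (use a2 in \<open>auto simp: writes_check\<close>)
          then show ?thesis using b by (simp add: built_def old1 old2)
        qed
        have ex2: "explored a ?ok s2" using ex s2ok by (simp add: explored_def old2)
        have "run emit_all s2 (\<lambda>t s'. (emitted s2 (s2 SOURCE 0) (set (arr (s2 QUEUE))) s' \<and>
            t \<le> 2 + 8 * nodes + card A * (7 * k + 5 * nodes + 18)) \<and> same (writes emit_all) s2 s')"
          by (rule run_same[OF run_emit_all[OF b2 _ ex2 _ ncl A]]) (use src s2ok in \<open>simp_all add: old1 old2\<close>)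
        then have "run emit_all s2 (\<lambda>t s'. sources_inv (ss @ [u]) ?st s' \<and> 2 + (t1 + (t2 + Suc t)) \<le> source_cost)"
        proof (rule run_mono)
          fix t3 :: nat and s3 :: store
          assume a3: "(emitted s2 (s2 SOURCE 0) (set (arr (s2 QUEUE))) s3 \<and>
            t3 \<le> 2 + 8 * nodes + card A * (7 * k + 5 * nodes + 18)) \<and> same (writes emit_all) s2 s3"
          then have old3: "\<And>x. x \<notin> {CUR, VIDX, ACT, WALK, TRANS, COUNT, FINALS, IDX} \<Longrightarrow> s3 x = s2 x"
            by (simp add: writes_emit_all same_def)
          have mem: "q \<in> set (arr (s2 QUEUE)) \<longleftrightarrow> (\<exists>\<gamma>. bwalk a \<gamma> q)" for q
            using ex2 s2ok unfolding explored_def tagged_def by auto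
          \<comment> \<open>Targets of transitions are reached by bracket walks, and the search has
            found all of those.\<close>
          have full: "out_edges u (set (arr (s2 QUEUE))) = out_edges u UNIV"
          proof -
            have "q \<in> set (arr (s2 QUEUE))" if "(q, ss) \<in> core_delta u b" for q ss b
            proof -
              from that obtain a' \<gamma> where "source u a'" "bwalk a' \<gamma> q" unfolding core_delta_def by blast
              with source_unique[OF src this(1)] show ?thesis unfolding mem by blast
            qed
            then show ?thesis unfolding out_edges_def by blast
          qed
          have fin: "F \<in> set (arr (s2 QUEUE)) \<longleftrightarrow> u \<in> final automaton"
          proof -
            have "u \<in> final automaton \<longleftrightarrow> (\<exists>a' \<gamma>. source u a' \<and> bwalk a' \<gamma> F)" by (simp add: automaton_def)
            then show ?thesis unfolding mem using src source_unique[OF src] by blast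
          qed
          from lst obtain ts0 where ts0: "arr (s TRANS) = concat (map transition_code ts0)"
            "s COUNT 0 = length ts0" "distinct ts0" "set ts0 = (\<Union>s\<in>set ss. out_edges s UNIV)"
            "length ts0 \<le> length ss * card A" "arr (s FINALS) = filter (\<lambda>s. s \<in> final automaton) ss"
            unfolding listed_def by blast
          have so: "s2 SOURCE 0 = u" "s2 TRANS = s TRANS" "s2 COUNT = s COUNT" "s2 FINALS = s FINALS"
            by (simp_all add: old1 old2)
          from a3 obtain ts where ts: "arr (s3 TRANS) = arr (s TRANS) @ concat (map transition_code ts)"
            "s3 COUNT 0 = s COUNT 0 + length ts" "distinct ts" "set ts = out_edges u UNIV"
            "length ts = card {q\<in>set (arr (s2 QUEUE)). \<exists>l. letter q l}"
            "arr (s3 FINALS) = arr (s FINALS) @ (if u \<in> final automaton then [u] else [])"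
            unfolding emitted_def so full fin by blast
          have "length ts \<le> card A" unfolding ts(5) by (rule letters_card[OF ncl _ A]) simp
          moreover have "out_edges u UNIV \<inter> (\<Union>s\<in>set ss. out_edges s UNIV) = {}"
            using new by (auto simp: out_edges_def)
          ultimately have "listed (ss @ [u]) s3"
            unfolding listed_def using ts ts0 by (intro conjI exI[of _ "ts0 @ ts"]) auto
          moreover have "s3 OK 0 = s2 OK 0" "s3 VIS = s2 VIS" "s3 SEEN = s2 SEEN" by (simp_all add: old3)
          ultimately show "sources_inv (ss @ [u]) ?st s3 \<and> 2 + (t1 + (t2 + Suc t3)) \<le> source_cost"
            using a3 time ok2 vs2 unfolding sources_inv_def source_cost_def by simp
        qed
        with s2ok show ?thesis by simp
      qed
    qed
  qed
  then show ?thesis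
    unfolding source_body_def
    by (intro run_PutI) (use u in \<open>simp del: run_Seq run_Cond\<close>)
qed

lemma run_sources:
  assumes b: "built s" and A: "A \<noteq> {}" and zero: "s VIS = (\<lambda>_. 0)" "s SEEN = (\<lambda>_. 0)" "s TRANS = (\<lambda>_. 0)"
    "s FINALS = (\<lambda>_. 0)" "s COUNT = (\<lambda>_. 0)"
  shows "run sources s (\<lambda>t s'. s' OK 0 = (if deterministic_rx \<alpha> then 1 else 0) \<and>
    (deterministic_rx \<alpha> \<longrightarrow> listed (0 # letters p0 \<alpha>) s') \<and>
    t \<le> 3 + (occurrences \<alpha> + 1) * (source_cost + 2))"
proof -
  let ?S = "0 # letters p0 \<alpha>" and ?s = "s(OK := (s OK)(0 := 1))"
  have S: "arr (s SRC) = ?S" using b by (simp add: built_def)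
  then have n: "s SRC 0 = length ?S" by (metis length_arr)
  have dist: "distinct ?S" using distinct_letters letters_range[of p0 \<alpha>] p0 by auto
  have isrc: "\<exists>a. source x a" if "x \<in> set ?S" for x
    using that set_letters_iff letter_source by (auto simp: source_def)
  have em: "arr (\<lambda>_. 0) = []" by (simp add: arr_def)
  \<comment> \<open>Every source is the initial state or a letter, so testing the listed states
    tests all of them.\<close>
  have det: "deterministic_rx \<alpha> \<longleftrightarrow> (\<forall>x\<in>set ?S. good x)"
  proof -
    have "x \<in> set ?S" if "source x a" for x a
      using source_cases[OF that] set_letters_iff by auto
    then show ?thesis unfolding deterministic_rx_def nondet_iff good_def by blast
  qed
  have loop: "run (for_upto SIDX (reg SRC) source_body) ?s (\<lambda>t s'. s' OK 0 = (if deterministic_rx \<alpha> then 1 else 0) \<and>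
    (deterministic_rx \<alpha> \<longrightarrow> listed ?S s') \<and> t \<le> 2 + (occurrences \<alpha> + 1) * (source_cost + 2))"
  proof (rule run_for_upto[where n = "length ?S" and T = "\<lambda>_. source_cost" and
        I = "\<lambda>i s'. sources_inv (take i ?S) i s'"])
    show "sources_inv (take 0 ?S) 0 ?s"
      using zero em by (auto simp: sources_inv_def listed_def)
    show "sources_inv (take i ?S) i s2" if "sources_inv (take i ?S) i s1" "same {SIDX} s1 s2" for i s1 s2
      using that unfolding sources_inv_def listed_def by (simp add: same_def)
    fix i :: nat and s' :: store
    assume i: "i < length ?S" "sources_inv (take i ?S) i s'" "s' SIDX 0 = i"
      and sm: "same (insert SIDX (writes source_body)) ?s s'"
    have old: "s' x = s x" if "x \<notin> insert SIDX (writes source_body)" for x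
      using sm that by (auto simp: same_def writes_source_body)
    have "\<forall>n\<in>G. stored ?s n"
      by (rule stored_same[of s "{OK}"]) (use b in \<open>auto simp: built_def same_def\<close>)
    then have "\<forall>n\<in>G. stored s' n"
      by (rule stored_same[OF _ sm]) (auto simp: writes_source_body)
    then have b': "built s'" using b by (simp add: built_def old writes_source_body)
    have u: "s' SRC (Suc (s' SIDX 0)) = ?S ! i"
      using arr_nth[of i "s SRC"] i n unfolding S by (simp add: old writes_source_body)
    have "?S ! i \<in> set ?S" using i(1) by (rule nth_mem)
    then obtain a where a: "source (?S ! i) a" using isrc by blast
    have "distinct (take (Suc i) ?S)" using dist by (rule distinct_take)
    then have new: "?S ! i \<notin> set (take i ?S)"
      using i(1) by (simp add: take_Suc_conv_app_nth del: take_Suc_Cons)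
    have "sources_inv (take i ?S) (s' SIDX 0) s'" using i by simp
    from run_source_body[OF b' A u a new this] i(1,3)
    show "run source_body s' (\<lambda>t s'. sources_inv (take (Suc i) ?S) (Suc i) s' \<and> t \<le> source_cost)"
      by (simp add: take_Suc_conv_app_nth del: take_Suc_Cons)
  next
    fix t :: nat and s' :: store
    assume "sources_inv (take (length ?S) ?S) (length ?S) s'" "t \<le> 2 + (\<Sum>i<length ?S. source_cost + 2)"
    then show "s' OK 0 = (if deterministic_rx \<alpha> then 1 else 0) \<and>
      (deterministic_rx \<alpha> \<longrightarrow> listed ?S s') \<and> t \<le> 2 + (occurrences \<alpha> + 1) * (source_cost + 2)"
      using det by (simp add: sources_inv_def length_letters)
  qed (use n in \<open>auto simp: same_def writes_source_body\<close>)
  show ?thesis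
    unfolding sources_def
  proof (rule run_SeqI[of _ _ "\<lambda>t s'. t = 1 \<and> s' = ?s"])
    show "run (put_reg OK (Const 1)) s (\<lambda>t s'. t = 1 \<and> s' = ?s)" by simp
    fix t1 :: nat and s' :: store assume s': "t1 = 1 \<and> s' = ?s"
    show "run (for_upto SIDX (reg SRC) source_body) s' (\<lambda>t2 s'. s' OK 0 = (if deterministic_rx \<alpha> then 1 else 0) \<and>
      (deterministic_rx \<alpha> \<longrightarrow> listed ?S s') \<and> t1 + t2 \<le> 3 + (occurrences \<alpha> + 1) * (source_cost + 2))"
      unfolding conjunct2[OF s'] by (rule run_mono[OF loop]) (use s' in auto)
  qed
qed

end

section \<open>Writing the result\<close>

text \<open>Quantified over all stores that agree with \<open>s0\<close> outside \<open>W\<close>: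
  whatever is read outside \<open>W\<close> keeps its value from \<open>s0\<close>, and pieces of
  output compose without intermediate assertions.\<close>

definition appends :: "nat set \<Rightarrow> store \<Rightarrow> prog \<Rightarrow> nat list \<Rightarrow> nat \<Rightarrow> bool" where
  "appends W s0 c xs T \<longleftrightarrow> (\<forall>s. same W s0 s \<longrightarrow>
     run c s (\<lambda>t s'. arr (s' 1) = arr (s 1) @ xs \<and> t \<le> T \<and> same W s0 s'))"

lemma appends_Seq:
  assumes "appends W s0 c1 xs T" "appends W s0 c2 ys U"
  shows "appends W s0 (Seq c1 c2) (xs @ ys) (T + U)"
  unfolding appends_def
proof (intro allI impI)
  fix s assume "same W s0 s"
  with assms(1) have "run c1 s (\<lambda>t s'. arr (s' 1) = arr (s 1) @ xs \<and> t \<le> T \<and> same W s0 s')"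
    unfolding appends_def by blast
  then show "run (Seq c1 c2) s (\<lambda>t s'. arr (s' 1) = arr (s 1) @ xs @ ys \<and> t \<le> T + U \<and> same W s0 s')"
  proof (rule run_SeqI)
    fix t1 :: nat and s1 :: store
    assume a: "arr (s1 1) = arr (s 1) @ xs \<and> t1 \<le> T \<and> same W s0 s1"
    with assms(2) have "run c2 s1 (\<lambda>t s'. arr (s' 1) = arr (s1 1) @ ys \<and> t \<le> U \<and> same W s0 s')"
      unfolding appends_def by blast
    then show "run c2 s1 (\<lambda>t2 s'. arr (s' 1) = arr (s 1) @ xs @ ys \<and> t1 + t2 \<le> T + U \<and> same W s0 s')"
      by (rule run_mono) (use a in auto)
  qed
qed

lemma appends_push:
  assumes "1 \<in> W" "\<And>s. same W s0 s \<Longrightarrow> eval_exp e s = v"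
  shows "appends W s0 (push 1 e) [v] 2"
  unfolding appends_def
proof (intro allI impI)
  fix s assume s: "same W s0 s"
  have "arr (pushed s 1 v 1) = arr (s 1) @ [v]" by (rule arr_pushed)
  moreover have "same W s0 (pushed s 1 v)" using s assms(1) by (auto simp: same_def pushed_def)
  ultimately show "run (push 1 e) s (\<lambda>t s'. arr (s' 1) = arr (s 1) @ [v] \<and> t \<le> 2 \<and> same W s0 s')"
    unfolding run_push assms(2)[OF s] by blast
qed

text \<open>Within one round the reference store is the current one and \<open>r\<close> is removed
  from \<open>W\<close>, so the body may use the counter as a constant.\<close>

lemma appends_for:
  assumes W: "1 \<in> W" "r \<in> W" "r \<noteq> 1" and w: "writes c \<subseteq> W - {r}"
    and n: "\<And>s. same W s0 s \<Longrightarrow> eval_exp e s = n"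
    and step: "\<And>i s. i < n \<Longrightarrow> same W s0 s \<Longrightarrow> s r 0 = i \<Longrightarrow> appends (W - {r}) s c (f i) T"
  shows "appends W s0 (for_upto r e c) (concat (map f [0..<n])) (2 + n * (T + 2))"
  unfolding appends_def
proof (intro allI impI)
  fix s assume s: "same W s0 s"
  have tr: "same W s0 s'" if "same (insert r (writes c)) s s'" for s'
    using same_mono[OF same_trans[OF s that], of W] w W by blast
  show "run (for_upto r e c) s (\<lambda>t s'. arr (s' 1) = arr (s 1) @ concat (map f [0..<n]) \<and>
      t \<le> 2 + n * (T + 2) \<and> same W s0 s')"
  proof (rule run_for_upto[where n = n and T = "\<lambda>_. T" and
        I = "\<lambda>i s'. arr (s' 1) = arr (s 1) @ concat (map f [0..<i])"])
    fix i :: nat and s' :: store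
    assume i: "i < n" "arr (s' 1) = arr (s 1) @ concat (map f [0..<i])" "s' r 0 = i"
      and sm: "same (insert r (writes c)) s s'"
    have "run c s' (\<lambda>t s''. arr (s'' 1) = arr (s' 1) @ f i \<and> t \<le> T \<and> same (W - {r}) s' s'')"
      using step[OF i(1) tr[OF sm] i(3)] unfolding appends_def by simp
    then show "run c s' (\<lambda>t s'. arr (s' 1) = arr (s 1) @ concat (map f [0..<Suc i]) \<and> t \<le> T)"
      by (rule run_mono) (use i in auto)
  next
    fix t :: nat and s' :: store
    assume "arr (s' 1) = arr (s 1) @ concat (map f [0..<n])" "same (insert r (writes c)) s s'"
      "t \<le> 2 + (\<Sum>i<n. T + 2)"
    then show "arr (s' 1) = arr (s 1) @ concat (map f [0..<n]) \<and> t \<le> 2 + n * (T + 2) \<and> same W s0 s'"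
      using tr by simp
  next
    show "r \<notin> writes c" using w by blast
    show "eval_exp e s' = n" if "same (insert r (writes c)) s s'" for s' using n[OF tr[OF that]] .
    show "arr (s2 1) = arr (s 1) @ concat (map f [0..<i])"
      if "arr (s1 1) = arr (s 1) @ concat (map f [0..<i])" "same {r} s1 s2" for i s1 s2
      using that sameD[OF that(2), of 1] W(3) by simp
  qed simp
qed

definition copy :: "nat \<Rightarrow> exp \<Rightarrow> exp \<Rightarrow> prog" where
  "copy a off n = for_upto IDX n (push 1 (Get a (Add off (reg IDX))))"

abbreviation (input) OUT :: "nat set" where "OUT \<equiv> {1, IDX, VIDX}"

lemma appends_copy:
  assumes "a \<notin> OUT" "\<And>s. same OUT s0 s \<Longrightarrow> eval_exp n s = N" "\<And>s. same OUT s0 s \<Longrightarrow> eval_exp off s = D"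
  shows "appends OUT s0 (copy a off n) (map (\<lambda>i. s0 a (D + i)) [0..<N]) (2 + 4 * N)"
proof -
  have st: "appends (OUT - {IDX}) s (push 1 (Get a (Add off (reg IDX)))) [s0 a (D + i)] 2"
    if "same OUT s0 s" "s IDX 0 = i" for s i
  proof (rule appends_push)
    fix s' assume s': "same (OUT - {IDX}) s s'"
    then have "same OUT s0 s'" using that(1) by (simp add: same_def)
    from assms(3)[OF this] show "eval_exp (Get a (Add off (reg IDX))) s' = s0 a (D + i)"
      using that s' assms(1) by (simp add: same_def)
  qed simp
  have "appends OUT s0 (copy a off n) (concat (map (\<lambda>i. [s0 a (D + i)]) [0..<N])) (2 + N * (2 + 2))"
    unfolding copy_def by (rule appends_for) (use assms(2) st in auto)
  moreover have "concat (map (\<lambda>i. [s0 a (D + i)]) [0..<N]) = map (\<lambda>i. s0 a (D + i)) [0..<N]"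
    by (rule concat_map_singleton)
  moreover have "2 + N * (2 + 2) = 2 + 4 * N" by simp
  ultimately show ?thesis by metis
qed

definition trap_body :: prog where
  "trap_body = Seq (push 1 (Const 1)) (Seq (push 1 (Const 0)) (Seq (push 1 (Get 0 (plus2 (reg IDX))))
     (Seq (push 1 (Const 1)) (for_upto VIDX (reg VARS) (push 1 (Const 3))))))"

text \<open>The leading 1 reports success. The states are the sources followed by the trap 1, and
  the transitions are those counted in \<open>COUNT\<close> plus one loop at the trap for each
  terminal.\<close>

definition write_code :: prog where
  "write_code =
     Seq (push 1 (Const 1)) (Seq (push 1 (plus1 (reg SRC))) (Seq (copy SRC (Const 1) (reg SRC))
     (Seq (push 1 (Const 1)) (Seq (push 1 (Get 0 (Const 1))) (Seq (copy 0 (Const 2) (Get 0 (Const 1)))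
     (Seq (push 1 (reg VARS)) (Seq (push 1 (Const 0)) (Seq (push 1 (reg FINALS))
     (Seq (copy FINALS (Const 1) (reg FINALS)) (Seq (push 1 (Const 1))
     (Seq (push 1 (Add (reg COUNT) (Get 0 (Const 1)))) (Seq (copy TRANS (Const 1) (reg TRANS))
     (for_upto IDX (Get 0 (Const 1)) trap_body)))))))))))))"

definition compile :: prog where
  "compile = Seq build (Seq sources (Cond (Equal (reg OK) (Const 0)) (push 1 (Const 0)) write_code))"

lemma appends_trap_body:
  assumes "s IDX 0 = i" "s 0 (Suc (Suc i)) = a" "s VARS 0 = m"
  shows "appends {1, VIDX} s trap_body ([1] @ [0] @ [a] @ [1] @ replicate m 3) (10 + 4 * m)"
proof -
  let ?W = "{1, VIDX}"
  have l: "appends ?W s (for_upto VIDX (reg VARS) (push 1 (Const 3))) (concat (map (\<lambda>_. [3]) [0..<m])) (2 + m * (2 + 2))"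
    using assms(3) by (intro appends_for appends_push) (auto simp: same_def)
  have r: "concat (map (\<lambda>_. [3 :: nat]) [0..<m]) = replicate m 3"
    by (induction m) (auto simp: replicate_append_same)
  have p: "appends ?W s (push 1 (Const c)) [c] 2" for c by (rule appends_push) auto
  have "appends ?W s (push 1 (Get 0 (plus2 (reg IDX)))) [a] 2"
    using assms by (intro appends_push) (auto simp: same_def)
  note p' = this
  have "appends ?W s trap_body ([1] @ [0] @ [a] @ [1] @ concat (map (\<lambda>_. [3]) [0..<m]))
      (2 + (2 + (2 + (2 + (2 + m * (2 + 2))))))"
    unfolding trap_body_def by (intro appends_Seq p p' l)
  moreover have "2 + (2 + (2 + (2 + (2 + m * (2 + 2))))) = 10 + 4 * m" by simp
  ultimately show ?thesis unfolding r by metis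
qed

lemma arr_eq_map: "arr (s a) = map (\<lambda>i. s a (1 + i)) [0..<s a 0]"
  by (simp add: arr_def)

lemma appends_write_code:
  assumes as: "s 0 1 = length as" "\<And>i. i < length as \<Longrightarrow> s 0 (2 + i) = as ! i"
  shows "appends OUT s write_code
    (1 # Suc (s SRC 0) # arr (s SRC) @ [1] @ block as @ [s VARS 0, 0] @ block (arr (s FINALS)) @ [1] @
      [s COUNT 0 + length as] @ arr (s TRANS) @
      concat (map (\<lambda>a. [1, 0, a, 1] @ replicate (s VARS 0) 3) as))
    (28 + 4 * s SRC 0 + 4 * s FINALS 0 + 4 * s TRANS 0 + length as * (16 + 4 * s VARS 0))"
proof -
  have p: "appends OUT s (push 1 (Const c)) [c] 2" for c by (rule appends_push) auto
  have reg: "appends OUT s (push 1 (reg a)) [s a 0] 2" if "a \<notin> OUT" for a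
    using that by (intro appends_push) (auto simp: same_def)
  have p1: "appends OUT s (push 1 (plus1 (reg SRC))) [Suc (s SRC 0)] 2"
    by (intro appends_push) (auto simp: same_def)
  have p2: "appends OUT s (push 1 (Get 0 (Const 1))) [length as] 2"
    using as(1) by (intro appends_push) (auto simp: same_def)
  have p3: "appends OUT s (push 1 (Add (reg COUNT) (Get 0 (Const 1)))) [s COUNT 0 + length as] 2"
    using as(1) by (intro appends_push) (auto simp: same_def)
  have c: "appends OUT s (copy a (Const 1) (reg a)) (arr (s a)) (2 + 4 * s a 0)" if "a \<notin> OUT" for a
    unfolding arr_eq_map by (intro appends_copy) (use that in \<open>auto simp: same_def\<close>)
  have c0: "appends OUT s (copy 0 (Const 2) (Get 0 (Const 1))) as (2 + 4 * length as)"
  proof -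
    have "as = map (\<lambda>i. s 0 (2 + i)) [0..<length as]"
      using as(2) by (intro nth_equalityI) auto
    moreover have "appends OUT s (copy 0 (Const 2) (Get 0 (Const 1)))
        (map (\<lambda>i. s 0 (2 + i)) [0..<length as]) (2 + 4 * length as)"
      by (intro appends_copy) (use as(1) in \<open>auto simp: same_def\<close>)
    ultimately show ?thesis by simp
  qed
  have tl: "appends OUT s (for_upto IDX (Get 0 (Const 1)) trap_body)
      (concat (map (\<lambda>i. [1] @ [0] @ [as ! i] @ [1] @ replicate (s VARS 0) 3) [0..<length as]))
      (2 + length as * (10 + 4 * s VARS 0 + 2))"
  proof (rule appends_for)
    fix i s' assume i: "i < length as" "same OUT s s'" "s' IDX 0 = i"
    have "OUT - {IDX} = {1, VIDX}" by auto
    moreover have "appends {1, VIDX} s' trap_body ([1] @ [0] @ [as ! i] @ [1] @ replicate (s VARS 0) 3) (10 + 4 * s VARS 0)"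
      using i as(2)[OF i(1)] by (intro appends_trap_body) (auto simp: same_def)
    ultimately show "appends (OUT - {IDX}) s' trap_body
        ([1] @ [0] @ [as ! i] @ [1] @ replicate (s VARS 0) 3) (10 + 4 * s VARS 0)" by simp
  qed (use as(1) in \<open>auto simp: same_def trap_body_def\<close>)
  have m: "map (\<lambda>i. [1] @ [0] @ [as ! i] @ [1] @ replicate (s VARS 0) 3) [0..<length as] =
      map (\<lambda>a. [1, 0, a, 1] @ replicate (s VARS 0) 3) as"
    by (intro nth_equalityI) auto
  have "appends OUT s write_code
    ([1] @ [Suc (s SRC 0)] @ arr (s SRC) @ [1] @ [length as] @ as @ [s VARS 0] @ [0] @ [s FINALS 0] @
      arr (s FINALS) @ [1] @ [s COUNT 0 + length as] @ arr (s TRANS) @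
      concat (map (\<lambda>i. [1] @ [0] @ [as ! i] @ [1] @ replicate (s VARS 0) 3) [0..<length as]))
    (2 + (2 + ((2 + 4 * s SRC 0) + (2 + (2 + ((2 + 4 * length as) + (2 + (2 + (2 + ((2 + 4 * s FINALS 0) +
      (2 + (2 + ((2 + 4 * s TRANS 0) + (2 + length as * (10 + 4 * s VARS 0 + 2)))))))))))))))"
    unfolding write_code_def by (intro appends_Seq p p1 p2 p3 reg c c0 tl) auto
  moreover have "2 + (2 + ((2 + 4 * s SRC 0) + (2 + (2 + ((2 + 4 * length as) + (2 + (2 + (2 + ((2 + 4 * s FINALS 0) +
      (2 + (2 + ((2 + 4 * s TRANS 0) + (2 + length as * (10 + 4 * s VARS 0 + 2)))))))))))))) =
    28 + 4 * s SRC 0 + 4 * s FINALS 0 + 4 * s TRANS 0 + length as * (16 + 4 * s VARS 0)"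
    by (simp add: algebra_simps)
  moreover have "[1] @ [Suc (s SRC 0)] @ arr (s SRC) @ [1] @ [length as] @ as @ [s VARS 0] @ [0] @ [s FINALS 0] @
      arr (s FINALS) @ [1] @ [s COUNT 0 + length as] @ arr (s TRANS) @
      concat (map (\<lambda>i. [1] @ [0] @ [as ! i] @ [1] @ replicate (s VARS 0) 3) [0..<length as]) =
    1 # Suc (s SRC 0) # arr (s SRC) @ [1] @ block as @ [s VARS 0, 0] @ block (arr (s FINALS)) @ [1] @
      [s COUNT 0 + length as] @ arr (s TRANS) @
      concat (map (\<lambda>a. [1, 0, a, 1] @ replicate (s VARS 0) 3) as)"
    unfolding m by (simp add: block_def)
  ultimately show ?thesis by (simp only:)
qed

lemma list_at_nth: "list_at f q xs \<longleftrightarrow> (\<forall>i<length xs. f (q + i) = xs ! i)"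
proof (induction xs arbitrary: q)
  case (Cons x xs)
  have "(\<forall>i<length (x # xs). f (q + i) = (x # xs) ! i) \<longleftrightarrow>
      f q = x \<and> (\<forall>i<length xs. f (Suc q + i) = xs ! i)"
    using All_less_Suc2[of "length xs" "\<lambda>i. f (q + i) = (x # xs) ! i"] by simp
  then show ?case using Cons.IH[of "Suc q"] by simp
qed simp

lemma len_le_size: "len \<alpha> \<le> 2 * rx_size \<alpha>"
  by (induction \<alpha>) auto

lemma rx_size_pos: "1 \<le> rx_size \<alpha>"
  by (induction \<alpha>) auto

lemma input_store_array: "a \<noteq> 0 \<Longrightarrow> input_store ns a = (\<lambda>_. 0)"
  by (auto simp: input_store_def)

lemma input_store_code:
  fixes as :: "nat list" and \<alpha> :: "(nat, nat) rx" and i :: nat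
  defines "s \<equiv> input_store (input_code as \<alpha>)"
  shows "s 0 0 = Suc (length as + len \<alpha>)" "s 0 1 = length as"
    "i < length as \<Longrightarrow> s 0 (2 + i) = as ! i" "list_at (s 0) (length as + 2) (rx_code \<alpha>)"
proof -
  have s: "s 0 i = (Suc (length as + len \<alpha>) # length as # as @ rx_code \<alpha>) ! i"
    if "i \<le> Suc (length as + len \<alpha>)" for i
    using that by (simp add: s_def input_store_def input_code_def block_def)
  show "s 0 0 = Suc (length as + len \<alpha>)" "s 0 1 = length as" using s[of 0] s[of 1] by simp_all
  show "i < length as \<Longrightarrow> s 0 (2 + i) = as ! i" using s[of "2 + i"] by (simp add: nth_append)
  show "list_at (s 0) (length as + 2) (rx_code \<alpha>)"
    unfolding list_at_nth using s by (simp add: nth_append)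
qed

section \<open>Running time and correctness of the compiler\<close>

context regex_graph
begin

definition compile_cost :: nat where
  "compile_cost = 32 * len \<alpha> + 51 + (occurrences \<alpha> + 1) * (source_cost + 2) + 8 * (occurrences \<alpha> + 1) +
     4 * ((occurrences \<alpha> + 1) * card A * (k + 4)) + card A * (16 + 4 * k)"

text \<open>All summands are at most multiples of the product \<open>W\<close>. The initial state
  makes n + 1 sources, at most twice the maximum of 1 and n; the sum of the coefficients stays well
  below 1200.\<close>

lemma compile_cost_bound:
  assumes "1 \<le> card A"
  shows "compile_cost \<le> 1200 * (card A * rx_size \<alpha> * max 1 (occurrences \<alpha>))"
proof -
  define a z n W where "a = card A" and "z = rx_size \<alpha>" and "n = max 1 (occurrences \<alpha>)" and "W = a * z * n"
  have ge: "1 \<le> a" "1 \<le> z" "1 \<le> n" using assms rx_size_pos by (simp_all add: a_def z_def n_def)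
  have az: "a * z \<le> W" using ge by (simp add: W_def)
  have zl: "z \<le> a * z" "a \<le> a * z" using ge by simp_all
  have an: "n \<le> W"
  proof -
    have "1 * n \<le> (a * z) * n" using ge by (intro mult_right_mono) (simp_all add: Suc_le_eq)
    then show ?thesis by (simp add: W_def)
  qed
  have occ: "occurrences \<alpha> + 1 \<le> 2 * n" by (simp add: n_def)
  have l: "len \<alpha> \<le> 2 * z" using len_le_size by (simp add: z_def)
  have k: "k \<le> 2 * z" using length_var_list[of \<alpha>] l by simp
  have nd: "nodes \<le> 6 * z" using l ge by (simp add: nodes_def)
  have "7 * k + 5 * nodes + 18 \<le> 62 * z" using k nd ge by linarith
  then have "a * (7 * k + 5 * nodes + 18) \<le> a * (62 * z)" by (rule mult_left_mono) simp
  then have "a * (7 * k + 5 * nodes + 18) \<le> 62 * (a * z)" by (simp only: mult.left_commute)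
  \<comment> \<open>Here 299 = 36 * 6 + 62 + 21, with \<open>nodes\<close> at most
    \<open>6 * z\<close>.\<close>
  then have sc: "source_cost + 2 \<le> 299 * (a * z)"
    using nd zl ge unfolding source_cost_def a_def[symmetric] by linarith
  have 1: "(occurrences \<alpha> + 1) * (source_cost + 2) \<le> 598 * W"
    using mult_le_mono[OF occ sc] by (simp add: W_def mult.assoc mult.left_commute mult.commute)
  have "(occurrences \<alpha> + 1) * a * (k + 4) \<le> (2 * n) * a * (6 * z)"
    using occ k ge by (intro mult_le_mono) auto
  then have 2: "(occurrences \<alpha> + 1) * a * (k + 4) \<le> 12 * W"
    by (simp add: W_def mult.assoc mult.left_commute mult.commute)
  have "a * (16 + 4 * k) \<le> a * (24 * z)" using k ge by (intro mult_le_mono) auto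
  also have "\<dots> = 24 * (a * z)" by simp
  also have "\<dots> \<le> 24 * W" using az by simp
  finally have 3: "a * (16 + 4 * k) \<le> 24 * W" .
  have sum: "32 * u + 51 + x + 8 * v + 4 * y + w \<le> 1200 * W"
    if "x \<le> 598 * W" "y \<le> 12 * W" "w \<le> 24 * W" "u \<le> 2 * z" "v \<le> 2 * n" for u v w x y
    using that an az zl ge by linarith
  have "compile_cost \<le> 1200 * W"
    unfolding compile_cost_def a_def[symmetric] by (rule sum[OF 1 2 3 l occ])
  then show ?thesis by (simp add: W_def a_def z_def n_def)
qed

text \<open>In the deterministic case \<open>extra_delta\<close> is empty, so the core transitions
  collected in \<open>ts\<close> and the loops at the trap are all there is to write.\<close>

lemma listed_code:
  assumes det: "deterministic_rx \<alpha>" and l: "listed (0 # letters p0 \<alpha>) s" and as: "distinct as" "set as = A"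
  shows "is_tmfa_code automaton (Suc (length (0 # letters p0 \<alpha>)) # (0 # letters p0 \<alpha>) @ [1] @ block as @ [k, 0] @
      block (arr (s FINALS)) @ [1] @ [s COUNT 0 + length as] @ arr (s TRANS) @
      concat (map (\<lambda>a. [1, 0, a, 1] @ replicate k 3) as))"
    and "s FINALS 0 \<le> occurrences \<alpha> + 1" "s TRANS 0 \<le> (occurrences \<alpha> + 1) * card A * (k + 4)"
proof -
  let ?S = "0 # letters p0 \<alpha>"
  obtain ts where ts: "arr (s TRANS) = concat (map transition_code ts)" "s COUNT 0 = length ts"
    "distinct ts" "set ts = (\<Union>s\<in>set ?S. out_edges s UNIV)" "length ts \<le> length ?S * card A"
    and fin: "arr (s FINALS) = filter (\<lambda>s. s \<in> final automaton) ?S"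
    using l unfolding listed_def by blast
  define traps where "traps = map (\<lambda>a. (1 :: nat, LTerm a, 1 :: nat, replicate k AKeep)) as"
  have dS: "distinct ?S" using distinct_letters letters_range[of p0 \<alpha>] p0 by auto
  have ge: "1 \<notin> set ?S" using letters_range[of p0 \<alpha>] p0 by auto
  have src: "s \<in> set ?S" if "source s a" for s a
    using source_cases[OF that] set_letters_iff by auto
  have states: "distinct (?S @ [1])" "set (?S @ [1]) = states automaton" using dS ge by auto
  have "final automaton \<subseteq> set ?S" using src by (auto simp: automaton_def)
  then have finals: "distinct (arr (s FINALS))" "set (arr (s FINALS)) = final automaton"
    unfolding fin using dS by auto
  have core: "set ts = {(q, b, p, ss). (p, ss) \<in> core_delta q b}"
  proof -
    have "q \<in> set ?S" if "(p, ss) \<in> core_delta q b" for q b p ss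
      using that src unfolding core_delta_def by blast
    then show ?thesis unfolding ts(4) out_edges_def by blast
  qed
  have trap: "set traps = {(q, b, p, ss). (p, ss) \<in> trap_delta q b}"
    using as(2) by (auto simp: traps_def trap_delta_def split: if_splits)
  have "extra_delta q b = {}" for q b using det by (simp add: extra_delta_def deterministic_rx_def)
  then have tset: "set (ts @ traps) = {(q, b, p, ss). (p, ss) \<in> delta automaton q b}"
    unfolding set_append core trap delta_automaton by blast
  have "set ts \<inter> set traps = {}"
    unfolding core using core_delta_1 by (auto simp: traps_def)
  moreover have "distinct traps" using as(1) by (auto simp: traps_def distinct_map inj_on_def)
  ultimately have dts: "distinct (ts @ traps)" using ts(3) by simp
  have tc: "map transition_code traps = map (\<lambda>a. [1, 0, a, 1] @ replicate k 3) as"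
    by (simp add: traps_def)
  have code: "Suc (length ?S) # ?S @ [1] @ block as @ [k, 0] @ block (arr (s FINALS)) @ [1] @
      [s COUNT 0 + length as] @ arr (s TRANS) @ concat (map (\<lambda>a. [1, 0, a, 1] @ replicate k 3) as) =
    block (?S @ [1]) @ block as @ [memories automaton, init automaton] @ block (arr (s FINALS)) @
      [trap automaton] @ [length (ts @ traps)] @ concat (map transition_code (ts @ traps))"
    unfolding map_append concat_append tc ts(1)[symmetric] by (simp add: block_def ts(2) traps_def)
  show "is_tmfa_code automaton (Suc (length ?S) # ?S @ [1] @ block as @ [k, 0] @
      block (arr (s FINALS)) @ [1] @ [s COUNT 0 + length as] @ arr (s TRANS) @
      concat (map (\<lambda>a. [1, 0, a, 1] @ replicate k 3) as))"
    unfolding is_tmfa_code_def code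
    by (intro exI[of _ "?S @ [1]"] exI[of _ as] exI[of _ "arr (s FINALS)"] exI[of _ "ts @ traps"] conjI
        states finals dts tset refl as(1)) (simp add: as(2))
  have "length (arr (s FINALS)) \<le> length ?S" unfolding fin by (rule length_filter_le)
  then show "s FINALS 0 \<le> occurrences \<alpha> + 1" by (simp add: length_letters)
  have "length (transition_code t) = k + 4" if "t \<in> set ts" for t
  proof -
    obtain q b p ss where t: "t = (q, b, p, ss)" by (cases t)
    with that core have "length ss = k" using core_delta_D(2) by blast
    then show ?thesis unfolding t by (cases b) simp_all
  qed
  then have "length (arr (s TRANS)) = length ts * (k + 4)"
    unfolding ts(1) by (intro concat_transition_length) blast
  also have "\<dots> \<le> (occurrences \<alpha> + 1) * card A * (k + 4)"
    using ts(5) by (intro mult_right_mono) (simp_all add: length_letters)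
  finally show "s TRANS 0 \<le> (occurrences \<alpha> + 1) * card A * (k + 4)" by simp
qed

lemma run_compile:
  assumes as: "distinct as" "set as = A" and A: "A \<noteq> {}" and p: "p0 = card A + 2"
  shows "run compile (input_store (input_code as \<alpha>)) (\<lambda>t s. t \<le> compile_cost \<and>
    (if deterministic_rx \<alpha> then \<exists>ns. result_of s = 1 # ns \<and> is_tmfa_code automaton ns else result_of s = [0]))"
proof -
  define s where "s = input_store (input_code as \<alpha>)"
  note inp = input_store_code[where as = as and \<alpha> = \<alpha>, folded s_def]
  have zero: "s a = (\<lambda>_. 0)" if "a \<noteq> 0" for a unfolding s_def using that by (rule input_store_array)
  have ca: "card A = length as" using as distinct_card by blast
  have em: "arr (\<lambda>_. 0) = []" by (simp add: arr_def)
  let ?R = "\<lambda>s. if deterministic_rx \<alpha> then \<exists>ns. result_of s = 1 # ns \<and> is_tmfa_code automaton ns else result_of s = [0]"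
  have "run compile s (\<lambda>t s. t \<le> compile_cost \<and> ?R s)"
    unfolding compile_def
  proof (rule run_SeqI[OF run_same[OF run_build]])
    have pa: "length as + 2 = p0" using p ca by simp
    show "Suc (s 0 0) = K" unfolding inp(1) K_def using pa by linarith
    show "s 0 1 + 2 = p0" unfolding inp(2) by (rule pa)
    show "list_at (s 0) p0 (rx_code \<alpha>)" using inp(4) unfolding pa .
    show "s SRC = (\<lambda>_. 0)" "s VARS = (\<lambda>_. 0)" "s MEM = (\<lambda>_. 0)" by (simp_all add: zero)
    fix t1 :: nat and s1 :: store
    assume a1: "(built s1 \<and> t1 \<le> 32 * len \<alpha> + 18) \<and> same (writes build) s s1"
    then have old1: "s1 a = s a" if "a \<notin> writes build" for a using that by (simp add: same_def)
    show "run (Seq sources (Cond (Equal (reg OK) (Const 0)) (push 1 (Const 0)) write_code)) s1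
      (\<lambda>t2 s'. t1 + t2 \<le> compile_cost \<and> ?R s')"
    proof (rule run_SeqI[OF run_same[OF run_sources]])
      show "built s1" using a1 by blast
      show "s1 VIS = (\<lambda>_. 0)" "s1 SEEN = (\<lambda>_. 0)" "s1 TRANS = (\<lambda>_. 0)" "s1 FINALS = (\<lambda>_. 0)" "s1 COUNT = (\<lambda>_. 0)"
        by (simp_all add: old1 writes_build zero)
      fix t2 :: nat and s2 :: store
      assume a2: "(s2 OK 0 = (if deterministic_rx \<alpha> then 1 else 0) \<and>
        (deterministic_rx \<alpha> \<longrightarrow> listed (0 # letters p0 \<alpha>) s2) \<and>
        t2 \<le> 3 + (occurrences \<alpha> + 1) * (source_cost + 2)) \<and> same (writes sources) s1 s2"
      then have old2: "s2 a = s1 a" if "a \<notin> writes sources" for a using that by (simp add: same_def)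
      have o1: "s2 1 = (\<lambda>_. 0)" and o0: "s2 0 = s 0"
        by (simp_all add: old1 old2 writes_build writes_sources writes_source_body zero)
      have SV: "s2 SRC = s1 SRC" "s2 VARS = s1 VARS"
        by (simp_all add: old2 writes_sources writes_source_body)
      with a1 have S: "arr (s2 SRC) = 0 # letters p0 \<alpha>" and V: "arr (s2 VARS) = vs"
        by (simp_all add: built_def)
      then have Sl: "s2 SRC 0 = length (0 # letters p0 \<alpha>)" and Vl: "s2 VARS 0 = k"
        by (metis length_arr)+
      show "run (Cond (Equal (reg OK) (Const 0)) (push 1 (Const 0)) write_code) s2
        (\<lambda>t3 s'. t1 + (t2 + t3) \<le> compile_cost \<and> ?R s')"
      proof (cases "deterministic_rx \<alpha>")
        case False
        have "result_of (pushed s2 1 0) = [0]"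
          unfolding result_of_arr arr_pushed o1 em by simp
        with False a1 a2 show ?thesis by (simp add: compile_cost_def)
      next
        case True
        with a2 have l: "listed (0 # letters p0 \<alpha>) s2" and ok: "s2 OK 0 = 1" by simp_all
        note code = listed_code[OF True l as]
        have "appends OUT s2 write_code
          (1 # Suc (s2 SRC 0) # arr (s2 SRC) @ [1] @ block as @ [s2 VARS 0, 0] @ block (arr (s2 FINALS)) @ [1] @
            [s2 COUNT 0 + length as] @ arr (s2 TRANS) @
            concat (map (\<lambda>a. [1, 0, a, 1] @ replicate (s2 VARS 0) 3) as))
          (28 + 4 * s2 SRC 0 + 4 * s2 FINALS 0 + 4 * s2 TRANS 0 + length as * (16 + 4 * s2 VARS 0))"
          by (rule appends_write_code) (use inp(2,3) in \<open>simp_all add: o0\<close>)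
        then have "run write_code s2 (\<lambda>t s'. arr (s' 1) = arr (s2 1) @
          (1 # Suc (s2 SRC 0) # arr (s2 SRC) @ [1] @ block as @ [s2 VARS 0, 0] @ block (arr (s2 FINALS)) @ [1] @
            [s2 COUNT 0 + length as] @ arr (s2 TRANS) @
            concat (map (\<lambda>a. [1, 0, a, 1] @ replicate (s2 VARS 0) 3) as)) \<and>
          t \<le> 28 + 4 * s2 SRC 0 + 4 * s2 FINALS 0 + 4 * s2 TRANS 0 + length as * (16 + 4 * s2 VARS 0) \<and>
          same OUT s2 s')"
          unfolding appends_def by simp
        then have "run write_code s2 (\<lambda>t3 s'. t1 + (t2 + Suc t3) \<le> compile_cost \<and> ?R s')"
        proof (rule run_mono)
          fix t3 :: nat and s3 :: store
          assume a3: "arr (s3 1) = arr (s2 1) @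
          (1 # Suc (s2 SRC 0) # arr (s2 SRC) @ [1] @ block as @ [s2 VARS 0, 0] @ block (arr (s2 FINALS)) @ [1] @
            [s2 COUNT 0 + length as] @ arr (s2 TRANS) @
            concat (map (\<lambda>a. [1, 0, a, 1] @ replicate (s2 VARS 0) 3) as)) \<and>
          t3 \<le> 28 + 4 * s2 SRC 0 + 4 * s2 FINALS 0 + 4 * s2 TRANS 0 + length as * (16 + 4 * s2 VARS 0) \<and>
          same OUT s2 s3"
          have "?R s3"
            using code(1) True a3 unfolding result_of_arr o1 em S Sl Vl append_Nil by auto
          moreover have "t3 \<le> 28 + 4 * (occurrences \<alpha> + 1) + 4 * (occurrences \<alpha> + 1) +
              4 * ((occurrences \<alpha> + 1) * card A * (k + 4)) + card A * (16 + 4 * k)"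
          proof -
            have "s2 SRC 0 = occurrences \<alpha> + 1" unfolding Sl by (simp add: length_letters)
            moreover have "t3 \<le> 28 + 4 * s2 SRC 0 + 4 * s2 FINALS 0 + 4 * s2 TRANS 0 + card A * (16 + 4 * k)"
              using a3 unfolding Vl ca[symmetric] by blast
            moreover have "t \<le> 28 + 4 * x + 4 * x + 4 * u + v"
              if "y = x" "t \<le> 28 + 4 * y + 4 * z + 4 * w + v" "z \<le> x" "w \<le> u" for t x y z u v w :: nat
              using that by linarith
            ultimately show ?thesis using code(2,3) by blast
          qed
          moreover have "u + (v + Suc w) \<le> 32 * l + 51 + x + 8 * y + 4 * z + c"
            if "u \<le> 32 * l + 18" "v \<le> 3 + x" "w \<le> 28 + 4 * y + 4 * y + 4 * z + c" for u v w x y z l c :: nat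
            using that by linarith
          ultimately show "t1 + (t2 + Suc t3) \<le> compile_cost \<and> ?R s3"
            using a1 a2 unfolding compile_cost_def by blast
        qed
        with ok show ?thesis by simp
      qed
    qed (rule A)
  qed
  then show ?thesis unfolding s_def .
qed

end

theorem theorem4:
  shows "\<exists>M :: nat set \<Rightarrow> (nat, nat) rx \<Rightarrow> (nat, nat) tmfa.
    (\<forall>A \<alpha>. finite A \<and> card A \<ge> 2 \<and> \<alpha> \<in> RX A \<longrightarrow>
        is_tmfa_rej (M A \<alpha>) \<and>
        alphabet (M A \<alpha>) = A \<and>
        card (states (M A \<alpha>)) = occurrences \<alpha> + 2 \<and>
        tmfa_lang (M A \<alpha>) = rx_lang \<alpha> \<and>
        (deterministic_tmfa (M A \<alpha>) \<longleftrightarrow> deterministic_rx \<alpha>)) \<and>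
    (\<exists>(P :: prog) (C :: nat). \<forall>A as \<alpha>.
        finite A \<and> card A \<ge> 2 \<and> \<alpha> \<in> RX A \<and> distinct as \<and> set as = A \<longrightarrow>
        (\<exists>t s.
           exec P (input_store (input_code as \<alpha>)) t s \<and>
           t \<le> C * (card A * rx_size \<alpha> * max 1 (occurrences \<alpha>)) \<and>
           (if deterministic_rx \<alpha>
            then \<exists>ns. result_of s = 1 # ns \<and> is_tmfa_code (M A \<alpha>) ns
            else result_of s = [0])))"
proof -
  \<comment> \<open>With this offset the nodes of the graph are the cells of the input array, and
    the numbers 0 and 1 remain free for the initial state and the trap.\<close>
  define M where "M A \<alpha> = regex_graph.automaton A \<alpha> (card A + 2)" for A \<alpha>
  have graph: "regex_graph A \<alpha> (card A + 2)" if "finite A" "\<alpha> \<in> RX A" for A \<alpha>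
    using that by unfold_locales auto
  have automaton: "is_tmfa_rej (M A \<alpha>) \<and> alphabet (M A \<alpha>) = A \<and> card (states (M A \<alpha>)) = occurrences \<alpha> + 2 \<and>
      tmfa_lang (M A \<alpha>) = rx_lang \<alpha> \<and> (deterministic_tmfa (M A \<alpha>) \<longleftrightarrow> deterministic_rx \<alpha>)"
    if "finite A \<and> card A \<ge> 2 \<and> \<alpha> \<in> RX A" for A \<alpha>
  proof -
    interpret regex_graph A \<alpha> "card A + 2" using that graph by blast
    show ?thesis
      unfolding M_def
      by (intro conjI automaton_rej automaton_sel(2) card_states automaton_lang deterministic_automaton)
  qed
  have program: "\<exists>t s. exec compile (input_store (input_code as \<alpha>)) t s \<and>
      t \<le> 1200 * (card A * rx_size \<alpha> * max 1 (occurrences \<alpha>)) \<and>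
      (if deterministic_rx \<alpha> then \<exists>ns. result_of s = 1 # ns \<and> is_tmfa_code (M A \<alpha>) ns
       else result_of s = [0])"
    if "finite A \<and> card A \<ge> 2 \<and> \<alpha> \<in> RX A \<and> distinct as \<and> set as = A" for A as \<alpha>
  proof -
    interpret regex_graph A \<alpha> "card A + 2" using that graph by blast
    have "A \<noteq> {}" "1 \<le> card A" using that by auto
    then show ?thesis
      using run_compile[of as] compile_cost_bound that unfolding run_def M_def by (meson le_trans)
  qed
  show ?thesis
    by (rule exI[of _ M], rule conjI, intro allI impI, erule automaton,
        rule exI[of _ compile], rule exI[of _ 1200], intro allI impI, erule program)
qed

end
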